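(* Let $\psi$ be a modified ruin probability for the mixed-Poisson Cramér-Lundberg model described in the context. Fix $\ell\in(0,c/\mu)$. Assume that $$\psi_{\rm cl}(u,\ell)\sim c_\ell e^{-R_\ell u},\qquad u\to\infty,$$ for some constants $c_\ell,R_\ell>0$. If $\psi$ is continuous or monotone on $(-\infty,0)$, then $$\psi_\ell(u)\sim C_\ell\,\psi_{\rm cl}(u,\ell),\qquad u\to\infty,$$ where $$C_\ell:=\int_{(-\infty,0)}\psi(y)\,\nu_\ell(\mathrm{d}y)$$ and the probability measure $\nu_\ell$ is determined by $$\nu_\ell((-\infty,-x])=\frac{1}{c-\ell\mu}\left(ce^{-R_\ell x}-\ell\int_0^x e^{-R_\ell(x-z)}\bar F(z)\,\mathrm{d}z-\ell\int_x^{\infty}\bar F(z)\,\mathrm{d}z\right),\qquad x\ge0.$$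
   Context: Model. For initial capital $u$ and premium rate $c>0$, let $U_t=u+ct-\sum_{i=1}^{N_t}X_i$, $t\ge0$, under the probability $\mathbb{P}_u$. The claim sizes $X_1,X_2,\dots$ are i.i.d. positive random variables with distribution function $F$, tail $\bar F=1-F$ and finite mean $\mu=\mathbb{E}[X_1]$. The claim number process $(N_t)_{t\ge0}$ is a mixed Poisson process with nonnegative mixing variable $\Lambda$ having distribution function $G$ (conditionally on $\Lambda=\ell$, it is a homogeneous Poisson process of rate $\ell$), and it is independent of the claim sizes. Classical ruin. The ruin time is $T:=\inf\{t>0:U_t<0\}$. For fixed intensity $\ell$, $\psi_{\rm cl}(u,\ell):=\mathbb{P}_u(T<\infty\mid\Lambda=\ell)$; here and below conditioning on $\Lambda=\ell$ means that the claim number process is Poisson with rate $\ell$. Modified ruin. A modified ruin probability is a measurable function $\psi:\mathbb{R}\to[0,1]$ such that $$\psi(u)=\int_{(-\infty,0)}\psi(y)\,\mathbb{P}_u(U_T\in \mathrm{d}y,\,T<\infty),\qquad u\ge0.$$ For fixed intensity $\ell$ and $u\ge0$, set $$\psi_\ell(u):=\int_{(-\infty,0)}\psi(y)\,\mathbb{P}_u(U_T\in \mathrm{d}y,\,T<\infty\mid\Lambda=\ell).$$ Notation. $f(u)\sim g(u)$ as $u\to\infty$ means $f(u)=(1+o(1))g(u)$. *)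

theory Defs
  imports "HOL-Probability.Probability" "HOL-Library.Landau_Symbols"
begin

section \<open>Claim number processes\<close>

locale counting_process = prob_space M
  for M :: "'a measure" and N :: "real \<Rightarrow> 'a \<Rightarrow> nat" +
  assumes N_measurable: "0 \<le> t \<Longrightarrow> N t \<in> measurable M (count_space UNIV)"
    and N_zero: "\<omega> \<in> space M \<Longrightarrow> N 0 \<omega> = 0"
    and N_mono: "\<omega> \<in> space M \<Longrightarrow> mono_on {0..} (\<lambda>t. N t \<omega>)"
    and N_right_cont: "\<omega> \<in> space M \<Longrightarrow> 0 \<le> t \<Longrightarrow> continuous (at_right t) (\<lambda>s. N s \<omega>)"

locale poisson_process = counting_process M N
  for M :: "'a measure" and N :: "real \<Rightarrow> 'a \<Rightarrow> nat" +
  fixes rate :: real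
  assumes rate_pos: "0 < rate"
    and indep_increments:
      "0 \<le> t 0 \<Longrightarrow> (\<And>i. i < n \<Longrightarrow> t i < t (Suc i)) \<Longrightarrow>
        indep_vars (\<lambda>_. count_space UNIV) (\<lambda>i \<omega>. N (t (Suc i)) \<omega> - N (t i) \<omega>) {..<n::nat}"
    and increments_distr:
      "0 \<le> s \<Longrightarrow> s < r \<Longrightarrow>
        distr M (count_space UNIV) (\<lambda>\<omega>. N r \<omega> - N s \<omega>) = measure_pmf (poisson_pmf (rate * (r - s)))"

text \<open>
  Conditionally on \<open>\<Lambda> = l\<close>, the process is Poisson with rate \<open>l\<close>; this is expressed by integrating
  the conditional law of the increments, i.e. the product of Poisson weights, against the
  distribution of \<open>\<Lambda>\<close>. The weights are written out because \<^const>\<open>poisson_pmf\<close> does not cover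
  rate 0, whereas \<open>\<Lambda>\<close> may have an atom at 0.
\<close>
locale mixed_poisson_process = counting_process M N
  for M :: "'a measure" and N :: "real \<Rightarrow> 'a \<Rightarrow> nat" +
  fixes \<Lambda> :: "'a \<Rightarrow> real"
  assumes \<Lambda>_measurable: "\<Lambda> \<in> borel_measurable M"
    and \<Lambda>_nonneg: "AE \<omega> in M. 0 \<le> \<Lambda> \<omega>"
    and cond_increments:
      "0 \<le> t 0 \<Longrightarrow> (\<And>i. i < n \<Longrightarrow> t i < t (Suc i)) \<Longrightarrow> B \<in> sets borel \<Longrightarrow>
        prob {\<omega> \<in> space M. \<Lambda> \<omega> \<in> B \<and> (\<forall>i<n. N (t (Suc i)) \<omega> - N (t i) \<omega> = k i)} =
        (LINT l:B|distr M borel \<Lambda>. (\<Prod>i<n::nat.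
           (l * (t (Suc i) - t i)) ^ k i / fact (k i) * exp (- (l * (t (Suc i) - t i)))))"


section \<open>Claim sizes and the risk models\<close>

text \<open>Claims are \<open>X 1, X 2, \<dots>\<close>; the value \<open>X 0\<close> is never used.\<close>
locale claim_sizes = prob_space M
  for M :: "'a measure" and X :: "nat \<Rightarrow> 'a \<Rightarrow> real" and F :: "real \<Rightarrow> real" +
  assumes X_indep: "indep_vars (\<lambda>_. borel) X {1..}"
    and X_cdf: "1 \<le> i \<Longrightarrow> cdf (distr M borel (X i)) = F"
    and X_pos: "1 \<le> i \<Longrightarrow> AE \<omega> in M. 0 < X i \<omega>"
    and X_integrable: "integrable M (X 1)"

text \<open>
  Independence of the two processes is that of the generated sigma-algebras
  (\<^const>\<open>prob_space.indep_var\<close> would force both processes to have the same type).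
\<close>
locale claims_model = counting_process M N + claim_sizes M X F
  for M :: "'a measure" and N :: "real \<Rightarrow> 'a \<Rightarrow> nat"
    and X :: "nat \<Rightarrow> 'a \<Rightarrow> real" and F :: "real \<Rightarrow> real" +
  assumes N_X_indep:
    "indep_set
       (sets (vimage_algebra (space M) (\<lambda>\<omega>. \<lambda>t\<in>{0..}. N t \<omega>) (PiM {0..} (\<lambda>_. count_space UNIV))))
       (sets (vimage_algebra (space M) (\<lambda>\<omega>. \<lambda>i\<in>{1..}. X i \<omega>) (PiM {1..} (\<lambda>_. borel))))"

locale poisson_claims_model = claims_model M N X F + poisson_process M N rate
  for M :: "'a measure" and N :: "real \<Rightarrow> 'a \<Rightarrow> nat"
    and X :: "nat \<Rightarrow> 'a \<Rightarrow> real" and F :: "real \<Rightarrow> real" and rate :: real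

locale mixed_poisson_claims_model = claims_model M N X F + mixed_poisson_process M N \<Lambda>
  for M :: "'a measure" and N :: "real \<Rightarrow> 'a \<Rightarrow> nat"
    and X :: "nat \<Rightarrow> 'a \<Rightarrow> real" and F :: "real \<Rightarrow> real" and \<Lambda> :: "'a \<Rightarrow> real"


section \<open>Ruin\<close>

text \<open>
  The initial capital \<open>u\<close> is a parameter of the surplus, so one measure on the claim processes
  replaces the family \<open>P\<^sub>u\<close>.
\<close>
definition surplus ::
  "real \<Rightarrow> (real \<Rightarrow> 'a \<Rightarrow> nat) \<Rightarrow> (nat \<Rightarrow> 'a \<Rightarrow> real) \<Rightarrow> real \<Rightarrow> real \<Rightarrow> 'a \<Rightarrow> real" where
  "surplus c N X u t \<omega> = u + c * t - (\<Sum>i=1..N t \<omega>. X i \<omega>)"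

definition ruin_time ::
  "real \<Rightarrow> (real \<Rightarrow> 'a \<Rightarrow> nat) \<Rightarrow> (nat \<Rightarrow> 'a \<Rightarrow> real) \<Rightarrow> real \<Rightarrow> 'a \<Rightarrow> ereal" where
  "ruin_time c N X u \<omega> = Inf {ereal t | t. 0 < t \<and> surplus c N X u t \<omega> < 0}"

definition ruin_prob ::
  "'a measure \<Rightarrow> real \<Rightarrow> (real \<Rightarrow> 'a \<Rightarrow> nat) \<Rightarrow> (nat \<Rightarrow> 'a \<Rightarrow> real) \<Rightarrow> real \<Rightarrow> real" where
  "ruin_prob M c N X u = measure M {\<omega> \<in> space M. ruin_time c N X u \<omega> < \<infinity>}"

text \<open>The sub-probability measure \<open>P\<^sub>u(U\<^sub>T \<in> dy, T < \<infinity>)\<close>.\<close>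
definition ruin_law ::
  "'a measure \<Rightarrow> real \<Rightarrow> (real \<Rightarrow> 'a \<Rightarrow> nat) \<Rightarrow> (nat \<Rightarrow> 'a \<Rightarrow> real) \<Rightarrow> real \<Rightarrow> real measure" where
  "ruin_law M c N X u =
     distr (restrict_space M {\<omega> \<in> space M. ruin_time c N X u \<omega> < \<infinity>}) borel
       (\<lambda>\<omega>. surplus c N X u (real_of_ereal (ruin_time c N X u \<omega>)) \<omega>)"

definition ruin_integral ::
  "'a measure \<Rightarrow> real \<Rightarrow> (real \<Rightarrow> 'a \<Rightarrow> nat) \<Rightarrow> (nat \<Rightarrow> 'a \<Rightarrow> real) \<Rightarrow> (real \<Rightarrow> real) \<Rightarrow> real \<Rightarrow> real" where
  "ruin_integral M c N X \<psi> u = (LINT y:{..<0}|ruin_law M c N X u. \<psi> y)"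

definition modified_ruin_probability ::
  "'a measure \<Rightarrow> real \<Rightarrow> (real \<Rightarrow> 'a \<Rightarrow> nat) \<Rightarrow> (nat \<Rightarrow> 'a \<Rightarrow> real) \<Rightarrow> (real \<Rightarrow> real) \<Rightarrow> bool" where
  "modified_ruin_probability M c N X \<psi> \<longleftrightarrow>
     \<psi> \<in> borel_measurable borel \<and> (\<forall>y. 0 \<le> \<psi> y \<and> \<psi> y \<le> 1) \<and>
     (\<forall>u\<ge>0. \<psi> u = ruin_integral M c N X \<psi> u)"

text \<open>
  A probability measure on the reals satisfying this puts no mass on \<open>[0,\<infinity>)\<close>: the right-hand side
  equals 1 at \<open>x = 0\<close> (when \<open>\<mu>\<close> is the mean of \<open>F\<close>) and is continuous there.
\<close>
definition limit_deficit_law ::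
  "real \<Rightarrow> real \<Rightarrow> real \<Rightarrow> (real \<Rightarrow> real) \<Rightarrow> real \<Rightarrow> real measure \<Rightarrow> bool" where
  "limit_deficit_law c l \<mu> F R \<nu> \<longleftrightarrow>
     prob_space \<nu> \<and> sets \<nu> = sets borel \<and>
     (\<forall>x\<ge>0. measure \<nu> {..-x} =
        1 / (c - l * \<mu>) *
          (c * exp (- R * x)
           - l * (LBINT z:{0..x}. exp (- R * (x - z)) * (1 - F z))
           - l * (LBINT z:{x..}. 1 - F z)))"

end

theory Submission
  imports Defs
begin

text \<open>
  Write \<open>B = 1 - F\<close> and \<open>I(x)\<close> for the integral of \<open>B\<close> over \<open>(x,\<infinity>)\<close>. Looking at the surplus only at multiples
  of \<open>h\<close> and letting \<open>h \<rightarrow> 0\<close> in the one-step equation of the resulting random walk shows that the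
  probability \<open>\<phi>\<^sub>a(u)\<close> of ruin with deficit exceeding \<open>a\<close> solves the defective renewal equation
  \<open>c \<phi>\<^sub>a(u) = l I(u + a) + l (\<phi>\<^sub>a * B)(u)\<close>; the constant \<open>\<phi>\<^sub>a(0)\<close> is found by letting \<open>u \<rightarrow> \<infinity>\<close>, where ruin
  becomes improbable by hypothesis. Since \<open>l \<mu> < c\<close>, bounded solutions are unique, and comparing the
  equations for \<open>\<phi>\<^sub>a\<close> and for the ruin probability \<open>\<phi>\<^sub>0\<close> gives the exact identity
  \<open>(c - l \<mu>) \<phi>\<^sub>a(u) = c \<phi>\<^sub>0(u + a) - l \<integral>\<^sub>0\<^sup>a \<phi>\<^sub>0(u + a - z) B(z) dz - l \<phi>\<^sub>0(u) I(a)\<close>.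
  Dividing by \<open>\<phi>\<^sub>0(u)\<close>, the exponential asymptotics of \<open>\<phi>\<^sub>0\<close> yields weak convergence of the conditional
  law of the deficit to \<open>\<nu>\<^sub>l\<close>, which has no atoms, so that the at most countably many discontinuities
  of \<open>\<psi>\<close> do not matter. If \<open>C\<^sub>l = 0\<close>, the asymptotic equivalence requires \<open>\<psi>\<^sub>l\<close> to vanish: then \<open>\<psi>\<close> is
  zero on the support of \<open>\<nu>\<^sub>l\<close>, and no deficit can exceed the largest possible claim.
\<close>

section \<open>First passage and its time discretisation\<close>

text \<open>The hypotheses describe the claim number process only through increments over finitely
  many fixed times, so conditioning on the first claim would first require the law of the jump times
  and a strong Markov property. On a grid the increments and the claims form two independent i.i.d.
  sequences, and the one-step equation is a computation with product measures. The price is that the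
  limit function is known only as a pointwise limit and only to be right-continuous; the difference
  quotient is therefore moved onto a piecewise linear test function, which yields an integrated
  equation at once. \<open>R\<close> enters only through the assumed asymptotics, and no Lundberg
  equation is solved. The formula for \<nu> is nonnegative and monotone because it is a limit of
  conditional probabilities, although neither property is visible in it. The case of a vanishing
  constant asks for exact zeros, about which asymptotics say nothing. It rests on a deficit bound
  that is uniform in \<open>u\<close> and on the strict decrease of the limiting tail as long as
  larger claims are possible.\<close>

definition ruins_below ::
  "real \<Rightarrow> (real \<Rightarrow> 'a \<Rightarrow> nat) \<Rightarrow> (nat \<Rightarrow> 'a \<Rightarrow> real) \<Rightarrow> real \<Rightarrow> real \<Rightarrow> 'a \<Rightarrow> bool" where
  "ruins_below c N X a u \<omega> \<longleftrightarrow>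
     (\<exists>t>0. (\<forall>s. 0 < s \<and> s < t \<longrightarrow> 0 \<le> surplus c N X u s \<omega>) \<and> surplus c N X u t \<omega> < - a)"

text \<open>Only the claim counts per time step and the claim sizes enter, so the walk lives on a
  product of two sequence spaces, where the first step can be split off. Claims are numbered from 0
  here, unlike in \<open>surplus\<close>.\<close>

definition skeleton_walk :: "real \<Rightarrow> real \<Rightarrow> real \<Rightarrow> (nat \<Rightarrow> nat) \<Rightarrow> (nat \<Rightarrow> real) \<Rightarrow> nat \<Rightarrow> real" where
  "skeleton_walk c h u k x n = u + c * (real n * h) - (\<Sum>i<(\<Sum>j<n. k j). x i)"

text \<open>Time 0 is not inspected, so a negative starting value is meaningful;
  \<open>skeleton_increment\<close> starts at \<open>w - c * h\<close>.\<close>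

definition skeleton_ruin ::
  "real \<Rightarrow> real \<Rightarrow> real \<Rightarrow> real \<Rightarrow> (nat \<Rightarrow> nat) \<Rightarrow> (nat \<Rightarrow> real) \<Rightarrow> bool" where
  "skeleton_ruin c h a u k x \<longleftrightarrow>
     (\<exists>n. (\<forall>j<n. 0 \<le> skeleton_walk c h u k x (Suc j)) \<and> skeleton_walk c h u k x (Suc n) < - a)"

definition increments :: "(real \<Rightarrow> 'a \<Rightarrow> nat) \<Rightarrow> real \<Rightarrow> 'a \<Rightarrow> nat \<Rightarrow> nat" where
  "increments N h \<omega> n = N (real (Suc n) * h) \<omega> - N (real n * h) \<omega>"

lemma surplus_shift: "surplus c N X v t \<omega> = surplus c N X u t \<omega> + (v - u)"
  by (simp add: surplus_def)

lemma ruins_below_mono: "ruins_below c N X b u \<omega> \<Longrightarrow> a \<le> b \<Longrightarrow> ruins_below c N X a u \<omega>"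
  unfolding ruins_below_def by fastforce

text \<open>The first passage below 0 happens at one time only, so every witness of
  \<open>ruins_below\<close> has to be \<open>t\<close>.\<close>

lemma ruins_below_iff_at:
  assumes "0 < t" "\<And>s. 0 < s \<Longrightarrow> s < t \<Longrightarrow> 0 \<le> surplus c N X u s \<omega>" "surplus c N X u t \<omega> < 0" "0 \<le> a"
  shows "ruins_below c N X a u \<omega> \<longleftrightarrow> surplus c N X u t \<omega> < - a"
proof
  assume "ruins_below c N X a u \<omega>"
  then obtain r where r: "0 < r" "\<And>s. 0 < s \<Longrightarrow> s < r \<Longrightarrow> 0 \<le> surplus c N X u s \<omega>"
    "surplus c N X u r \<omega> < - a"
    unfolding ruins_below_def by auto
  have "r = t"
  proof (rule linorder_cases)
    assume "r < t" with assms(2)[of r] r assms(4) show ?thesis by auto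
  next
    assume "t < r" with r(2)[of t] assms show ?thesis by auto
  qed
  with r show "surplus c N X u t \<omega> < - a" by simp
qed (use assms in \<open>auto simp: ruins_below_def\<close>)

lemma ruin_time_eq:
  assumes "0 < t" "\<And>s. 0 < s \<Longrightarrow> s < t \<Longrightarrow> 0 \<le> surplus c N X u s \<omega>" "surplus c N X u t \<omega> < 0"
  shows "ruin_time c N X u \<omega> = ereal t"
  unfolding ruin_time_def
proof (rule antisym)
  show "Inf {ereal t |t. 0 < t \<and> surplus c N X u t \<omega> < 0} \<le> ereal t"
    by (rule Inf_lower) (use assms in auto)
  show "ereal t \<le> Inf {ereal t |t. 0 < t \<and> surplus c N X u t \<omega> < 0}"
    by (rule Inf_greatest) (use assms in \<open>force simp: not_less[symmetric]\<close>)
qed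

section \<open>Paths of the surplus process\<close>

context counting_process
begin

text \<open>A right-continuous function into the naturals is constant on a short interval to the
  right, so only the premium acts there.\<close>

lemma surplus_locally_affine:
  assumes "\<omega> \<in> space M" "0 \<le> t"
  obtains \<delta> where "0 < \<delta>" "\<And>s. t \<le> s \<Longrightarrow> s < t + \<delta> \<Longrightarrow> surplus c N X u s \<omega> = surplus c N X u t \<omega> + c * (s - t)"
proof -
  have "((\<lambda>s. N s \<omega>) \<longlongrightarrow> N t \<omega>) (at_right t)"
    using N_right_cont[OF assms] by (simp add: continuous_within)
  then have "eventually (\<lambda>s. N s \<omega> = N t \<omega>) (at_right t)"
    by (simp add: tendsto_discrete)
  then obtain b where b: "t < b" "\<And>s. t < s \<Longrightarrow> s < b \<Longrightarrow> N s \<omega> = N t \<omega>"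
    unfolding eventually_at_right_field by auto
  show thesis
  proof (rule that[of "b - t"])
    fix s assume "t \<le> s" "s < t + (b - t)"
    then have "N s \<omega> = N t \<omega>" using b(2)[of s] by (cases "s = t") auto
    then show "surplus c N X u s \<omega> = surplus c N X u t \<omega> + c * (s - t)"
      by (simp add: surplus_def algebra_simps)
  qed (use b in auto)
qed

text \<open>The infimum in the ruin time is attained: just to the right of it the surplus grows
  linearly, so a negative value there forces a negative value at the infimum itself. Time 0 is
  excluded because the surplus starts at \<open>u \<ge> 0\<close>.\<close>

lemma first_passage:
  assumes "\<omega> \<in> space M" "0 < c" "0 \<le> u" "0 < r" "surplus c N X u r \<omega> < 0"
  obtains t where "0 < t" "t \<le> r" "\<And>s. 0 < s \<Longrightarrow> s < t \<Longrightarrow> 0 \<le> surplus c N X u s \<omega>" "surplus c N X u t \<omega> < 0"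
proof -
  let ?S = "{t. 0 < t \<and> surplus c N X u t \<omega> < 0}"
  have ne: "?S \<noteq> {}" and bdd: "bdd_below ?S"
    using assms by (auto intro!: bdd_belowI[of _ 0])
  define t where "t = Inf ?S"
  have t0: "0 \<le> t" unfolding t_def using ne by (intro cInf_greatest) auto
  obtain \<delta> where d: "0 < \<delta>"
    "\<And>s. t \<le> s \<Longrightarrow> s < t + \<delta> \<Longrightarrow> surplus c N X u s \<omega> = surplus c N X u t \<omega> + c * (s - t)"
    using surplus_locally_affine[OF assms(1) t0, of c X u] by metis
  have "Inf ?S < t + \<delta>" using d by (simp add: t_def)
  then obtain s where s: "s \<in> ?S" "s < t + \<delta>"
    using cInf_less_iff[OF ne bdd] by auto
  have ts: "t \<le> s" unfolding t_def using s bdd by (intro cInf_lower) auto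
  have "0 \<le> c * (s - t)" using ts assms by simp
  then have neg: "surplus c N X u t \<omega> < 0"
    using d(2)[OF ts s(2)] s(1) by simp
  have "t \<noteq> 0"
  proof
    assume "t = 0"
    then have "surplus c N X u t \<omega> = u" using N_zero[OF assms(1)] by (simp add: surplus_def)
    with neg assms show False by simp
  qed
  show thesis
  proof (rule that[of t])
    show "t \<le> r" unfolding t_def using assms bdd by (intro cInf_lower) auto
    fix s assume "0 < s" "s < t"
    show "0 \<le> surplus c N X u s \<omega>"
    proof (rule ccontr)
      assume "\<not> ?thesis"
      with \<open>0 < s\<close> have "t \<le> s" unfolding t_def by (intro cInf_lower bdd) auto
      with \<open>s < t\<close> show False by simp
    qed
  qed (use t0 neg \<open>t \<noteq> 0\<close> in auto)
qed

lemma no_ruin_nonneg: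
  assumes "\<omega> \<in> space M" "0 < c" "0 \<le> u" "\<not> ruins_below c N X 0 u \<omega>" "0 < s"
  shows "0 \<le> surplus c N X u s \<omega>"
proof (rule ccontr)
  assume "\<not> 0 \<le> surplus c N X u s \<omega>"
  then have "surplus c N X u s \<omega> < 0" by simp
  from first_passage[OF assms(1-3,5) this] show False
    using assms(4) unfolding ruins_below_def by (metis minus_zero)
qed

lemma ruins_below_obtain:
  assumes "ruins_below c N X 0 u \<omega>"
  obtains t where "0 < t" "\<And>s. 0 < s \<Longrightarrow> s < t \<Longrightarrow> 0 \<le> surplus c N X u s \<omega>" "surplus c N X u t \<omega> < 0"
  using assms unfolding ruins_below_def by auto

lemma ruin_time_finite_iff:
  assumes "\<omega> \<in> space M" "0 < c" "0 \<le> u"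
  shows "ruin_time c N X u \<omega> < \<infinity> \<longleftrightarrow> ruins_below c N X 0 u \<omega>"
proof (cases "ruins_below c N X 0 u \<omega>")
  case True
  then show ?thesis using ruin_time_eq by (metis ruins_below_obtain less_ereal.simps(4) PInfty_neq_ereal(1) ereal_less_PInfty)
next
  case False
  then have "{ereal t |t. 0 < t \<and> surplus c N X u t \<omega> < 0} = {}"
    using no_ruin_nonneg[OF assms False] by (auto simp: not_less[symmetric])
  with False show ?thesis unfolding ruin_time_def by (simp only:) (simp add: top_ereal_def)
qed

text \<open>The bridge from the ruin time of the statement to first-passage events, which are easier
  to approximate and to measure.\<close>

lemma deficit_iff:
  assumes "\<omega> \<in> space M" "0 < c" "0 \<le> u" "0 \<le> a"
  shows "ruin_time c N X u \<omega> < \<infinity> \<and> surplus c N X u (real_of_ereal (ruin_time c N X u \<omega>)) \<omega> < - a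
    \<longleftrightarrow> ruins_below c N X a u \<omega>"
proof (cases "ruins_below c N X 0 u \<omega>")
  case True
  then obtain t where t: "0 < t" "\<And>s. 0 < s \<Longrightarrow> s < t \<Longrightarrow> 0 \<le> surplus c N X u s \<omega>" "surplus c N X u t \<omega> < 0"
    using ruins_below_obtain by blast
  show ?thesis
    using ruins_below_iff_at[of t c N X u \<omega> a] ruin_time_eq[of t c N X u \<omega>] t assms(4) by simp
next
  case False
  then show ?thesis
    using ruin_time_finite_iff[OF assms(1-3), of X] ruins_below_mono[OF _ assms(4), of c N X u \<omega>] by auto
qed

text \<open>More capital keeps the path nonnegative before \<open>t\<close>, whereas less capital
  could cause an earlier ruin; this is why continuity is claimed only from the right.\<close>

lemma ruins_below_right_continuous:
  assumes "\<omega> \<in> space M" "0 < c" "0 \<le> u" "0 \<le> a"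
  shows "eventually (\<lambda>v. ruins_below c N X a v \<omega> \<longleftrightarrow> ruins_below c N X a u \<omega>) (at_right u)"
proof (cases "ruins_below c N X 0 u \<omega>")
  case True
  then obtain t where t: "0 < t" "\<And>s. 0 < s \<Longrightarrow> s < t \<Longrightarrow> 0 \<le> surplus c N X u s \<omega>" "surplus c N X u t \<omega> < 0"
    using ruins_below_obtain by blast
  let ?U = "surplus c N X u t \<omega>"
  \<comment> \<open>The slack of the strict inequality that decides the event: an increase by less
    than \<open>?d\<close> keeps the surplus at \<open>t\<close> below \<open>- a\<close> in the
    first case, and between \<open>- a\<close> and 0 in the second.\<close>
  let ?d = "if ?U < - a then - a - ?U else - ?U"
  have d: "?d > 0" using t by auto
  have "ruins_below c N X a v \<omega> \<longleftrightarrow> ruins_below c N X a u \<omega>" if "u < v" "v < u + ?d" for v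
  proof -
    have sh: "surplus c N X v s \<omega> = surplus c N X u s \<omega> + (v - u)" for s by (rule surplus_shift)
    have neg: "surplus c N X v t \<omega> < 0"
      using that t assms(4) unfolding sh by (auto split: if_splits)
    have pos: "0 \<le> surplus c N X v s \<omega>" if "0 < s" "s < t" for s
      using t(2)[OF that] \<open>u < v\<close> unfolding sh by simp
    have "ruins_below c N X a u \<omega> \<longleftrightarrow> ?U < - a" by (rule ruins_below_iff_at) (use t assms in auto)
    moreover have "ruins_below c N X a v \<omega> \<longleftrightarrow> surplus c N X v t \<omega> < - a"
      by (rule ruins_below_iff_at) (use t pos neg assms in auto)
    ultimately show ?thesis
      using that unfolding sh by (auto split: if_splits)
  qed
  then show ?thesis
    unfolding eventually_at_right_field using d by (intro exI[of _ "u + ?d"]) auto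
next
  case False
  have "\<not> ruins_below c N X a v \<omega>" if "u < v" for v
  proof
    assume "ruins_below c N X a v \<omega>"
    then obtain s where "0 < s" "surplus c N X v s \<omega> < - a"
      unfolding ruins_below_def by auto
    then show False
      using no_ruin_nonneg[OF assms(1-3) False \<open>0 < s\<close>] assms(4) that
      by (auto simp: surplus_shift[of c N X v s \<omega> u])
  qed
  moreover have "\<not> ruins_below c N X a u \<omega>" using False ruins_below_mono assms(4) by metis
  ultimately show ?thesis
    unfolding eventually_at_right_field by (intro exI[of _ "u + 1"]) auto
qed

lemma skeleton_walk_eq_surplus:
  assumes "\<omega> \<in> space M" "0 \<le> h"
  shows "skeleton_walk c h u (increments N h \<omega>) (\<lambda>i. X (Suc i) \<omega>) n
    = surplus c N X u (real n * h) \<omega>"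
proof -
  have le: "N (real n * h) \<omega> \<le> N (real (Suc n) * h) \<omega>" for n
    using assms(2) by (intro mono_onD[OF N_mono[OF assms(1)]] mult_right_mono) auto
  have "(\<Sum>j<n. N (real (Suc j) * h) \<omega> - N (real j * h) \<omega>) = N (real n * h) \<omega>"
  proof (induction n)
    case 0
    then show ?case using N_zero[OF assms(1)] by simp
  next
    case (Suc n)
    then show ?case using le[of n] by simp
  qed
  then show ?thesis
    unfolding skeleton_walk_def surplus_def increments_def
    by (simp add: lessThan_atLeast0 sum.shift_bounds_Suc_ivl[symmetric] atLeastLessThanSuc_atLeastAtMost
          sum.atLeast1_atMost_eq)
qed

text \<open>On a fine grid, the premium earned between the ruin time and the next grid point is
  smaller than the slack \<open>?e\<close>, so walk and path agree on whether the deficit exceeds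
  \<open>a\<close>. How fine the grid must be depends on the path.\<close>

lemma skeleton_ruin_eventually:
  assumes "\<omega> \<in> space M" "0 < c" "0 \<le> u" "0 \<le> a"
  shows "eventually (\<lambda>h. skeleton_ruin c h a u (increments N h \<omega>) (\<lambda>i. X (Suc i) \<omega>)
     \<longleftrightarrow> ruins_below c N X a u \<omega>) (at_right 0)"
proof -
  have eq: "skeleton_ruin c h a u (increments N h \<omega>) (\<lambda>i. X (Suc i) \<omega>) \<longleftrightarrow>
     (\<exists>n. (\<forall>j<n. 0 \<le> surplus c N X u (real (Suc j) * h) \<omega>) \<and> surplus c N X u (real (Suc n) * h) \<omega> < - a)"
    if "0 < h" for h
    unfolding skeleton_ruin_def using skeleton_walk_eq_surplus[OF assms(1), of h c u X] that by simp
  show ?thesis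
  proof (cases "ruins_below c N X 0 u \<omega>")
    case False
    have "skeleton_ruin c h a u (increments N h \<omega>) (\<lambda>i. X (Suc i) \<omega>) \<longleftrightarrow> False" if "0 < h" for h
    proof -
      have "- a \<le> surplus c N X u (real (Suc n) * h) \<omega>" for n
        using no_ruin_nonneg[OF assms(1-3) False, of "real (Suc n) * h"] assms(4) that
        by (simp add: add_pos_nonneg)
      then show ?thesis unfolding eq[OF that] using linorder_not_less by blast
    qed
    moreover have "\<not> ruins_below c N X a u \<omega>" using False ruins_below_mono assms(4) by metis
    ultimately show ?thesis
      unfolding eventually_at_right_field by (intro exI[of _ 1]) auto
  next
    case True
    then obtain t where t: "0 < t" "\<And>s. 0 < s \<Longrightarrow> s < t \<Longrightarrow> 0 \<le> surplus c N X u s \<omega>" "surplus c N X u t \<omega> < 0"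
      using ruins_below_obtain by blast
    let ?U = "surplus c N X u t \<omega>"
    obtain \<delta> where d: "0 < \<delta>"
      "\<And>s. t \<le> s \<Longrightarrow> s < t + \<delta> \<Longrightarrow> surplus c N X u s \<omega> = ?U + c * (s - t)"
      using surplus_locally_affine[OF assms(1), of t c X u] t(1) by (metis less_imp_le)
    let ?e = "if ?U < - a then - a - ?U else - ?U"
    have e: "?e > 0" using t by auto
    have "(\<exists>n. (\<forall>j<n. 0 \<le> surplus c N X u (real (Suc j) * h) \<omega>) \<and> surplus c N X u (real (Suc n) * h) \<omega> < - a)
       \<longleftrightarrow> ?U < - a" (is "?L \<longleftrightarrow> _") if h: "0 < h" "h < min \<delta> (?e / c)" for h
    proof -
      \<comment> \<open>\<open>Suc m\<close> is the index of the first grid point at or after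
        \<open>t\<close>; the walk tests the grid points from index 1 on.\<close>
      define m where "m = nat (\<lceil>t / h\<rceil> - 1)"
      have c1: "\<lceil>t / h\<rceil> \<ge> 1" using t(1) h by (simp add: one_le_ceiling)
      have rm: "real (Suc m) = of_int \<lceil>t / h\<rceil>" unfolding m_def using c1 by (simp add: of_nat_diff)
      have "t / h \<le> real (Suc m)" "real (Suc m) < t / h + 1" "real m < t / h"
        using ceiling_correct[of "t / h"] rm by linarith+
      then have m: "t \<le> real (Suc m) * h" "real (Suc m) * h < t + h" "real m * h < t"
        using h by (simp_all add: field_simps)
      have val: "surplus c N X u (real (Suc m) * h) \<omega> = ?U + c * (real (Suc m) * h - t)"
        using d(2)[of "real (Suc m) * h"] m h by auto
      have "c * (real (Suc m) * h - t) < c * h" using m assms by (intro mult_strict_left_mono) auto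
      also have "\<dots> < ?e" using h assms by (simp add: field_simps)
      finally have lt: "c * (real (Suc m) * h - t) < ?e" .
      have ge: "0 \<le> c * (real (Suc m) * h - t)" using m assms by simp
      have neg: "surplus c N X u (real (Suc m) * h) \<omega> < 0"
        unfolding val using lt assms(4) by (auto split: if_splits)
      have iff: "surplus c N X u (real (Suc m) * h) \<omega> < - a \<longleftrightarrow> ?U < - a"
        unfolding val using lt ge by (auto split: if_splits)
      have before: "0 \<le> surplus c N X u (real (Suc j) * h) \<omega>" if "j < m" for j
      proof (rule t(2))
        have "real (Suc j) * h \<le> real m * h" using that h by (intro mult_right_mono) auto
        then show "real (Suc j) * h < t" using m(3) by linarith
      qed (use h in simp)
      show ?thesis
      proof
        assume ?L
        then obtain n where n: "\<And>j. j < n \<Longrightarrow> 0 \<le> surplus c N X u (real (Suc j) * h) \<omega>"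
          "surplus c N X u (real (Suc n) * h) \<omega> < - a" by auto
        have "n = m"
        proof (rule linorder_cases)
          assume "n < m" with before[of n] n(2) assms(4) show ?thesis by simp
        next
          assume "m < n" with n(1)[of m] neg show ?thesis by simp
        qed
        with n(2) iff show "?U < - a" by simp
      next
        assume "?U < - a"
        with iff before show ?L by blast
      qed
    qed
    moreover have "ruins_below c N X a u \<omega> \<longleftrightarrow> ?U < - a" by (rule ruins_below_iff_at) (use t assms in auto)
    ultimately show ?thesis
      unfolding eventually_at_right_field
      using d(1) e assms(2) eq by (intro exI[of _ "min \<delta> (?e / c)"]) auto
  qed
qed

end


section \<open>One-step analysis of the skeleton walk\<close>

lemma measurable_sum_nat_count_space [measurable]:
  fixes f :: "'i \<Rightarrow> 'b \<Rightarrow> nat"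
  assumes [measurable]: "\<And>i. i \<in> I \<Longrightarrow> f i \<in> measurable M (count_space UNIV)"
  shows "(\<lambda>\<omega>. \<Sum>i\<in>I. f i \<omega>) \<in> measurable M (count_space UNIV)"
  using assms
proof (induction I rule: infinite_finite_induct)
  case (insert i I)
  have [measurable]: "f i \<in> measurable M (count_space UNIV)" "(\<lambda>\<omega>. \<Sum>i\<in>I. f i \<omega>) \<in> measurable M (count_space UNIV)"
    using insert by auto
  show ?case using insert(1,2) by simp
qed simp_all

lemma measurable_skeleton_walk [measurable (raw)]:
  assumes [measurable]: "u \<in> borel_measurable M" "k \<in> measurable M (PiM UNIV (\<lambda>_. count_space UNIV))"
    "x \<in> measurable M (PiM UNIV (\<lambda>_. borel))"
  shows "(\<lambda>\<omega>. skeleton_walk c h (u \<omega>) (k \<omega>) (x \<omega>) n) \<in> borel_measurable M"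
proof -
  have [measurable]: "(\<lambda>\<omega>. k \<omega> j) \<in> measurable M (count_space UNIV)" "(\<lambda>\<omega>. x \<omega> j) \<in> borel_measurable M" for j
    by (rule measurable_compose[OF assms(2)], simp) (rule measurable_compose[OF assms(3)], simp)
  have [measurable]: "(\<lambda>\<omega>. \<Sum>i<(\<Sum>j<n. k \<omega> j). x \<omega> i) \<in> borel_measurable M"
    by (rule measurable_compose_countable[where f="\<lambda>m \<omega>. \<Sum>i<m. x \<omega> i" and g="\<lambda>\<omega>. \<Sum>j<n. k \<omega> j"]) measurable
  show ?thesis unfolding skeleton_walk_def by measurable
qed

lemma measurable_skeleton_ruin [measurable (raw)]:
  assumes [measurable]: "u \<in> borel_measurable M" "k \<in> measurable M (PiM UNIV (\<lambda>_. count_space UNIV))"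
    "x \<in> measurable M (PiM UNIV (\<lambda>_. borel))"
  shows "Measurable.pred M (\<lambda>\<omega>. skeleton_ruin c h a (u \<omega>) (k \<omega>) (x \<omega>))"
  unfolding skeleton_ruin_def by measurable

lemma sum_comb_seq:
  "(\<Sum>i<m + n. comb_seq m x y i) = (\<Sum>i<m. x i) + (\<Sum>i<n. y i)" for x y :: "nat \<Rightarrow> 'a::comm_monoid_add"
proof -
  have "(\<Sum>i<m + n. comb_seq m x y i) = (\<Sum>i<m. comb_seq m x y i) + (\<Sum>i=m..<m+n. comb_seq m x y i)"
    by (simp add: lessThan_atLeast0 sum.atLeastLessThan_concat)
  also have "(\<Sum>i=m..<m+n. comb_seq m x y i) = (\<Sum>i<n. y i)"
    using sum.shift_bounds_nat_ivl[of "comb_seq m x y" 0 m n]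
    by (simp add: lessThan_atLeast0 add.commute comb_seq_add)
  finally show ?thesis by (simp add: comb_seq_less)
qed

text \<open>Regeneration: when a count \<open>m\<close> is put in front together with exactly
  \<open>m\<close> claims \<open>y\<close>, the first step consumes these claims, and a fresh walk
  runs from the position reached.\<close>

lemma skeleton_walk_step:
  "skeleton_walk c h u (case_nat m k) (comb_seq m y x) (Suc n) = skeleton_walk c h (u + c * h - (\<Sum>i<m. y i)) k x n"
proof -
  have "(\<Sum>j<Suc n. case_nat m k j) = m + (\<Sum>j<n. k j)"
    by (subst sum.lessThan_Suc_shift) simp
  then show ?thesis by (simp add: skeleton_walk_def sum_comb_seq algebra_simps)
qed

lemma skeleton_ruin_step:
  assumes "0 \<le> a"
  shows "skeleton_ruin c h a u (case_nat m k) (comb_seq m y x) \<longleftrightarrow>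
    (let v = u + c * h - (\<Sum>i<m. y i) in if 0 \<le> v then skeleton_ruin c h a v k x else v < - a)"
proof -
  let ?v = "u + c * h - (\<Sum>i<m. y i)"
  have 0: "skeleton_walk c h v k x 0 = v" for v by (simp add: skeleton_walk_def)
  have "skeleton_ruin c h a u (case_nat m k) (comb_seq m y x) \<longleftrightarrow>
     (\<exists>n. (\<forall>j<n. 0 \<le> skeleton_walk c h ?v k x j) \<and> skeleton_walk c h ?v k x n < - a)"
    unfolding skeleton_ruin_def skeleton_walk_step ..
  also have "\<dots> \<longleftrightarrow> ?v < - a \<or> 0 \<le> ?v \<and> skeleton_ruin c h a ?v k x"
  proof -
    have ex: "(\<exists>n. P n) \<longleftrightarrow> P 0 \<or> (\<exists>n. P (Suc n))" for P :: "nat \<Rightarrow> bool"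
      by (metis not0_implies_Suc)
    show ?thesis unfolding skeleton_ruin_def by (subst ex) (simp add: 0 All_less_Suc2 ex_simps)
  qed
  finally show ?thesis using assms by (auto simp: Let_def)
qed

text \<open>By \<open>exp (- a) \<ge> 1 - a\<close>, at most one event has probability at least
  \<open>(1 - a) * (1 + a)\<close>.\<close>

lemma poisson_tail_two:
  assumes "0 < a"
  shows "measure (measure_pmf (poisson_pmf a)) {2..} \<le> a\<^sup>2"
proof -
  have "measure (measure_pmf (poisson_pmf a)) {2..} = 1 - measure (measure_pmf (poisson_pmf a)) {0, 1}"
    by (subst measure_pmf.prob_compl[symmetric]) (auto intro!: arg_cong[where f="measure _"])
  also have "measure (measure_pmf (poisson_pmf a)) {0, 1} = exp (- a) * (1 + a)"
    using assms by (subst measure_measure_pmf_finite) (auto simp: pmf_poisson algebra_simps)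
  also have "1 - exp (- a) * (1 + a) \<le> 1 - (1 - a) * (1 + a)"
    using exp_ge_add_one_self[of "- a"] assms by (intro diff_left_mono mult_right_mono) auto
  finally show ?thesis by (simp add: algebra_simps power2_eq_square)
qed

text \<open>For a time step of length \<open>h\<close> the mean \<open>a\<close> is proportional to
  \<open>h\<close>, so the error still vanishes after division by \<open>h\<close>.\<close>

lemma poisson_expectation_two_terms:
  fixes f :: "nat \<Rightarrow> real"
  assumes "0 < a" "\<And>n. 0 \<le> f n" "\<And>n. f n \<le> 1"
  shows "\<bar>measure_pmf.expectation (poisson_pmf a) f - (exp (- a) * f 0 + a * exp (- a) * f 1)\<bar> \<le> a\<^sup>2"
proof -
  let ?P = "measure_pmf (poisson_pmf a)"
  have int: "integrable ?P g" if "\<And>n. \<bar>g n\<bar> \<le> 1" for g :: "nat \<Rightarrow> real"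
    using that by (intro measure_pmf.integrable_const_bound[where B=1]) auto
  have "integral\<^sup>L ?P f = integral\<^sup>L ?P (\<lambda>n. f n * indicator {0,1} n + f n * indicator {2..} n)"
    by (intro Bochner_Integration.integral_cong) (auto simp: indicator_def)
  also have "\<dots> = integral\<^sup>L ?P (\<lambda>n. f n * indicator {0,1} n) + integral\<^sup>L ?P (\<lambda>n. f n * indicator {2..} n)"
    using assms by (intro Bochner_Integration.integral_add int) (auto simp: indicator_def abs_le_iff)
  also have "integral\<^sup>L ?P (\<lambda>n. f n * indicator {0,1} n) = (\<Sum>n\<in>{0,1}. f n * pmf (poisson_pmf a) n)"
    by (subst integral_measure_pmf_real[where A="{0,1}"]) (auto simp: indicator_def)
  also have "\<dots> = exp (- a) * f 0 + a * exp (- a) * f 1"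
    using assms(1) by (simp add: pmf_poisson)
  finally have eq: "integral\<^sup>L ?P f - (exp (- a) * f 0 + a * exp (- a) * f 1) = integral\<^sup>L ?P (\<lambda>n. f n * indicator {2..} n)"
    by simp
  have "0 \<le> integral\<^sup>L ?P (\<lambda>n. f n * indicator {2..} n)"
    using assms by (intro integral_nonneg_AE) auto
  moreover have "integral\<^sup>L ?P (\<lambda>n. f n * indicator {2..} n) \<le> integral\<^sup>L ?P (indicator {2..})"
    using assms by (intro integral_mono int) (auto simp: indicator_def abs_le_iff)
  ultimately show ?thesis unfolding eq using poisson_tail_two[OF assms(1)] by simp
qed

section \<open>The skeleton ruin probability and its recursion\<close>

locale claim_law = real_distribution D for D :: "real measure"
begin

definition skeleton_ruin_prob :: "nat pmf \<Rightarrow> real \<Rightarrow> real \<Rightarrow> real \<Rightarrow> real \<Rightarrow> real" where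
  "skeleton_ruin_prob p c h a u =
     measure (PiM UNIV (\<lambda>_::nat. measure_pmf p) \<Otimes>\<^sub>M PiM UNIV (\<lambda>_::nat. D)) {(k, x). skeleton_ruin c h a u k x}"

text \<open>Boundary values of the one-step equation: a walk that lands at \<open>v < 0\<close> is
  ruined, and only the size of the deficit still matters.\<close>

definition extend_neg :: "real \<Rightarrow> (real \<Rightarrow> real) \<Rightarrow> real \<Rightarrow> real" where
  "extend_neg a f v = (if 0 \<le> v then f v else indicator {..<- a} v)"

lemma measurable_extend_neg [measurable]:
  "f \<in> borel_measurable borel \<Longrightarrow> extend_neg a f \<in> borel_measurable borel"
  unfolding extend_neg_def[abs_def] by (intro measurable_If borel_measurable_indicator) auto

context
  fixes p :: "nat pmf" and c h a :: real
  assumes a_nonneg: "0 \<le> a"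
begin

abbreviation "K \<equiv> PiM UNIV (\<lambda>_::nat. measure_pmf p)"
abbreviation "S \<equiv> PiM UNIV (\<lambda>_::nat. D)"

lemma sets_K [measurable_cong]: "sets K = sets (PiM UNIV (\<lambda>_. count_space UNIV))"
  by (intro sets_PiM_cong) auto

lemma sets_S [measurable_cong]: "sets S = sets (PiM UNIV (\<lambda>_. borel))"
  by (intro sets_PiM_cong) auto

lemma space_KS: "space (K \<Otimes>\<^sub>M S) = UNIV"
  by (simp add: space_pair_measure space_PiM)

interpretation K: sequence_space "measure_pmf p" ..
interpretation S: sequence_space D ..
interpretation KS: pair_prob_space K S ..

lemma pred_ruin [measurable]: "Measurable.pred (borel \<Otimes>\<^sub>M K \<Otimes>\<^sub>M S) (\<lambda>(u, k, x). skeleton_ruin c h a u k x)"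
  by measurable

lemma emeasure_skeleton_ruin:
  "ennreal (skeleton_ruin_prob p c h a u) = (\<integral>\<^sup>+\<omega>. indicator {(k, x). skeleton_ruin c h a u k x} \<omega> \<partial>(K \<Otimes>\<^sub>M S))"
proof -
  have "{(k, x). skeleton_ruin c h a u k x} = {\<omega>\<in>space (K \<Otimes>\<^sub>M S). skeleton_ruin c h a u (fst \<omega>) (snd \<omega>)}"
    by (auto simp: space_KS)
  also have "\<dots> \<in> sets (K \<Otimes>\<^sub>M S)" by measurable
  finally show ?thesis
    unfolding skeleton_ruin_prob_def by (simp add: KS.emeasure_eq_measure)
qed

lemma measurable_skeleton_ruin_prob [measurable]: "skeleton_ruin_prob p c h a \<in> borel_measurable borel"
proof -
  have "(\<lambda>u. enn2real (\<integral>\<^sup>+\<omega>. (\<lambda>(u, k, x). indicator {\<omega>. case \<omega> of (u, k, x) \<Rightarrow> skeleton_ruin c h a u k x} (u, k, x)) (u, \<omega>) \<partial>(K \<Otimes>\<^sub>M S))) \<in> borel_measurable borel"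
    by measurable
  also have "(\<lambda>u. enn2real (\<integral>\<^sup>+\<omega>. (\<lambda>(u, k, x). indicator {\<omega>. case \<omega> of (u, k, x) \<Rightarrow> skeleton_ruin c h a u k x} (u, k, x)) (u, \<omega>) \<partial>(K \<Otimes>\<^sub>M S)))
    = (\<lambda>u. enn2real (\<integral>\<^sup>+\<omega>. indicator {(k, x). skeleton_ruin c h a u k x} \<omega> \<partial>(K \<Otimes>\<^sub>M S)))"
    by (auto simp: split_beta' indicator_def)
  also have "\<dots> = skeleton_ruin_prob p c h a"
    by (auto simp: emeasure_skeleton_ruin[symmetric] skeleton_ruin_prob_def)
  finally show ?thesis .
qed

lemma skeleton_ruin_prob_bounds: "0 \<le> skeleton_ruin_prob p c h a u" "skeleton_ruin_prob p c h a u \<le> 1"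
  unfolding skeleton_ruin_prob_def by auto

lemma extend_neg_bounds:
  assumes "\<And>v. 0 \<le> f v \<and> f v \<le> 1"
  shows "0 \<le> extend_neg a f v" "extend_neg a f v \<le> 1"
  using assms by (auto simp: extend_neg_def indicator_def)

text \<open>The Markov property at the first step: \<open>PiM_iter\<close> splits off the first
  count, \<open>PiM_comb_seq\<close> the first \<open>m\<close> claims, and the sequences that
  remain have their original laws.\<close>

lemma skeleton_recursion:
  "skeleton_ruin_prob p c h a u =
     measure_pmf.expectation p (\<lambda>m. \<integral>y. extend_neg a (skeleton_ruin_prob p c h a) (u + c * h - (\<Sum>i<m. y i)) \<partial>S)"
proof -
  let ?q = "extend_neg a (skeleton_ruin_prob p c h a)"
  let ?I = "\<lambda>k x. (if skeleton_ruin c h a u k x then 1 else 0) :: ennreal"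
  have qb: "0 \<le> ?q v" "?q v \<le> 1" for v
    using extend_neg_bounds skeleton_ruin_prob_bounds by auto
  have "ennreal (skeleton_ruin_prob p c h a u) = (\<integral>\<^sup>+k. \<integral>\<^sup>+x. ?I k x \<partial>S \<partial>K)"
    unfolding emeasure_skeleton_ruin by (subst S.P.nn_integral_fst[symmetric]) (auto simp: indicator_def of_bool_def split_beta')
  also have "\<dots> = (\<integral>\<^sup>+k. \<integral>\<^sup>+x. ?I k x \<partial>S \<partial>distr (measure_pmf p \<Otimes>\<^sub>M K) K (\<lambda>(s, \<omega>). case_nat s \<omega>))"
    by (subst K.PiM_iter) simp
  also have "\<dots> = (\<integral>\<^sup>+z. \<integral>\<^sup>+x. ?I (case_nat (fst z) (snd z)) x \<partial>S \<partial>(measure_pmf p \<Otimes>\<^sub>M K))"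
    by (subst nn_integral_distr) (auto simp: split_beta')
  also have "\<dots> = (\<integral>\<^sup>+m. \<integral>\<^sup>+k. \<integral>\<^sup>+x. ?I (case_nat m k) x \<partial>S \<partial>K \<partial>measure_pmf p)"
    by (subst K.P.nn_integral_fst[symmetric]) (auto simp: split_beta')
  also have "\<dots> = (\<integral>\<^sup>+m. ennreal (\<integral>y. ?q (u + c * h - (\<Sum>i<m. y i)) \<partial>S) \<partial>measure_pmf p)"
  proof (intro nn_integral_cong)
    fix m
    have "(\<integral>\<^sup>+k. \<integral>\<^sup>+x. ?I (case_nat m k) x \<partial>S \<partial>K)
      = (\<integral>\<^sup>+k. \<integral>\<^sup>+x. ?I (case_nat m k) x \<partial>distr (S \<Otimes>\<^sub>M S) S (\<lambda>(\<omega>, \<omega>'). comb_seq m \<omega> \<omega>') \<partial>K)"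
      by (subst S.PiM_comb_seq) simp
    also have "\<dots> = (\<integral>\<^sup>+k. \<integral>\<^sup>+z. ?I (case_nat m k) (comb_seq m (fst z) (snd z)) \<partial>(S \<Otimes>\<^sub>M S) \<partial>K)"
      by (intro nn_integral_cong, subst nn_integral_distr) (auto simp: split_beta')
    also have "\<dots> = (\<integral>\<^sup>+k. \<integral>\<^sup>+y. \<integral>\<^sup>+x. ?I (case_nat m k) (comb_seq m y x) \<partial>S \<partial>S \<partial>K)"
      by (intro nn_integral_cong, subst S.P.nn_integral_fst[symmetric]) (auto simp: split_beta')
    \<comment> \<open>The claims of the first step are integrated last, so that for fixed
      \<open>y\<close> the inner double integral is again a skeleton ruin probability.\<close>
    also have "\<dots> = (\<integral>\<^sup>+y. \<integral>\<^sup>+k. \<integral>\<^sup>+x. ?I (case_nat m k) (comb_seq m y x) \<partial>S \<partial>K \<partial>S)"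
      by (rule KS.Fubini'[symmetric]) measurable
    also have "\<dots> = (\<integral>\<^sup>+y. ennreal (?q (u + c * h - (\<Sum>i<m. y i))) \<partial>S)"
    proof (intro nn_integral_cong)
      fix y
      let ?v = "u + c * h - (\<Sum>i<m. y i)"
      have "(\<integral>\<^sup>+k. \<integral>\<^sup>+x. ?I (case_nat m k) (comb_seq m y x) \<partial>S \<partial>K)
        = (if 0 \<le> ?v then (\<integral>\<^sup>+k. \<integral>\<^sup>+x. (if skeleton_ruin c h a ?v k x then 1 else 0) \<partial>S \<partial>K) else indicator {..<-a} ?v)"
        by (auto simp: indicator_def skeleton_ruin_step[OF a_nonneg] Let_def K.emeasure_space_1 S.emeasure_space_1)
      also have "(\<integral>\<^sup>+k. \<integral>\<^sup>+x. (if skeleton_ruin c h a ?v k x then 1 else 0) \<partial>S \<partial>K) = ennreal (skeleton_ruin_prob p c h a ?v)"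
        unfolding emeasure_skeleton_ruin by (subst S.P.nn_integral_fst[symmetric]) (auto simp: indicator_def of_bool_def split_beta')
      finally show "(\<integral>\<^sup>+k. \<integral>\<^sup>+x. ?I (case_nat m k) (comb_seq m y x) \<partial>S \<partial>K) = ennreal (?q ?v)"
        by (auto simp: extend_neg_def indicator_def)
    qed
    also have "\<dots> = ennreal (\<integral>y. ?q (u + c * h - (\<Sum>i<m. y i)) \<partial>S)"
      using qb by (intro nn_integral_eq_integral S.P.integrable_const_bound[where B=1]) auto
    finally show "(\<integral>\<^sup>+k. \<integral>\<^sup>+x. ?I (case_nat m k) x \<partial>S \<partial>K) = ennreal (\<integral>y. ?q (u + c * h - (\<Sum>i<m. y i)) \<partial>S)" .
  qed
  also have "\<dots> = ennreal (measure_pmf.expectation p (\<lambda>m. \<integral>y. ?q (u + c * h - (\<Sum>i<m. y i)) \<partial>S))"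
  proof (intro nn_integral_eq_integral measure_pmf.integrable_const_bound[where B=1] AE_I2)
    fix m
    have "(\<integral>y. ?q (u + c * h - (\<Sum>i<m. y i)) \<partial>S) \<le> 1"
      using qb by (intro S.P.integral_le_const S.P.integrable_const_bound[where B=1]) auto
    then show "norm (\<integral>y. ?q (u + c * h - (\<Sum>i<m. y i)) \<partial>S) \<le> 1"
      using qb by (simp add: integral_nonneg_AE)
  qed (use qb in \<open>auto intro!: integral_nonneg_AE\<close>)
  finally show ?thesis
    using qb by (subst (asm) ennreal_inj) (auto intro!: integral_nonneg_AE skeleton_ruin_prob_bounds)
qed

end

text \<open>Started at \<open>w - c * h\<close>, the walk is at \<open>w\<close> after a step
  without claims, which turns the recursion into a backward difference of \<open>q\<close> at
  \<open>w\<close>. The start may be negative; \<open>w \<ge> 0\<close> ensures that the value after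
  such a step is \<open>q w\<close>.\<close>

lemma skeleton_increment:
  fixes r a c h w :: real
  assumes "0 < r" "0 \<le> a"
  defines "q \<equiv> skeleton_ruin_prob (poisson_pmf r) c h a"
  assumes "0 \<le> w"
  shows "\<bar>q (w - c * h) - (exp (- r) * q w + r * exp (- r) * (\<integral>y. extend_neg a q (w - y) \<partial>D))\<bar> \<le> r\<^sup>2"
proof -
  interpret S: sequence_space D ..
  let ?S = "PiM UNIV (\<lambda>_::nat. D)"
  let ?q = "extend_neg a q"
  let ?f = "\<lambda>m. \<integral>y. ?q (w - (\<Sum>i<m. y i)) \<partial>?S"
  have S [measurable_cong]: "sets ?S = sets (PiM UNIV (\<lambda>_. borel))"
    by (rule sets_S[OF assms(2)])
  have [measurable]: "q \<in> borel_measurable borel"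
    unfolding q_def by (rule measurable_skeleton_ruin_prob[OF assms(2)])
  have qb: "0 \<le> ?q v" "?q v \<le> 1" for v
    using extend_neg_bounds[OF assms(2)] skeleton_ruin_prob_bounds[OF assms(2)] unfolding q_def by auto
  have rec: "q (w - c * h) = measure_pmf.expectation (poisson_pmf r) ?f"
    unfolding q_def by (subst skeleton_recursion[OF assms(2)]) simp
  have f0: "?f 0 = q w" using assms by (simp add: extend_neg_def S.P.prob_space)
  have "?f 1 = (\<integral>y. ?q (w - y 0) \<partial>?S)" by simp
  also have "\<dots> = (\<integral>y. ?q (w - y) \<partial>distr ?S D (\<lambda>y. y 0))"
    by (subst integral_distr) auto
  also have "distr ?S D (\<lambda>y. y 0) = D"
    by (rule S.PiM_component) simp
  finally have f1: "?f 1 = (\<integral>y. ?q (w - y) \<partial>D)" .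
  have "?f m \<le> 1" for m
    using qb by (intro S.P.integral_le_const S.P.integrable_const_bound[where B=1]) auto
  then show ?thesis
    using poisson_expectation_two_terms[OF assms(1), of ?f] qb
    unfolding rec f0[symmetric] f1[symmetric] by (simp add: integral_nonneg_AE)
qed

end


section \<open>The law of the skeleton\<close>

lemma measurable_diff_count_space:
  fixes f g :: "'b \<Rightarrow> nat"
  assumes [measurable]: "f \<in> measurable M (count_space UNIV)" "g \<in> measurable M (count_space UNIV)"
  shows "(\<lambda>\<omega>. f \<omega> - g \<omega>) \<in> measurable M (count_space UNIV)"
  by measurable

context prob_space
begin

text \<open>Independence concerns finite subfamilies only, and every finite index set lies in an
  initial segment.\<close>

lemma indep_vars_nat_UNIV:
  assumes "\<And>n. indep_vars M' X {..<n::nat}"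
  shows "indep_vars M' X UNIV"
  unfolding indep_vars_def2
proof (intro conjI ballI)
  fix i :: nat
  show "random_variable (M' i) (X i)"
    using assms[of "Suc i"] unfolding indep_vars_def by auto
next
  show "indep_sets (\<lambda>i. {X i -` A \<inter> space M |A. A \<in> sets (M' i)}) UNIV"
    unfolding indep_sets_finite_index_sets[of _ UNIV]
  proof (intro allI impI)
    fix J :: "nat set" assume J: "J \<subseteq> UNIV" "J \<noteq> {}" "finite J"
    then obtain n where "J \<subseteq> {..<n}" using finite_nat_iff_bounded by auto
    then have "indep_vars M' X J" by (rule indep_vars_subset[OF assms[of n]])
    then show "indep_sets (\<lambda>i. {X i -` A \<inter> space M |A. A \<in> sets (M' i)}) J"
      by (simp add: indep_vars_def2)
  qed
qed

end

context claim_sizes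
begin

definition D :: "real measure" where "D = distr M borel (X 1)"

definition claim_mean :: real where "claim_mean = expectation (X 1)"

lemma X_measurable: "1 \<le> i \<Longrightarrow> X i \<in> borel_measurable M"
  using X_indep unfolding indep_vars_def by auto

lemma X_distr: "1 \<le> i \<Longrightarrow> distr M borel (X i) = D"
  unfolding D_def by (rule cdf_unique) (auto simp: X_cdf intro!: real_distribution_distr X_measurable)

sublocale law: claim_law D
  unfolding D_def claim_law_def by (intro real_distribution_distr X_measurable) simp

lemma distr_X_sequence:
  "distr M (PiM UNIV (\<lambda>_. borel)) (\<lambda>\<omega> i. X (Suc i) \<omega>) = PiM UNIV (\<lambda>_. D)"
proof -
  let ?B = "\<lambda>I. PiM I (\<lambda>_. borel) :: (nat \<Rightarrow> real) measure"
  have m1: "(\<lambda>\<omega>. \<lambda>i\<in>{1..}. X i \<omega>) \<in> measurable M (?B {1..})"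
    by (intro measurable_restrict) (auto intro: X_measurable)
  have m2: "(\<lambda>f i. f (Suc i)) \<in> measurable (?B {1..}) (?B UNIV)"
    by (intro measurable_PiM_single') (auto intro!: measurable_component_singleton)
  have "distr M (?B UNIV) (\<lambda>\<omega> i. X (Suc i) \<omega>) = distr (distr M (?B {1..}) (\<lambda>\<omega>. \<lambda>i\<in>{1..}. X i \<omega>)) (?B UNIV) (\<lambda>f i. f (Suc i))"
    by (subst distr_distr[OF m2 m1]) (simp add: comp_def)
  also have "distr M (?B {1..}) (\<lambda>\<omega>. \<lambda>i\<in>{1..}. X i \<omega>) = PiM {1..} (\<lambda>i. distr M borel (X i))"
    using X_indep by (subst (asm) indep_vars_iff_distr_eq_PiM') (auto simp: X_measurable)
  also have "\<dots> = PiM {1..} (\<lambda>_. D)"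
    by (intro PiM_cong refl X_distr) simp
  also have "distr \<dots> (?B UNIV) (\<lambda>f i. f (Suc i)) = distr \<dots> (PiM UNIV (\<lambda>_. D)) (\<lambda>f. \<lambda>i\<in>UNIV. f (Suc i))"
    by (intro distr_cong) (auto intro!: sets_PiM_cong)
  also have "\<dots> = PiM UNIV (\<lambda>_. D)"
    by (rule distr_PiM_reindex) (use law.prob_space_axioms in auto)
  finally show ?thesis .
qed

end

context poisson_process
begin

lemma distr_increments:
  assumes "0 < h"
  shows "distr M (PiM UNIV (\<lambda>_. count_space UNIV)) (increments N h)
    = PiM UNIV (\<lambda>_. measure_pmf (poisson_pmf (rate * h)))"
proof -
  have lt: "real n * h < real (Suc n) * h" for n using assms by simp
  have rv: "(\<lambda>\<omega>. N (real (Suc n) * h) \<omega> - N (real n * h) \<omega>) \<in> measurable M (count_space UNIV)" for n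
    using assms by (intro measurable_diff_count_space N_measurable) auto
  have "indep_vars (\<lambda>_. count_space UNIV) (\<lambda>n \<omega>. N (real (Suc n) * h) \<omega> - N (real n * h) \<omega>) {..<n}" for n
    by (rule indep_increments[of "\<lambda>n. real n * h"]) (use lt in auto)
  then have "indep_vars (\<lambda>_. count_space UNIV) (\<lambda>n \<omega>. N (real (Suc n) * h) \<omega> - N (real n * h) \<omega>) UNIV"
    by (rule indep_vars_nat_UNIV)
  then have "distr M (PiM UNIV (\<lambda>_. count_space UNIV)) (\<lambda>\<omega>. \<lambda>n\<in>UNIV. N (real (Suc n) * h) \<omega> - N (real n * h) \<omega>)
    = PiM UNIV (\<lambda>n. distr M (count_space UNIV) (\<lambda>\<omega>. N (real (Suc n) * h) \<omega> - N (real n * h) \<omega>))"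
    using rv by (subst (asm) indep_vars_iff_distr_eq_PiM') auto
  also have "\<dots> = PiM UNIV (\<lambda>_. measure_pmf (poisson_pmf (rate * h)))"
  proof (intro PiM_cong refl)
    fix n
    have "distr M (count_space UNIV) (\<lambda>\<omega>. N (real (Suc n) * h) \<omega> - N (real n * h) \<omega>)
      = measure_pmf (poisson_pmf (rate * (real (Suc n) * h - real n * h)))"
      using assms lt by (intro increments_distr) auto
    also have "real (Suc n) * h - real n * h = h" by (simp add: algebra_simps)
    finally show "distr M (count_space UNIV) (\<lambda>\<omega>. N (real (Suc n) * h) \<omega> - N (real n * h) \<omega>)
      = measure_pmf (poisson_pmf (rate * h))" .
  qed
  finally show ?thesis by (simp only: increments_def[abs_def] restrict_def UNIV_I if_True)
qed

end

context poisson_claims_model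
begin

lemma measurable_increments:
  assumes "0 < h" shows "increments N h \<in> measurable M (PiM UNIV (\<lambda>_. count_space UNIV))"
  unfolding increments_def[abs_def] using assms
  by (intro measurable_PiM_single' measurable_diff_count_space N_measurable) auto

lemma measurable_X_sequence: "(\<lambda>\<omega> i. X (Suc i) \<omega>) \<in> measurable M (PiM UNIV (\<lambda>_. borel))"
  by (intro measurable_PiM_single') (auto intro!: X_measurable)

text \<open>Independence is assumed for the sigma-algebras generated by the whole processes, so both
  sequences are shown to be measurable with respect to these, not merely with respect to
  \<open>M\<close>. Equality of the measures is then checked on rectangles.\<close>

lemma joint_law:
  assumes "0 < h"
  shows "distr M (PiM UNIV (\<lambda>_. count_space UNIV) \<Otimes>\<^sub>M PiM UNIV (\<lambda>_. borel)) (\<lambda>\<omega>. (increments N h \<omega>, \<lambda>i. X (Suc i) \<omega>))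
    = PiM UNIV (\<lambda>_. measure_pmf (poisson_pmf (rate * h))) \<Otimes>\<^sub>M PiM UNIV (\<lambda>_. D)"
proof (rule pair_measure_eqI[symmetric])
  let ?K = "PiM UNIV (\<lambda>_::nat. measure_pmf (poisson_pmf (rate * h)))" and ?S = "PiM UNIV (\<lambda>_::nat. D)"
  let ?CK = "PiM UNIV (\<lambda>_::nat. count_space (UNIV::nat set))" and ?BS = "PiM UNIV (\<lambda>_::nat. borel::real measure)"
  interpret K: prob_space ?K by (intro prob_space_PiM) (rule measure_pmf.prob_space_axioms)
  interpret S: prob_space ?S by (intro prob_space_PiM) (rule law.prob_space_axioms)
  show "sigma_finite_measure ?K" "sigma_finite_measure ?S" by unfold_locales
  have sK: "sets ?K = sets ?CK" by (intro sets_PiM_cong) auto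
  have sS: "sets ?S = sets ?BS" by (intro sets_PiM_cong) auto
  show "sets (?K \<Otimes>\<^sub>M ?S) = sets (distr M (?CK \<Otimes>\<^sub>M ?BS) (\<lambda>\<omega>. (increments N h \<omega>, \<lambda>i. X (Suc i) \<omega>)))"
    by (subst sets_distr) (rule sets_pair_measure_cong[OF sK sS])
  fix A B assume A: "A \<in> sets ?K" and B: "B \<in> sets ?S"
  let ?a = "increments N h -` A \<inter> space M" and ?b = "(\<lambda>\<omega> i. X (Suc i) \<omega>) -` B \<inter> space M"
  let ?vN = "vimage_algebra (space M) (\<lambda>\<omega>. \<lambda>t\<in>{0..}. N t \<omega>) (PiM {0..} (\<lambda>_. count_space UNIV))"
  let ?vX = "vimage_algebra (space M) (\<lambda>\<omega>. \<lambda>i\<in>{1..}. X i \<omega>) (PiM {1..} (\<lambda>_. borel))"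
  have "increments N h \<in> measurable ?vN ?CK"
  proof -
    have "(\<lambda>f n. f (real (Suc n) * h) - f (real n * h)) \<in> measurable (PiM {0..} (\<lambda>_. count_space (UNIV::nat set))) ?CK"
      using assms
      by (intro measurable_PiM_single' measurable_diff_count_space measurable_component_singleton) auto
    from measurable_compose[OF measurable_vimage_algebra1 this, of "\<lambda>\<omega>. \<lambda>t\<in>{0..}. N t \<omega>" "space M"]
    show ?thesis using assms by (simp add: increments_def[abs_def] space_PiM)
  qed
  then have a: "?a \<in> sets ?vN" using A unfolding sK by (auto dest: measurable_sets)
  have "(\<lambda>\<omega> i. X (Suc i) \<omega>) \<in> measurable ?vX ?BS"
  proof -
    have "(\<lambda>f n. f (Suc n)) \<in> measurable (PiM {1..} (\<lambda>_. borel :: real measure)) ?BS"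
      by (intro measurable_PiM_single') (auto intro!: measurable_component_singleton)
    from measurable_compose[OF measurable_vimage_algebra1 this, of "\<lambda>\<omega>. \<lambda>i\<in>{1..}. X i \<omega>" "space M"]
    show ?thesis by (simp add: space_PiM)
  qed
  then have b: "?b \<in> sets ?vX" using B unfolding sS by (auto dest: measurable_sets)
  have "emeasure (distr M (?CK \<Otimes>\<^sub>M ?BS) (\<lambda>\<omega>. (increments N h \<omega>, \<lambda>i. X (Suc i) \<omega>))) (A \<times> B) = emeasure M (?a \<inter> ?b)"
    using A B unfolding sK sS
    by (subst emeasure_distr[OF measurable_Pair[OF measurable_increments[OF assms] measurable_X_sequence]])
       (auto intro!: arg_cong[where f="emeasure M"])
  also have "\<dots> = emeasure M ?a * emeasure M ?b"
    using indep_setD[OF N_X_indep a b] by (simp add: emeasure_eq_measure ennreal_mult)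
  also have "emeasure M ?a = emeasure ?K A"
    using A measurable_increments[OF assms] unfolding sK distr_increments[OF assms, symmetric]
    by (subst emeasure_distr) (simp_all only: sets_distr)
  also have "emeasure M ?b = emeasure ?S B"
    using B measurable_X_sequence unfolding sS distr_X_sequence[symmetric]
    by (subst emeasure_distr) (simp_all only: sets_distr)
  finally show "emeasure ?K A * emeasure ?S B = emeasure (distr M (?CK \<Otimes>\<^sub>M ?BS) (\<lambda>\<omega>. (increments N h \<omega>, \<lambda>i. X (Suc i) \<omega>))) (A \<times> B)" ..
qed

section \<open>Ruin probabilities as limits of skeleton probabilities\<close>

definition below_prob :: "real \<Rightarrow> real \<Rightarrow> real \<Rightarrow> real" where
  "below_prob c a u = prob {\<omega>\<in>space M. ruins_below c N X a u \<omega>}"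

definition sk_prob :: "real \<Rightarrow> real \<Rightarrow> real \<Rightarrow> real \<Rightarrow> real" where
  "sk_prob c a h u = law.skeleton_ruin_prob (poisson_pmf (rate * h)) c h a u"

lemma sk_event: "0 < h \<Longrightarrow> {\<omega>\<in>space M. skeleton_ruin c h a u (increments N h \<omega>) (\<lambda>i. X (Suc i) \<omega>)} \<in> events"
  using measurable_increments measurable_X_sequence by measurable

lemma sk_prob_eq:
  assumes "0 < h"
  shows "sk_prob c a h u = prob {\<omega>\<in>space M. skeleton_ruin c h a u (increments N h \<omega>) (\<lambda>i. X (Suc i) \<omega>)}"
proof -
  note [measurable] = measurable_increments[OF assms] measurable_X_sequence
  let ?CK = "PiM UNIV (\<lambda>_::nat. count_space (UNIV::nat set))" and ?BS = "PiM UNIV (\<lambda>_::nat. borel::real measure)"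
  have "{(k, x). skeleton_ruin c h a u k x} = {z\<in>space (?CK \<Otimes>\<^sub>M ?BS). skeleton_ruin c h a u (fst z) (snd z)}"
    by (auto simp: space_pair_measure space_PiM)
  also have "\<dots> \<in> sets (?CK \<Otimes>\<^sub>M ?BS)" by measurable
  finally show ?thesis
    unfolding sk_prob_def law.skeleton_ruin_prob_def joint_law[OF assms, symmetric]
    by (subst measure_distr) (auto intro!: arg_cong[where f=prob])
qed

lemma skeleton_indicator_tendsto:
  assumes "0 < c" "0 \<le> u" "0 \<le> a" "\<omega> \<in> space M"
  shows "eventually (\<lambda>m. skeleton_ruin c (inverse (real (Suc m))) a u (increments N (inverse (real (Suc m))) \<omega>) (\<lambda>i. X (Suc i) \<omega>)
     \<longleftrightarrow> ruins_below c N X a u \<omega>) sequentially"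
proof -
  have "filterlim (\<lambda>m. inverse (real (Suc m))) (at_right 0) sequentially"
    using LIMSEQ_inverse_real_of_nat by (auto simp: filterlim_at)
  from filterlim_iff[THEN iffD1, OF this, rule_format, OF skeleton_ruin_eventually[OF assms(4,1-3), of X]]
  show ?thesis by (simp add: increments_def[abs_def])
qed

text \<open>\<open>ruins_below\<close> quantifies over uncountably many times; pathwise agreement
  with the skeleton on fine grids exhibits the event as the limit inferior of measurable
  events.\<close>

lemma ruins_below_event:
  assumes "0 < c" "0 \<le> u" "0 \<le> a"
  shows "{\<omega>\<in>space M. ruins_below c N X a u \<omega>} \<in> events"
proof -
  let ?A = "\<lambda>m. {\<omega>\<in>space M. skeleton_ruin c (inverse (real (Suc m))) a u (increments N (inverse (real (Suc m))) \<omega>) (\<lambda>i. X (Suc i) \<omega>)}"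
  have "{\<omega>\<in>space M. ruins_below c N X a u \<omega>} = (\<Union>n. \<Inter>m\<in>{n..}. ?A m)"
  proof (intro set_eqI iffI)
    fix \<omega> assume w: "\<omega> \<in> {\<omega>\<in>space M. ruins_below c N X a u \<omega>}"
    then show "\<omega> \<in> (\<Union>n. \<Inter>m\<in>{n..}. ?A m)"
      using skeleton_indicator_tendsto[OF assms, of \<omega>] unfolding eventually_sequentially by auto
  next
    fix \<omega> assume "\<omega> \<in> (\<Union>n. \<Inter>m\<in>{n..}. ?A m)"
    then obtain n where n: "\<And>m. n \<le> m \<Longrightarrow> \<omega> \<in> ?A m" by auto
    then have "\<omega> \<in> space M" by blast
    from skeleton_indicator_tendsto[OF assms this]
    obtain k where "\<And>m. k \<le> m \<Longrightarrow> \<omega> \<in> ?A m \<longleftrightarrow> \<omega> \<in> {\<omega>\<in>space M. ruins_below c N X a u \<omega>}"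
      using \<open>\<omega> \<in> space M\<close> unfolding eventually_sequentially by auto
    from this[of "max n k"] n[of "max n k"] show "\<omega> \<in> {\<omega>\<in>space M. ruins_below c N X a u \<omega>}" by simp
  qed
  also have "\<dots> \<in> events"
    by (intro sets.countable_UN' sets.countable_INT') (auto intro!: sk_event)
  finally show ?thesis .
qed

lemma sk_prob_tendsto:
  assumes "0 < c" "0 \<le> u" "0 \<le> a"
  shows "(\<lambda>m. sk_prob c a (inverse (real (Suc m))) u) \<longlonglongrightarrow> below_prob c a u"
proof -
  let ?A = "\<lambda>m. {\<omega>\<in>space M. skeleton_ruin c (inverse (real (Suc m))) a u (increments N (inverse (real (Suc m))) \<omega>) (\<lambda>i. X (Suc i) \<omega>)}"
  let ?E = "{\<omega>\<in>space M. ruins_below c N X a u \<omega>}"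
  have "(\<lambda>m. integral\<^sup>L M (indicator (?A m) :: 'a \<Rightarrow> real)) \<longlonglongrightarrow> integral\<^sup>L M (indicator ?E)"
  proof (rule integral_dominated_convergence[where w="\<lambda>_. 1"])
    show "AE \<omega> in M. (\<lambda>m. indicator (?A m) \<omega> :: real) \<longlonglongrightarrow> indicator ?E \<omega>"
    proof (rule AE_I2)
      fix \<omega> assume w: "\<omega> \<in> space M"
      show "(\<lambda>m. indicator (?A m) \<omega> :: real) \<longlonglongrightarrow> indicator ?E \<omega>"
        by (rule tendsto_eventually, rule eventually_mono[OF skeleton_indicator_tendsto[OF assms w]])
           (auto simp: indicator_def)
    qed
  qed (auto intro!: borel_measurable_indicator sk_event ruins_below_event assms simp: indicator_def)
  then show ?thesis
    by (simp add: sk_prob_eq below_prob_def ruins_below_event[OF assms] sk_event)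
qed

lemma below_prob_bounds: "0 \<le> below_prob c a u" "below_prob c a u \<le> 1"
  by (auto simp: below_prob_def)

lemma below_prob_mono: "0 < c \<Longrightarrow> 0 \<le> u \<Longrightarrow> 0 \<le> a \<Longrightarrow> a \<le> b \<Longrightarrow> below_prob c b u \<le> below_prob c a u"
  unfolding below_prob_def
  by (intro finite_measure_mono ruins_below_event) (auto intro: ruins_below_mono)

lemma below_prob_right_continuous:
  assumes "0 < c" "0 \<le> u" "0 \<le> a"
  shows "(below_prob c a \<longlongrightarrow> below_prob c a u) (at_right u)"
proof (rule tendsto_at_right_sequentially[where b="u + 1"])
  fix v :: "nat \<Rightarrow> real" assume v: "\<And>n. u < v n" "v \<longlonglongrightarrow> u"
  let ?E = "\<lambda>u. {\<omega>\<in>space M. ruins_below c N X a u \<omega>}"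
  have lim: "filterlim v (at_right u) sequentially"
  proof -
    have "v n \<noteq> u" for n using v(1)[of n] by simp
    then show ?thesis using v by (simp add: filterlim_at)
  qed
  have "(\<lambda>m. integral\<^sup>L M (indicator (?E (v m)) :: 'a \<Rightarrow> real)) \<longlonglongrightarrow> integral\<^sup>L M (indicator (?E u))"
  proof (rule integral_dominated_convergence[where w="\<lambda>_. 1"])
    show "AE \<omega> in M. (\<lambda>m. indicator (?E (v m)) \<omega> :: real) \<longlonglongrightarrow> indicator (?E u) \<omega>"
    proof (rule AE_I2)
      fix \<omega> assume w: "\<omega> \<in> space M"
      show "(\<lambda>m. indicator (?E (v m)) \<omega> :: real) \<longlonglongrightarrow> indicator (?E u) \<omega>"
        by (rule tendsto_eventually, rule eventually_mono[OF
              filterlim_iff[THEN iffD1, OF lim, rule_format, OF ruins_below_right_continuous[OF w assms]]])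
           (auto simp: indicator_def)
    qed
    show "indicat_real (?E (v m)) \<in> borel_measurable M" for m
      using v(1)[of m] assms by (intro borel_measurable_indicator ruins_below_event) auto
  qed (use assms in \<open>auto intro!: borel_measurable_indicator ruins_below_event simp: indicator_def\<close>)
  moreover have "0 \<le> v m" for m using v(1)[of m] assms by simp
  ultimately show "(\<lambda>n. below_prob c a (v n)) \<longlonglongrightarrow> below_prob c a u"
    using assms by (simp add: below_prob_def ruins_below_event)
qed simp

lemma measurable_sk_prob [measurable]: "0 \<le> a \<Longrightarrow> sk_prob c a h \<in> borel_measurable borel"
  unfolding sk_prob_def[abs_def] by (rule law.measurable_skeleton_ruin_prob)

lemma measurable_below_prob:
  assumes "0 < c" "0 \<le> a"
  shows "(\<lambda>u. if 0 \<le> u then below_prob c a u else 0) \<in> borel_measurable borel"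
proof (rule borel_measurable_LIMSEQ_real)
  fix u :: real
  show "(\<lambda>m. if 0 \<le> u then sk_prob c a (inverse (real (Suc m))) u else 0) \<longlonglongrightarrow> (if 0 \<le> u then below_prob c a u else 0)"
    using sk_prob_tendsto[OF assms(1) _ assms(2)] by auto
qed (use assms in measurable)

lemma sk_prob_bounds: "0 \<le> a \<Longrightarrow> 0 \<le> sk_prob c a h u" "0 \<le> a \<Longrightarrow> sk_prob c a h u \<le> 1"
  unfolding sk_prob_def by (rule law.skeleton_ruin_prob_bounds, assumption)+

end


section \<open>From the skeleton to an integrated equation\<close>

text \<open>A Lipschitz substitute for the indicator of \<open>{s<..}\<close>, with slope
  \<open>1 / e\<close>: the test function has to be differenced, and its quotient then becomes the
  averaging window on \<open>{s..<s + e}\<close>.\<close>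

definition ramp :: "real \<Rightarrow> real \<Rightarrow> real \<Rightarrow> real" where
  "ramp e s v = max 0 (min 1 ((v - s) / e))"

lemma measurable_ramp [measurable]: "ramp e s \<in> borel_measurable borel"
  unfolding ramp_def[abs_def] by measurable

lemma ramp_bounds: "0 \<le> ramp e s v" "ramp e s v \<le> 1"
  by (auto simp: ramp_def)

lemma ramp_zero: "0 < e \<Longrightarrow> v \<le> s \<Longrightarrow> ramp e s v = 0"
  using divide_nonpos_pos[of "v - s" e] by (simp add: ramp_def)

lemma ramp_one: "0 < e \<Longrightarrow> s + e \<le> v \<Longrightarrow> ramp e s v = 1"
  by (auto simp: ramp_def max_def min_def field_simps)

lemma ramp_mid: "0 < e \<Longrightarrow> s \<le> v \<Longrightarrow> v \<le> s + e \<Longrightarrow> ramp e s v = (v - s) / e"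
  by (auto simp: ramp_def max_def min_def field_simps)

lemma ramp_lipschitz:
  assumes "0 < e" "0 \<le> d" shows "\<bar>ramp e s (v + d) - ramp e s v\<bar> \<le> d / e"
proof -
  have clamp: "\<bar>max 0 (min 1 x) - max 0 (min 1 y)\<bar> \<le> \<bar>x - y\<bar>" for x y :: real by auto
  have "(v + d - s) / e - (v - s) / e = d / e" by (simp add: diff_divide_distrib[symmetric])
  then show ?thesis using clamp[of "(v + d - s) / e" "(v - s) / e"] assms unfolding ramp_def by simp
qed

lemma ramp_antimono: "0 < e \<Longrightarrow> s \<le> t \<Longrightarrow> ramp e t v \<le> ramp e s v"
  unfolding ramp_def by (intro max.mono min.mono) (auto simp: divide_right_mono)

text \<open>The quotient tends to \<open>c\<close> times the right derivative, hence the half-open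
  interval: at the kink \<open>s\<close> the slope to the right is already \<open>1 / e\<close>, at
  \<open>s + e\<close> it is 0. Away from accidents at the kinks the ramp is affine, so equality
  holds for small \<open>h\<close> and not only in the limit.\<close>

lemma ramp_quotient_eventually:
  assumes "0 < e" "0 < c"
  shows "eventually (\<lambda>h. (ramp e s (v + c * h) - ramp e s v) / h = c / e * indicator {s..<s + e} v) (at_right 0)"
proof -
  consider "v < s" | "s \<le> v" "v < s + e" | "s + e \<le> v" by linarith
  then show ?thesis
  proof cases
    case 1
    then show ?thesis unfolding eventually_at_right_field
      using assms by (intro exI[of _ "(s - v) / c"]) (auto simp: field_simps ramp_zero)
  next
    case 2
    have "(ramp e s (v + c * h) - ramp e s v) / h = c / e" if "0 < h" "h < (s + e - v) / c" for h
    proof -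
      have "v + c * h \<le> s + e" "s \<le> v + c * h" using that assms 2 by (auto simp: field_simps add_nonneg_nonneg intro: order.trans)
      then show ?thesis using that assms 2 by (simp add: ramp_mid field_simps)
    qed
    then show ?thesis unfolding eventually_at_right_field
      using assms 2 by (intro exI[of _ "(s + e - v) / c"]) auto
  next
    case 3
    then show ?thesis unfolding eventually_at_right_field
      using assms by (intro exI[of _ 1]) (auto simp: ramp_one add_increasing2)
  qed
qed

lemma ramp_tendsto:
  assumes "e \<longlonglongrightarrow> 0" "\<And>n. 0 < e n"
  shows "(\<lambda>n. ramp (e n) s v) \<longlonglongrightarrow> indicator {s<..} v"
proof (cases "s < v")
  case True
  have "eventually (\<lambda>n. e n < v - s) sequentially"
    using order_tendstoD(2)[OF assms(1)] True by simp
  then have "eventually (\<lambda>n. ramp (e n) s v = indicator {s<..} v) sequentially"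
    by eventually_elim (use True assms(2) in \<open>auto simp: ramp_one\<close>)
  then show ?thesis by (rule tendsto_eventually)
qed (use assms in \<open>simp add: ramp_zero\<close>)

lemma integrable_bounded_indicator:
  fixes f :: "real \<Rightarrow> real"
  assumes "f \<in> borel_measurable borel" "\<And>v. \<bar>f v\<bar> \<le> B" "\<And>v. v \<notin> {s..t} \<Longrightarrow> f v = 0"
  shows "integrable lborel f"
proof (rule Bochner_Integration.integrable_bound)
  show "integrable lborel (\<lambda>v. B * indicator {s..t} v :: real)"
    by (intro integrable_mult_right) (auto simp: integrable_indicator_iff emeasure_lborel_Icc_eq)
  have "norm (f v) \<le> norm (B * indicator {s..t} v)" for v
    using assms(2)[of v] assms(3)[of v] by (cases "v \<in> {s..t}") auto
  then show "AE v in lborel. norm (f v) \<le> norm (B * indicator {s..t} v)" by simp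
qed (use assms in simp)

section \<open>Passage to the limit in the one-step equation\<close>

context claim_law
begin

text \<open>A discrete integration by parts. The one-step relation controls a difference of
  \<open>p m\<close>, whose smoothness is unknown. After multiplication by the trapezoid
  \<open>\<eta>\<close> and integration, translation invariance passes the shift by
  \<open>c * h m\<close> to \<open>\<eta>\<close>, whose quotient converges; pointwise convergence
  of \<open>p m\<close> on the half-line then suffices.\<close>

lemma skeleton_limit_ramp:
  fixes p :: "nat \<Rightarrow> real \<Rightarrow> real" and h :: "nat \<Rightarrow> real" and \<phi> :: "real \<Rightarrow> real"
  assumes c: "0 < c" and l: "0 \<le> l" and b: "0 < b" and e: "0 < e"
    and h: "\<And>m. 0 < h m" "\<And>m. h m \<le> 1" "h \<longlonglongrightarrow> 0"
    and pm [measurable]: "\<And>m. p m \<in> borel_measurable borel"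
    and pb: "\<And>m u. 0 \<le> p m u" "\<And>m u. p m u \<le> 1"
    and lim: "\<And>u. 0 \<le> u \<Longrightarrow> (\<lambda>m. p m u) \<longlonglongrightarrow> \<phi> u"
    and incr: "\<And>m w. 0 \<le> w \<Longrightarrow> \<bar>p m (w - c * h m) - (exp (- (l * h m)) * p m w
        + l * h m * exp (- (l * h m)) * (\<integral>y. extend_neg a (p m) (w - y) \<partial>D))\<bar> \<le> (l * h m)\<^sup>2"
    and \<phi>0 [simp]: "\<And>u. u < 0 \<Longrightarrow> \<phi> u = 0"
  shows "(LBINT v. \<phi> v * (c / e * indicator {0..<e} v - c / e * indicator {b..<b + e} v))
    = (LBINT w. (ramp e 0 w - ramp e b w) * (l * (\<integral>y. extend_neg a \<phi> (w - y) \<partial>D) - l * \<phi> w))"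
proof -
  define \<eta> where "\<eta> w = ramp e 0 w - ramp e b w" for w
  define k where "k m w = (\<integral>y. extend_neg a (p m) (w - y) \<partial>D)" for m w
  define K where "K w = (\<integral>y. extend_neg a \<phi> (w - y) \<partial>D)" for w
  have [measurable]: "\<phi> \<in> borel_measurable borel"
  proof (rule borel_measurable_LIMSEQ_real)
    show "(\<lambda>m. if 0 \<le> u then p m u else 0) \<longlonglongrightarrow> \<phi> u" for u
      using lim by (cases "0 \<le> u") auto
  qed measurable
  have [measurable]: "extend_neg a \<phi> \<in> borel_measurable borel" "\<And>m. extend_neg a (p m) \<in> borel_measurable borel"
    by measurable
  have [measurable]: "\<And>m. k m \<in> borel_measurable borel" "K \<in> borel_measurable borel"
    unfolding k_def[abs_def] K_def[abs_def] by measurable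
  have [measurable]: "\<eta> \<in> borel_measurable borel" unfolding \<eta>_def[abs_def] by measurable
  have \<eta>b: "0 \<le> \<eta> w" "\<eta> w \<le> 1" for w
    using ramp_antimono[OF e, of 0 b w] b ramp_bounds[of e 0 w] ramp_bounds[of e b w] unfolding \<eta>_def by auto
  have \<eta>0: "\<eta> w = 0" if "w \<notin> {0..b + e}" for w
    using that e b by (auto simp: \<eta>_def ramp_zero ramp_one)
  have \<eta>neg: "\<eta> w = 0" if "w \<le> 0" for w using that e b by (simp add: \<eta>_def ramp_zero)
  have qb: "0 \<le> extend_neg a (p m) v" "extend_neg a (p m) v \<le> 1" for m v
    using pb by (auto simp: extend_neg_def indicator_def)
  have kb: "0 \<le> k m w" "k m w \<le> 1" for m w
    unfolding k_def using qb by (auto intro!: integral_nonneg_AE integral_le_const integrable_const_bound[where B=1])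
  have klim: "(\<lambda>m. k m w) \<longlonglongrightarrow> K w" for w
    unfolding k_def K_def
  proof (rule integral_dominated_convergence[where w="\<lambda>_. 1"])
    show "AE y in D. (\<lambda>m. extend_neg a (p m) (w - y)) \<longlonglongrightarrow> extend_neg a \<phi> (w - y)"
      by (rule AE_I2) (auto simp: extend_neg_def lim)
    show "AE y in D. norm (extend_neg a (p m) (w - y)) \<le> 1" for m using qb by auto
  qed auto
  \<comment> \<open>\<open>L\<close> has the difference quotient on the test function,
    \<open>R\<close> has it on \<open>p m\<close>, expanded by the one-step relation;
    \<open>E\<close> is the Poisson remainder divided by the step.\<close>
  define L where "L m v = p m v * ((\<eta> (v + c * h m) - \<eta> v) / h m)" for m v
  define E where "E m w = (p m (w - c * h m) - (exp (- (l * h m)) * p m w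
        + l * h m * exp (- (l * h m)) * k m w)) / h m" for m w
  define R where "R m w = \<eta> w * (E m w + (exp (- (l * h m)) - 1) / h m * p m w + l * exp (- (l * h m)) * k m w)" for m w
  have [measurable]: "\<And>m. L m \<in> borel_measurable borel" "\<And>m. E m \<in> borel_measurable borel" "\<And>m. R m \<in> borel_measurable borel"
    unfolding L_def[abs_def] E_def[abs_def] R_def[abs_def] by measurable
  have LR: "integral\<^sup>L lborel (L m) = integral\<^sup>L lborel (R m)" for m
  proof -
    note hm = h(1)[of m]
    have int1: "integrable lborel (\<lambda>v. p m v * \<eta> v)"
      by (rule integrable_bounded_indicator[where B=1 and s=0 and t="b+e"])
         (use pb \<eta>b \<eta>0 in \<open>auto simp: abs_mult intro!: mult_le_one\<close>)
    have int2: "integrable lborel (\<lambda>v. p m v * \<eta> (v + c * h m))"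
      by (rule integrable_bounded_indicator[where B=1 and s="- c * h m" and t="b+e- c * h m"])
         (use pb \<eta>b \<eta>0 in \<open>auto simp: abs_mult intro!: mult_le_one\<close>)
    have int3: "integrable lborel (\<lambda>v. p m (v - c * h m) * \<eta> v)"
      by (rule integrable_bounded_indicator[where B=1 and s=0 and t="b+e"])
         (use pb \<eta>b \<eta>0 in \<open>auto simp: abs_mult intro!: mult_le_one\<close>)
    have "integral\<^sup>L lborel (L m) = (LBINT v. (p m v * \<eta> (v + c * h m) - p m v * \<eta> v) / h m)"
      unfolding L_def by (intro Bochner_Integration.integral_cong) (auto simp: algebra_simps diff_divide_distrib)
    also have "\<dots> = ((LBINT v. p m v * \<eta> (v + c * h m)) - (LBINT v. p m v * \<eta> v)) / h m"
      using int1 int2 by simp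
    also have "(LBINT v. p m v * \<eta> (v + c * h m)) = (LBINT v. p m (v - c * h m) * \<eta> v)"
      using lborel_integral_real_affine[of 1 "\<lambda>v. p m (v - c * h m) * \<eta> v" "c * h m"] by (simp add: add.commute)
    also have "((LBINT v. p m (v - c * h m) * \<eta> v) - (LBINT v. p m v * \<eta> v)) / h m
       = (LBINT v. (p m (v - c * h m) * \<eta> v - p m v * \<eta> v) / h m)"
      using int1 int3 by simp
    also have "\<dots> = integral\<^sup>L lborel (R m)"
      unfolding R_def E_def using hm by (intro Bochner_Integration.integral_cong) (auto simp: field_simps)
    finally show ?thesis .
  qed
  have hr: "filterlim h (at_right 0) sequentially"
    using h by (auto simp: filterlim_at less_imp_neq[symmetric])
  have "(\<lambda>m. integral\<^sup>L lborel (L m)) \<longlonglongrightarrow> (LBINT v. \<phi> v * (c / e * indicator {0..<e} v - c / e * indicator {b..<b + e} v))"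
  \<comment> \<open>Steps are at most 1, so the shift is at most \<open>c\<close> and the quotient
    vanishes outside \<open>{- c..b + e}\<close>; each of the two ramps contributes a slope of at
    most \<open>1 / e\<close>.\<close>
  proof (rule integral_dominated_convergence[where w="\<lambda>v. 2 * c / e * indicator {- c..b + e} v"])
    show "integrable lborel (\<lambda>v. 2 * c / e * indicator {- c..b + e} v :: real)"
      by (intro integrable_mult_right) (auto simp: integrable_indicator_iff emeasure_lborel_Icc_eq)
    show "AE v in lborel. (\<lambda>m. L m v) \<longlonglongrightarrow> \<phi> v * (c / e * indicator {0..<e} v - c / e * indicator {b..<b + e} v)"
    proof (rule AE_I2)
      fix v
      have ev: "eventually (\<lambda>m. (ramp e s (v + c * h m) - ramp e s v) / h m = c / e * indicator {s..<s + e} v) sequentially" for s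
        using filterlim_iff[THEN iffD1, OF hr, rule_format, OF ramp_quotient_eventually[OF e c, of s v]] .
      have "eventually (\<lambda>m. (\<eta> (v + c * h m) - \<eta> v) / h m = c / e * indicator {0..<e} v - c / e * indicator {b..<b + e} v) sequentially"
        using ev[of 0] ev[of b] by eventually_elim (simp add: \<eta>_def diff_divide_distrib algebra_simps add_divide_distrib)
      then have q: "(\<lambda>m. (\<eta> (v + c * h m) - \<eta> v) / h m) \<longlonglongrightarrow> c / e * indicator {0..<e} v - c / e * indicator {b..<b + e} v"
        by (rule tendsto_eventually)
      show "(\<lambda>m. L m v) \<longlonglongrightarrow> \<phi> v * (c / e * indicator {0..<e} v - c / e * indicator {b..<b + e} v)"
      proof (cases "0 \<le> v")
        case True
        show ?thesis unfolding L_def by (intro tendsto_mult lim[OF True] q)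
      next
        \<comment> \<open>For negative \<open>v\<close> nothing is known about the convergence of
          \<open>p m v\<close>; its boundedness suffices because the quotient of the trapezoid tends
          to 0 there.\<close>
        case False
        then have "c / e * indicator {0..<e} v - c / e * indicator {b..<b + e} v = 0" using b by auto
        with q have "(\<lambda>m. (\<eta> (v + c * h m) - \<eta> v) / h m) \<longlonglongrightarrow> 0" by (simp only:)
        then have "(\<lambda>m. L m v) \<longlonglongrightarrow> 0"
          by (rule Lim_null_comparison[rotated, OF tendsto_rabs_zero])
             (use pb in \<open>auto simp: L_def abs_mult intro!: always_eventually divide_right_mono mult_left_le_one_le\<close>)
        then show ?thesis using False b by simp
      qed
    qed
    show "AE v in lborel. norm (L m v) \<le> 2 * c / e * indicator {- c..b + e} v" for m
    proof (rule AE_I2)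
      fix v
      show "norm (L m v) \<le> 2 * c / e * indicator {- c..b + e} v"
      proof (cases "v \<in> {- c..b + e}")
        case True
        have "\<bar>\<eta> (v + c * h m) - \<eta> v\<bar> \<le> 2 * (c * h m / e)"
          using ramp_lipschitz[OF e, of "c * h m" 0 v] ramp_lipschitz[OF e, of "c * h m" b v] c h(1)[of m]
          unfolding \<eta>_def by auto
        then have "\<bar>(\<eta> (v + c * h m) - \<eta> v) / h m\<bar> \<le> 2 * c / e" using h(1)[of m] by (simp add: field_simps)
        then have "\<bar>L m v\<bar> \<le> 1 * (2 * c / e)" unfolding L_def abs_mult using pb by (intro mult_mono) auto
        then show ?thesis using True by simp
      next
        case False
        have "c * h m \<le> c * 1" using h(2)[of m] c by (intro mult_left_mono) auto
        moreover have "0 < c * h m" using c h(1)[of m] by simp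
        ultimately have "v < 0 \<and> v + c * h m \<le> 0 \<or> b + e \<le> v" using False b e by auto
        then have "\<eta> (v + c * h m) = 0 \<and> \<eta> v = 0" using \<eta>neg \<eta>0 e b \<open>0 < c * h m\<close>
          by (auto simp: \<eta>_def ramp_zero ramp_one)
        then show ?thesis using False by (simp add: L_def)
      qed
    qed
  qed measurable
  moreover have "(\<lambda>m. integral\<^sup>L lborel (R m)) \<longlonglongrightarrow> (LBINT w. \<eta> w * (l * K w - l * \<phi> w))"
  \<comment> \<open>In the majorant, \<open>l\<^sup>2\<close> bounds the remainder, and the terms
    for no claim and for one claim contribute \<open>l\<close> each.\<close>
  proof (rule integral_dominated_convergence[where w="\<lambda>v. (l\<^sup>2 + 2 * l) * indicator {0..b + e} v"])
    have Eb: "\<bar>E m w\<bar> \<le> l\<^sup>2 * h m" if "0 \<le> w" for m w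
      using incr[OF that, of m] h(1)[of m] unfolding E_def k_def by (simp add: power2_eq_square field_simps)
    have dl: "((\<lambda>t. (exp (- (l * t)) - 1) / t) \<longlongrightarrow> - l) (at 0)"
    proof -
      have "((\<lambda>t. exp (- (l * t))) has_real_derivative - l) (at 0)"
        by (auto intro!: derivative_eq_intros)
      then show ?thesis by (simp add: has_field_derivative_iff)
    qed
    have h0: "filterlim h (at 0) sequentially"
      using hr by (auto simp: filterlim_at elim: eventually_mono)
    show "integrable lborel (\<lambda>v. (l\<^sup>2 + 2 * l) * indicator {0..b + e} v :: real)"
      by (intro integrable_mult_right) (auto simp: integrable_indicator_iff emeasure_lborel_Icc_eq)
    show "AE w in lborel. (\<lambda>m. R m w) \<longlonglongrightarrow> \<eta> w * (l * K w - l * \<phi> w)"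
    proof (rule AE_I2)
      fix w
      show "(\<lambda>m. R m w) \<longlonglongrightarrow> \<eta> w * (l * K w - l * \<phi> w)"
      proof (cases "0 \<le> w")
        case True
        have "(\<lambda>m. l\<^sup>2 * h m) \<longlonglongrightarrow> 0" using tendsto_mult[OF tendsto_const h(3), of "l\<^sup>2"] by simp
        then have 1: "(\<lambda>m. E m w) \<longlonglongrightarrow> 0"
          by (rule Lim_null_comparison[rotated]) (auto simp: Eb[OF True])
        have 2: "(\<lambda>m. (exp (- (l * h m)) - 1) / h m) \<longlonglongrightarrow> - l"
          using filterlim_compose[OF dl h0] .
        have "(\<lambda>m. exp (- (l * h m))) \<longlonglongrightarrow> exp (- (l * 0))" by (intro tendsto_intros h(3))
        then have 3: "(\<lambda>m. exp (- (l * h m))) \<longlonglongrightarrow> 1" by simp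
        have "(\<lambda>m. R m w) \<longlonglongrightarrow> \<eta> w * (0 + (- l) * \<phi> w + l * 1 * K w)"
          unfolding R_def by (intro tendsto_intros 1 2 3 lim[OF True] klim)
        then show ?thesis by (simp add: algebra_simps)
      qed (simp add: R_def \<eta>neg)
    qed
    show "AE w in lborel. norm (R m w) \<le> (l\<^sup>2 + 2 * l) * indicator {0..b + e} w" for m
    proof (rule AE_I2)
      fix w
      show "norm (R m w) \<le> (l\<^sup>2 + 2 * l) * indicator {0..b + e} w"
      proof (cases "w \<in> {0..b + e}")
        case True
        have e1: "\<bar>E m w\<bar> \<le> l\<^sup>2"
          using Eb[of w m] True mult_left_mono[OF h(2)[of m], of "l\<^sup>2"] by auto
        have "1 - l * h m \<le> exp (- (l * h m))" using exp_ge_add_one_self[of "- (l * h m)"] by simp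
        moreover have x1: "exp (- (l * h m)) \<le> 1" using l h(1)[of m] by simp
        ultimately have "\<bar>(exp (- (l * h m)) - 1) / h m\<bar> \<le> l" using h(1)[of m] by (simp add: field_simps abs_if)
        then have e2: "\<bar>(exp (- (l * h m)) - 1) / h m * p m w\<bar> \<le> l * 1"
          unfolding abs_mult using pb l by (intro mult_mono) auto
        have e3: "\<bar>l * exp (- (l * h m)) * k m w\<bar> \<le> l * 1 * 1"
          unfolding abs_mult using l x1 kb by (intro mult_mono) auto
        have "\<bar>E m w + (exp (- (l * h m)) - 1) / h m * p m w + l * exp (- (l * h m)) * k m w\<bar> \<le> l\<^sup>2 + 2 * l"
          using e1 e2 e3 by linarith
        then have "\<bar>R m w\<bar> \<le> 1 * (l\<^sup>2 + 2 * l)"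
          unfolding R_def abs_mult using \<eta>b by (intro mult_mono) auto
        then show ?thesis using True by simp
      qed (simp add: R_def \<eta>0)
    qed
  qed measurable
  ultimately have "(LBINT v. \<phi> v * (c / e * indicator {0..<e} v - c / e * indicator {b..<b + e} v)) = (LBINT w. \<eta> w * (l * K w - l * \<phi> w))"
    unfolding LR by (rule LIMSEQ_unique)
  then show ?thesis unfolding \<eta>_def K_def .
qed

text \<open>The substitution \<open>v = s + e n * t\<close> fixes the window at
  \<open>{0..<1}\<close>; for \<open>t > 0\<close> the arguments approach \<open>s\<close> from the
  right, so right-continuity is enough.\<close>

lemma average_tendsto:
  fixes \<phi> :: "real \<Rightarrow> real"
  assumes [measurable]: "\<phi> \<in> borel_measurable borel" and bd: "\<And>v. \<bar>\<phi> v\<bar> \<le> B"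
    and rc: "(\<phi> \<longlongrightarrow> \<phi> s) (at_right s)" and e: "e \<longlonglongrightarrow> 0" "\<And>n. 0 < e n"
  shows "(\<lambda>n. (LBINT v. \<phi> v * (1 / e n * indicator {s..<s + e n} v))) \<longlonglongrightarrow> \<phi> s"
proof -
  have eq: "(LBINT v. \<phi> v * (1 / e n * indicator {s..<s + e n} v)) = (LBINT t. \<phi> (s + e n * t) * indicator {0..<1} t)" for n
  proof -
    have "(LBINT v. \<phi> v * (1 / e n * indicator {s..<s + e n} v))
      = e n * (LBINT t. \<phi> (s + e n * t) * (1 / e n * indicator {s..<s + e n} (s + e n * t)))"
      using e(2)[of n] by (subst lborel_integral_real_affine[where c="e n" and t=s]) auto
    also have "(\<lambda>t. \<phi> (s + e n * t) * (1 / e n * indicator {s..<s + e n} (s + e n * t)))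
       = (\<lambda>t. 1 / e n * (\<phi> (s + e n * t) * indicator {0..<1} t))"
      using e(2)[of n] by (auto simp: indicator_def fun_eq_iff zero_le_mult_iff)
    finally show ?thesis using e(2)[of n] by simp
  qed
  have "(\<lambda>n. \<integral>t. \<phi> (s + e n * t) * indicator {0..<1} t \<partial>lborel) \<longlonglongrightarrow> (LBINT t. \<phi> s * indicator {0..<1::real} t)"
  proof (rule integral_dominated_convergence[where w="\<lambda>v::real. B * indicator {0..1} v"])
    show "integrable lborel (\<lambda>v::real. B * indicator {0..1} v :: real)"
      by (intro integrable_mult_right) (auto simp: integrable_indicator_iff emeasure_lborel_Icc_eq)
    show "AE t in lborel. (\<lambda>n. \<phi> (s + e n * t) * indicator {0..<1} t) \<longlonglongrightarrow> \<phi> s * indicator {0..<1} t"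
    proof (rule AE_I2)
      fix t :: real
      consider "t = 0" | "0 < t" | "t < 0" by linarith
      then show "(\<lambda>n. \<phi> (s + e n * t) * indicator {0..<1} t) \<longlonglongrightarrow> \<phi> s * indicator {0..<1} t"
      proof cases
        case 2
        have "(\<lambda>n. s + e n * t) \<longlonglongrightarrow> s + 0 * t" by (intro tendsto_intros e)
        then have "filterlim (\<lambda>n. s + e n * t) (at_right s) sequentially"
          using e(2) 2 by (auto simp: filterlim_at less_imp_neq[symmetric])
        from filterlim_compose[OF rc this] show ?thesis by (intro tendsto_intros)
      qed simp_all
    qed
    show "AE t in lborel. norm (\<phi> (s + e n * t) * indicator {0..<1} t) \<le> B * indicator {0..1} t" for n
      using bd order_trans[OF abs_ge_zero bd] by (auto simp: indicator_def)
  qed measurable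
  then show ?thesis unfolding eq by simp
qed

text \<open>As the ramps steepen, the two windows on the left shrink to the values at 0 and
  \<open>b\<close>, and the trapezoid on the right becomes the indicator of
  \<open>{0<..b}\<close>.\<close>

lemma integrated_equation:
  fixes p :: "nat \<Rightarrow> real \<Rightarrow> real" and h :: "nat \<Rightarrow> real" and \<phi> :: "real \<Rightarrow> real"
  assumes c: "0 < c" and l: "0 \<le> l" and b: "0 < b"
    and h: "\<And>m. 0 < h m" "\<And>m. h m \<le> 1" "h \<longlonglongrightarrow> 0"
    and pm [measurable]: "\<And>m. p m \<in> borel_measurable borel"
    and pb: "\<And>m u. 0 \<le> p m u" "\<And>m u. p m u \<le> 1"
    and lim: "\<And>u. 0 \<le> u \<Longrightarrow> (\<lambda>m. p m u) \<longlonglongrightarrow> \<phi> u"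
    and incr: "\<And>m w. 0 \<le> w \<Longrightarrow> \<bar>p m (w - c * h m) - (exp (- (l * h m)) * p m w
        + l * h m * exp (- (l * h m)) * (\<integral>y. extend_neg a (p m) (w - y) \<partial>D))\<bar> \<le> (l * h m)\<^sup>2"
    and \<phi>0 [simp]: "\<And>u. u < 0 \<Longrightarrow> \<phi> u = 0"
    and rc: "\<And>u. 0 \<le> u \<Longrightarrow> (\<phi> \<longlongrightarrow> \<phi> u) (at_right u)"
    and \<phi>m [measurable]: "\<phi> \<in> borel_measurable borel" and \<phi>b: "\<And>u. 0 \<le> \<phi> u" "\<And>u. \<phi> u \<le> 1"
  shows "c * (\<phi> b - \<phi> 0) = l * (LBINT w. (\<phi> w - (\<integral>y. extend_neg a \<phi> (w - y) \<partial>D)) * indicator {0<..b} w)"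
proof -
  define e :: "nat \<Rightarrow> real" where "e n = inverse (real (Suc n))" for n
  have e: "0 < e n" "e n \<le> 1" "e \<longlonglongrightarrow> 0" for n
    unfolding e_def using LIMSEQ_inverse_real_of_nat by (auto simp: field_simps)
  define K where "K w = (\<integral>y. extend_neg a \<phi> (w - y) \<partial>D)" for w
  have [measurable]: "extend_neg a \<phi> \<in> borel_measurable borel" by measurable
  have [measurable]: "K \<in> borel_measurable borel"
    unfolding K_def[abs_def] by measurable
  have qb: "0 \<le> extend_neg a \<phi> v" "extend_neg a \<phi> v \<le> 1" for v
    using \<phi>b by (auto simp: extend_neg_def indicator_def)
  have Kb: "0 \<le> K w" "K w \<le> 1" for w
    unfolding K_def using qb by (auto intro!: integral_nonneg_AE integral_le_const integrable_const_bound[where B=1])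
  have "(\<lambda>n. \<integral>w. (ramp (e n) 0 w - ramp (e n) b w) * (l * K w - l * \<phi> w) \<partial>lborel)
    \<longlonglongrightarrow> (LBINT w. (indicator {0<..} w - indicator {b<..} w) * (l * K w - l * \<phi> w))"
  proof (rule integral_dominated_convergence[where w="\<lambda>v. l * indicator {0..b + 1} v"])
    show "integrable lborel (\<lambda>v. l * indicator {0..b+1} v :: real)"
      by (intro integrable_mult_right) (auto simp: integrable_indicator_iff emeasure_lborel_Icc_eq)
    show "AE w in lborel. (\<lambda>n. (ramp (e n) 0 w - ramp (e n) b w) * (l * K w - l * \<phi> w))
        \<longlonglongrightarrow> (indicator {0<..} w - indicator {b<..} w) * (l * K w - l * \<phi> w)"
      by (intro AE_I2 tendsto_intros ramp_tendsto e)
    show "AE w in lborel. norm ((ramp (e n) 0 w - ramp (e n) b w) * (l * K w - l * \<phi> w)) \<le> l * indicator {0..b + 1} w" for n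
    proof (rule AE_I2)
      fix w
      show "norm ((ramp (e n) 0 w - ramp (e n) b w) * (l * K w - l * \<phi> w)) \<le> l * indicator {0..b + 1} w"
      proof (cases "w \<in> {0..b + 1}")
        case True
        have "\<bar>K w - \<phi> w\<bar> \<le> 1" using Kb[of w] \<phi>b[of w] by auto
        then have "l * \<bar>K w - \<phi> w\<bar> \<le> l * 1" using l by (intro mult_left_mono) auto
        then have "\<bar>l * K w - l * \<phi> w\<bar> \<le> l" using l by (simp add: abs_mult right_diff_distrib[symmetric])
        moreover have "\<bar>ramp (e n) 0 w - ramp (e n) b w\<bar> \<le> 1"
          using ramp_bounds[of "e n" 0 w] ramp_bounds[of "e n" b w] by auto
        ultimately have "\<bar>ramp (e n) 0 w - ramp (e n) b w\<bar> * \<bar>l * K w - l * \<phi> w\<bar> \<le> 1 * l"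
          by (intro mult_mono) auto
        then show ?thesis using True by (simp add: abs_mult)
      next
        case False
        then have "ramp (e n) 0 w - ramp (e n) b w = 0"
          using b e(1,2)[of n] by (auto simp: ramp_zero ramp_one)
        then show ?thesis using False by simp
      qed
    qed
  qed measurable
  moreover have "(\<lambda>n. \<integral>w. (ramp (e n) 0 w - ramp (e n) b w) * (l * K w - l * \<phi> w) \<partial>lborel) \<longlonglongrightarrow> c * (\<phi> 0 - \<phi> b)"
  proof -
    have "(LBINT w. (ramp (e n) 0 w - ramp (e n) b w) * (l * K w - l * \<phi> w))
      = c * ((LBINT v. \<phi> v * (1 / e n * indicator {0..<0 + e n} v)) - (LBINT v. \<phi> v * (1 / e n * indicator {b..<b + e n} v)))" for n
    proof -
      have int: "integrable lborel (\<lambda>v. \<phi> v * (1 / e n * indicator {s..<s + e n} v))" for s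
        by (rule integrable_bounded_indicator[where B="1 / e n" and s=s and t="s + e n"])
           (use \<phi>b e(1)[of n] in \<open>auto simp: indicator_def abs_mult field_simps\<close>)
      have "(LBINT w. (ramp (e n) 0 w - ramp (e n) b w) * (l * K w - l * \<phi> w))
        = (LBINT v. \<phi> v * (c / e n * indicator {0..<e n} v - c / e n * indicator {b..<b + e n} v))"
        unfolding K_def by (rule skeleton_limit_ramp[OF c l b e(1) h pm pb lim incr \<phi>0, symmetric])
      also have "\<dots> = (LBINT v. c * (\<phi> v * (1 / e n * indicator {0..<0 + e n} v) - \<phi> v * (1 / e n * indicator {b..<b + e n} v)))"
        by (intro Bochner_Integration.integral_cong) (auto simp: algebra_simps)
      also have "\<dots> = c * ((LBINT v. \<phi> v * (1 / e n * indicator {0..<0 + e n} v)) - (LBINT v. \<phi> v * (1 / e n * indicator {b..<b + e n} v)))"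
        using Bochner_Integration.integral_diff[OF int int, of 0 b] by simp
      finally show ?thesis .
    qed
    moreover have "(\<lambda>n. c * ((LBINT v. \<phi> v * (1 / e n * indicator {0..<0 + e n} v)) - (LBINT v. \<phi> v * (1 / e n * indicator {b..<b + e n} v))))
       \<longlonglongrightarrow> c * (\<phi> 0 - \<phi> b)"
      using \<phi>b b by (intro tendsto_mult tendsto_diff tendsto_const average_tendsto[where B=1] rc e) auto
    ultimately show ?thesis by simp
  qed
  ultimately have "(LBINT w. (indicator {0<..} w - indicator {b<..} w) * (l * K w - l * \<phi> w)) = c * (\<phi> 0 - \<phi> b)"
    by (rule LIMSEQ_unique)
  also have "(LBINT w. (indicator {0<..} w - indicator {b<..} w) * (l * K w - l * \<phi> w))
    = (LBINT w. (- l) * ((\<phi> w - K w) * indicator {0<..b} w))"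
    using b by (intro Bochner_Integration.integral_cong) (auto simp: indicator_def algebra_simps)
  also have "\<dots> = - l * (LBINT w. (\<phi> w - K w) * indicator {0<..b} w)"
    by (rule integral_mult_right_zero)
  finally show ?thesis unfolding K_def by (simp add: right_diff_distrib)
qed

end


section \<open>Renewal equations on the half-line\<close>

definition conv :: "(real \<Rightarrow> real) \<Rightarrow> (real \<Rightarrow> real) \<Rightarrow> real \<Rightarrow> real" where
  "conv f g u = (LBINT v. f v * g (u - v) * indicator {0..u} v)"

definition bounded_borel :: "(real \<Rightarrow> real) \<Rightarrow> bool" where
  "bounded_borel f \<longleftrightarrow> f \<in> borel_measurable borel \<and> (\<exists>C. \<forall>x. \<bar>f x\<bar> \<le> C)"

lemma bounded_borel_measurable [measurable_dest]: "bounded_borel f \<Longrightarrow> f \<in> borel_measurable borel"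
  by (simp add: bounded_borel_def)

lemma bounded_borelE:
  assumes "bounded_borel f" obtains C where "0 \<le> C" "\<And>x. \<bar>f x\<bar> \<le> C"
  using assms order_trans[OF abs_ge_zero] unfolding bounded_borel_def by metis

lemma bounded_borel_cmult: "bounded_borel f \<Longrightarrow> bounded_borel (\<lambda>z. a * f z)"
  unfolding bounded_borel_def
proof safe
  fix C assume "\<forall>x. \<bar>f x\<bar> \<le> C"
  then have "\<bar>a * f x\<bar> \<le> \<bar>a\<bar> * C" for x by (simp add: abs_mult mult_left_mono)
  then show "\<exists>C. \<forall>x. \<bar>a * f x\<bar> \<le> C" by blast
qed measurable

lemma bounded_borel_add: "bounded_borel f \<Longrightarrow> bounded_borel g \<Longrightarrow> bounded_borel (\<lambda>z. f z + g z)"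
  unfolding bounded_borel_def
proof safe
  fix C E assume "\<forall>x. \<bar>f x\<bar> \<le> C" "\<forall>x. \<bar>g x\<bar> \<le> E"
  then have "\<bar>f x + g x\<bar> \<le> C + E" for x by (meson abs_triangle_ineq add_mono order_trans)
  then show "\<exists>C. \<forall>x. \<bar>f x + g x\<bar> \<le> C" by blast
qed measurable

lemma conv_integrable:
  assumes "bounded_borel f" "bounded_borel g"
  shows "integrable lborel (\<lambda>v. f v * g (u - v) * indicator {0..u} v)"
proof -
  from assms(1) obtain C where C: "0 \<le> C" "\<And>x. \<bar>f x\<bar> \<le> C" by (rule bounded_borelE) blast
  from assms(2) obtain E where E: "0 \<le> E" "\<And>x. \<bar>g x\<bar> \<le> E" by (rule bounded_borelE) blast
  note [measurable] = bounded_borel_measurable[OF assms(1)] bounded_borel_measurable[OF assms(2)]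
  show ?thesis
    by (rule integrable_bounded_indicator[where B="C * E" and s=0 and t=u])
       (use C E in \<open>auto simp: abs_mult indicator_def intro!: mult_mono\<close>)
qed

lemma conv_add_left:
  "bounded_borel f \<Longrightarrow> bounded_borel g \<Longrightarrow> bounded_borel k \<Longrightarrow> conv (\<lambda>v. f v + g v) k u = conv f k u + conv g k u"
  unfolding conv_def by (subst Bochner_Integration.integral_add[symmetric]) (auto intro!: conv_integrable simp: distrib_right)

lemma conv_cmult_left: "conv (\<lambda>v. a * f v) k u = a * conv f k u"
  unfolding conv_def by (subst integral_mult_right_zero[symmetric]) (simp add: mult.assoc)

lemma conv_cong: "(\<And>v. 0 \<le> v \<Longrightarrow> v \<le> u \<Longrightarrow> f v = f' v) \<Longrightarrow> conv f g u = conv f' g u"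
  unfolding conv_def by (intro Bochner_Integration.integral_cong) (auto simp: indicator_def)

lemma conv_commute: "conv f g u = conv g f u"
  unfolding conv_def
  by (subst lborel_integral_real_affine[where c="-1" and t=u]) (auto intro!: Bochner_Integration.integral_cong simp: indicator_def)

lemma measurable_conv [measurable]:
  assumes "bounded_borel f" "bounded_borel g" shows "conv f g \<in> borel_measurable borel"
proof -
  note [measurable] = bounded_borel_measurable[OF assms(1)] bounded_borel_measurable[OF assms(2)]
  have "(\<lambda>u. \<integral>v. f v * g (u - v) * (if 0 \<le> v \<and> v \<le> u then 1 else 0) \<partial>lborel) \<in> borel_measurable borel"
    by measurable
  also have "(\<lambda>u. \<integral>v. f v * g (u - v) * (if 0 \<le> v \<and> v \<le> u then 1 else 0) \<partial>lborel) = conv f g"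
    unfolding conv_def by (auto simp: indicator_def intro!: Bochner_Integration.integral_cong)
  finally show ?thesis .
qed

text \<open>Both sides are iterated integrals over the triangle
  \<open>0 \<le> s \<le> v \<le> u\<close>, in the two orders.\<close>

lemma conv_assoc:
  assumes "bounded_borel f" "bounded_borel g" "bounded_borel k"
  shows "conv (conv f g) k u = conv f (conv g k) u"
proof -
  from assms(1) obtain C where C: "0 \<le> C" "\<And>x. \<bar>f x\<bar> \<le> C" by (rule bounded_borelE) blast
  from assms(2) obtain E where E: "0 \<le> E" "\<And>x. \<bar>g x\<bar> \<le> E" by (rule bounded_borelE) blast
  from assms(3) obtain G where G: "0 \<le> G" "\<And>x. \<bar>k x\<bar> \<le> G" by (rule bounded_borelE) blast
  note [measurable] = assms[THEN bounded_borel_measurable]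
  define H where "H v s = f s * g (v - s) * k (u - v) * (if 0 \<le> s \<and> s \<le> v \<and> v \<le> u then 1 else 0)" for v s
  have [measurable]: "case_prod H \<in> borel_measurable (lborel \<Otimes>\<^sub>M lborel)"
    unfolding H_def by measurable
  have int: "integrable (lborel \<Otimes>\<^sub>M lborel) (case_prod H)"
  proof (rule Bochner_Integration.integrable_bound)
    show "integrable (lborel \<Otimes>\<^sub>M lborel) (\<lambda>z. C * E * G * indicator ({0..u} \<times> {0..u}) z :: real)"
      by (intro integrable_mult_right)
         (auto simp: integrable_indicator_iff lborel.emeasure_pair_measure_Times emeasure_lborel_Icc_eq ennreal_mult_less_top)
    have "\<bar>H v s\<bar> \<le> C * E * G * indicator ({0..u} \<times> {0..u}) (v, s)" for v s
    proof (cases "0 \<le> s \<and> s \<le> v \<and> v \<le> u")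
      case True
      then have "\<bar>H v s\<bar> = \<bar>f s\<bar> * \<bar>g (v - s)\<bar> * \<bar>k (u - v)\<bar>" by (simp add: H_def abs_mult)
      also have "\<dots> \<le> C * E * G" using C E G by (intro mult_mono) auto
      finally show ?thesis using True by simp
    qed (use C E G in \<open>auto simp: H_def indicator_def\<close>)
    then show "AE z in lborel \<Otimes>\<^sub>M lborel. norm (case_prod H z) \<le> norm (C * E * G * indicator ({0..u} \<times> {0..u}) z)"
      using C E G by (intro AE_I2) (auto simp: split_beta' abs_mult)
  qed measurable
  have "conv (conv f g) k u = (\<integral>v. \<integral>s. H v s \<partial>lborel \<partial>lborel)"
    unfolding conv_def
  proof (intro Bochner_Integration.integral_cong refl)
    fix v
    have "(LBINT s. f s * g (v - s) * indicator {0..v} s) * k (u - v) * indicator {0..u} v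
      = (LBINT s. (k (u - v) * indicator {0..u} v) * (f s * g (v - s) * indicator {0..v} s))"
      by (subst integral_mult_right_zero) simp
    also have "\<dots> = (LBINT s. H v s)"
      by (intro Bochner_Integration.integral_cong) (auto simp: H_def indicator_def)
    finally show "(LBINT s. f s * g (v - s) * indicator {0..v} s) * k (u - v) * indicator {0..u} v = (LBINT s. H v s)" .
  qed
  also have "\<dots> = (\<integral>s. \<integral>v. H v s \<partial>lborel \<partial>lborel)"
    by (rule lborel_pair.Fubini_integral[OF int, symmetric])
  also have "\<dots> = conv f (conv g k) u"
    unfolding conv_def
  proof (intro Bochner_Integration.integral_cong refl)
    fix s
    have "(LBINT v. H v s) = (LBINT w. H (s + w) s)"
      by (subst lborel_integral_real_affine[where c=1 and t=s]) auto
    also have "\<dots> = (LBINT w. (f s * indicator {0..u} s) * (g w * k (u - s - w) * indicator {0..u - s} w))"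
      by (intro Bochner_Integration.integral_cong) (auto simp: H_def indicator_def diff_diff_eq)
    also have "\<dots> = f s * (LBINT w. g w * k (u - s - w) * indicator {0..u - s} w) * indicator {0..u} s"
      by (subst integral_mult_right_zero) simp
    finally show "(LBINT v. H v s) = f s * (LBINT w. g w * k (u - s - w) * indicator {0..u - s} w) * indicator {0..u} s" .
  qed
  finally show ?thesis .
qed

text \<open>Abstracted from the claim law so that it also covers the shifted tail
  \<open>B (x + z)\<close>, which need not equal 1 at 0 and whose integral is
  \<open>int_tail x\<close>.\<close>

locale tail_function =
  fixes B :: "real \<Rightarrow> real" and \<mu> :: real
  assumes B_measurable [measurable]: "B \<in> borel_measurable borel"
    and B_bounds: "0 \<le> B z" "B z \<le> 1"
    and B_integrable: "integrable lborel (\<lambda>z. B z * indicator {0..} z)"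
    and B_integral: "(LBINT z. B z * indicator {0..} z) = \<mu>"
begin

definition int_tail :: "real \<Rightarrow> real" where
  "int_tail x = (LBINT z. B z * indicator {x<..} z)"

lemma B_bounded_borel: "bounded_borel B"
  using B_bounds unfolding bounded_borel_def by (intro conjI exI[of _ 1] B_measurable) auto

lemma B_integrable_Ioi:
  assumes "0 \<le> x" shows "integrable lborel (\<lambda>z. B z * indicator {x<..} z)"
  by (rule Bochner_Integration.integrable_bound[OF B_integrable])
     (use assms B_bounds in \<open>auto intro!: AE_I2 simp: indicator_def\<close>)

lemma int_tail_Ici: "int_tail x = (LBINT z. B z * indicator {x..} z)"
  unfolding int_tail_def
  by (rule integral_cong_AE) (use AE_lborel_singleton[of x] in \<open>auto simp: indicator_def elim!: eventually_mono\<close>)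

lemma int_tail_0: "int_tail 0 = \<mu>"
  by (simp add: int_tail_Ici B_integral)

lemma int_tail_nonneg: "0 \<le> int_tail x"
  unfolding int_tail_def using B_bounds by (intro integral_nonneg_AE) auto

lemma int_tail_antimono: "0 \<le> x \<Longrightarrow> x \<le> y \<Longrightarrow> int_tail y \<le> int_tail x"
  unfolding int_tail_def using B_bounds
  by (intro integral_mono B_integrable_Ioi) (auto simp: indicator_def)

lemma int_tail_le: "0 \<le> x \<Longrightarrow> int_tail x \<le> \<mu>"
  using int_tail_antimono[of 0 x] int_tail_0 by simp

lemma int_tail_split:
  assumes "0 \<le> x" "x \<le> y"
  shows "int_tail x = (LBINT z. B z * indicator {x<..y} z) + int_tail y"
proof -
  have "integrable lborel (\<lambda>z. B z * indicator {x<..y} z)"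
    by (rule Bochner_Integration.integrable_bound[OF B_integrable])
       (use assms B_bounds in \<open>auto intro!: AE_I2 simp: indicator_def\<close>)
  moreover have "integrable lborel (\<lambda>z. B z * indicator {y<..} z)" using assms by (intro B_integrable_Ioi) auto
  ultimately have "(LBINT z. B z * indicator {x<..y} z) + int_tail y
    = (LBINT z. B z * indicator {x<..y} z + B z * indicator {y<..} z)"
    unfolding int_tail_def by simp
  also have "\<dots> = int_tail x"
    unfolding int_tail_def using assms by (intro Bochner_Integration.integral_cong) (auto simp: indicator_def)
  finally show ?thesis ..
qed

lemma int_tail_lipschitz:
  assumes "0 \<le> x" "x \<le> y" shows "int_tail x \<le> int_tail y + (y - x)"
proof -
  have "(LBINT z. B z * indicator {x<..y} z) \<le> (LBINT z. indicator {x<..y} z)"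
  proof (rule integral_mono)
    show "integrable lborel (\<lambda>z. B z * indicator {x<..y} z)"
      by (rule Bochner_Integration.integrable_bound[OF B_integrable])
         (use assms B_bounds in \<open>auto intro!: AE_I2 simp: indicator_def\<close>)
    show "integrable lborel (\<lambda>z. indicator {x<..y} z :: real)"
      using assms by (simp add: integrable_indicator_iff)
    show "B z * indicator {x<..y} z \<le> indicator {x<..y} z" for z
      using B_bounds[of z] by (simp add: indicator_def)
  qed
  then show ?thesis using int_tail_split[OF assms] assms by simp
qed

lemma measurable_int_tail [measurable]: "int_tail \<in> borel_measurable borel"
proof -
  have "(\<lambda>x. \<integral>z. B z * (if x < z then 1 else 0) \<partial>lborel) \<in> borel_measurable borel" by measurable
  also have "(\<lambda>x. \<integral>z. B z * (if x < z then 1 else 0) \<partial>lborel) = int_tail"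
    unfolding int_tail_def by (auto simp: indicator_def intro!: Bochner_Integration.integral_cong)
  finally show ?thesis .
qed

lemma int_tail_tendsto_0: "(int_tail \<longlongrightarrow> 0) at_top"
proof (rule tendsto_at_topI_sequentially)
  fix X :: "nat \<Rightarrow> real" assume X: "filterlim X at_top sequentially"
  have "(\<lambda>n. int_tail (max 0 (X n))) \<longlonglongrightarrow> (\<integral>z. 0 \<partial>(lborel :: real measure))"
    unfolding int_tail_def
  proof (rule integral_dominated_convergence[where w="\<lambda>z. B z * indicator {0..} z"])
    show "AE z in lborel. (\<lambda>n. B z * indicator {max 0 (X n)<..} z) \<longlonglongrightarrow> 0"
    proof (rule AE_I2, rule tendsto_eventually)
      fix z
      show "eventually (\<lambda>n. B z * indicator {max 0 (X n)<..} z = 0) sequentially"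
        using X[unfolded filterlim_at_top, rule_format, of z] by eventually_elim auto
    qed
  qed (use B_bounds B_integrable in \<open>auto simp: indicator_def\<close>)
  moreover have "eventually (\<lambda>n. int_tail (max 0 (X n)) = int_tail (X n)) sequentially"
    using X[unfolded filterlim_at_top, rule_format, of 0] by eventually_elim (simp add: max_def)
  ultimately show "(\<lambda>n. int_tail (X n)) \<longlonglongrightarrow> 0" by (simp add: filterlim_cong)
qed

(* Every term integrates B(p) B(q) over a planar region, and the regions on the two sides have the same
   multiplicities; for continuous B this is the integrated product rule for I(u - z) I(x + z). *)
lemma int_tail_convolution_swap:
  assumes u: "0 \<le> u" and x: "0 \<le> x"
  shows "conv (\<lambda>v. int_tail (v + x)) B u + int_tail u * int_tail x
    = conv int_tail (\<lambda>z. B (x + z)) u + \<mu> * int_tail (u + x)"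
proof -
  define G where "G p q = (B p * indicator {0..} p) * (B q * indicator {0..} q)" for p q
  define J where "J S = (\<integral>z. G (fst z) (snd z) * indicator S z \<partial>(lborel \<Otimes>\<^sub>M lborel))" for S
  have G0: "0 \<le> G p q" for p q unfolding G_def using B_bounds by simp
  have Gm [measurable]: "(\<lambda>z. G (fst z) (snd z)) \<in> borel_measurable (lborel \<Otimes>\<^sub>M lborel)"
    unfolding G_def by measurable
  have Gi: "integrable (lborel \<Otimes>\<^sub>M lborel) (\<lambda>z. G (fst z) (snd z))"
  proof (rule lborel_pair.Fubini_integrable)
    have "(\<lambda>p. \<integral>q. norm (G (fst (p, q)) (snd (p, q))) \<partial>lborel) = (\<lambda>p. B p * indicator {0..} p * \<mu>)"
      using G0 by (simp add: G_def B_integral)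
    then show "integrable lborel (\<lambda>p. \<integral>q. norm (G (fst (p, q)) (snd (p, q))) \<partial>lborel)"
      using B_integrable by simp
    show "AE p in lborel. integrable lborel (\<lambda>q. G (fst (p, q)) (snd (p, q)))"
      unfolding G_def using B_integrable by simp
  qed measurable
  have GSi: "integrable (lborel \<Otimes>\<^sub>M lborel) (\<lambda>z. G (fst z) (snd z) * indicator S z)"
    if "S \<in> sets (lborel \<Otimes>\<^sub>M lborel)" for S
    using Gi that by (intro integrable_real_mult_indicator)
  define S1 :: "(real \<times> real) set" where "S1 = {z\<in>space (lborel \<Otimes>\<^sub>M lborel). fst z \<le> u \<and> fst z + snd z > x + (u::real)}"
  define S2 :: "(real \<times> real) set" where "S2 = {z\<in>space (lborel \<Otimes>\<^sub>M lborel). x \<le> snd z \<and> snd z \<le> x + u \<and> fst z + snd z > x + (u::real)}"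
  define S3 :: "(real \<times> real) set" where "S3 = {z\<in>space (lborel \<Otimes>\<^sub>M lborel). snd z > x + (u::real)}"
  define S4 :: "(real \<times> real) set" where "S4 = {z\<in>space (lborel \<Otimes>\<^sub>M lborel). fst z > u \<and> snd z \<ge> (x::real)}"
  have S [measurable]: "S1 \<in> sets (lborel \<Otimes>\<^sub>M lborel)" "S2 \<in> sets (lborel \<Otimes>\<^sub>M lborel)"
    "S3 \<in> sets (lborel \<Otimes>\<^sub>M lborel)" "S4 \<in> sets (lborel \<Otimes>\<^sub>M lborel)"
    unfolding S1_def S2_def S3_def S4_def by measurable
  have "J S1 + J S4 = J S2 + J S3"
  proof -
    have "J S1 + J S4 = (\<integral>z. G (fst z) (snd z) * indicator S1 z + G (fst z) (snd z) * indicator S4 z \<partial>(lborel \<Otimes>\<^sub>M lborel))"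
      unfolding J_def by (subst Bochner_Integration.integral_add) (auto intro: GSi S)
    also have "\<dots> = (\<integral>z. G (fst z) (snd z) * indicator S2 z + G (fst z) (snd z) * indicator S3 z \<partial>(lborel \<Otimes>\<^sub>M lborel))"
      using u x by (intro Bochner_Integration.integral_cong)
        (auto simp: S1_def S2_def S3_def S4_def indicator_def G_def space_pair_measure)
    also have "\<dots> = J S2 + J S3"
      unfolding J_def by (subst Bochner_Integration.integral_add) (auto intro: GSi S)
    finally show ?thesis .
  qed
  moreover have fst: "J S = (\<integral>p. \<integral>q. G p q * indicator S (p, q) \<partial>lborel \<partial>lborel)"
    if "S \<in> sets (lborel \<Otimes>\<^sub>M lborel)" for S
    unfolding J_def using lborel_pair.integral_fst'[OF GSi[OF that]] by simp
  moreover have snd: "J S = (\<integral>q. \<integral>p. G p q * indicator S (p, q) \<partial>lborel \<partial>lborel)"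
    if "S \<in> sets (lborel \<Otimes>\<^sub>M lborel)" for S
    unfolding fst[OF that]
    using lborel_pair.Fubini_integral[of "\<lambda>p q. G p q * indicator S (p, q)"] GSi[OF that] by (simp add: split_beta')
  moreover have "J S1 = conv (\<lambda>v. int_tail (v + x)) B u"
  proof -
    have "J S1 = (LBINT p. B p * int_tail (u - p + x) * indicator {0..u} p)"
      unfolding fst[OF S(1)]
    proof (intro Bochner_Integration.integral_cong refl)
      fix p :: real
      have "(LBINT q. G p q * indicator S1 (p, q)) = (LBINT q. (B p * indicator {0..u} p) * (B q * indicator {u - p + x<..} q))"
        using x u by (intro Bochner_Integration.integral_cong) (auto simp: G_def S1_def indicator_def space_pair_measure)
      then show "(LBINT q. G p q * indicator S1 (p, q)) = B p * int_tail (u - p + x) * indicator {0..u} p"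
        by (simp add: int_tail_def)
    qed
    also have "\<dots> = conv B (\<lambda>v. int_tail (v + x)) u" by (simp add: conv_def)
    finally show ?thesis by (simp only: conv_commute[of B])
  qed
  moreover have "J S2 = conv int_tail (\<lambda>z. B (x + z)) u"
  proof -
    have "J S2 = (LBINT q. int_tail (x + u - q) * B q * indicator {x..x + u} q)"
      unfolding snd[OF S(2)]
    proof (intro Bochner_Integration.integral_cong refl)
      fix q :: real
      have "(LBINT p. G p q * indicator S2 (p, q)) = (LBINT p. (B q * indicator {x..x + u} q) * (B p * indicator {x + u - q<..} p))"
        using x u by (intro Bochner_Integration.integral_cong) (auto simp: G_def S2_def indicator_def space_pair_measure)
      then show "(LBINT p. G p q * indicator S2 (p, q)) = int_tail (x + u - q) * B q * indicator {x..x + u} q"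
        by (simp add: int_tail_def)
    qed
    also have "\<dots> = conv int_tail (\<lambda>z. B (x + z)) u"
      unfolding conv_def
      by (subst lborel_integral_real_affine[where c="-1" and t="x + u"])
         (auto intro!: Bochner_Integration.integral_cong simp: indicator_def algebra_simps)
    finally show ?thesis .
  qed
  moreover have "J S3 = \<mu> * int_tail (u + x)"
  proof -
    have "J S3 = (LBINT p. (B p * indicator {0..} p) * int_tail (u + x))"
      unfolding fst[OF S(3)]
    proof (intro Bochner_Integration.integral_cong refl)
      fix p :: real
      have "(LBINT q. G p q * indicator S3 (p, q)) = (LBINT q. (B p * indicator {0..} p) * (B q * indicator {u + x<..} q))"
        using x u by (intro Bochner_Integration.integral_cong) (auto simp: G_def S3_def indicator_def space_pair_measure)
      then show "(LBINT q. G p q * indicator S3 (p, q)) = (B p * indicator {0..} p) * int_tail (u + x)"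
        by (simp add: int_tail_def)
    qed
    then show ?thesis by (simp add: B_integral)
  qed
  moreover have "J S4 = int_tail u * int_tail x"
  proof -
    have "J S4 = (LBINT p. (B p * indicator {u<..} p) * int_tail x)"
      unfolding fst[OF S(4)]
    proof (intro Bochner_Integration.integral_cong refl)
      fix p :: real
      have "(LBINT q. G p q * indicator S4 (p, q)) = (LBINT q. (B p * indicator {u<..} p) * (B q * indicator {x..} q))"
        using x u by (intro Bochner_Integration.integral_cong) (auto simp: G_def S4_def indicator_def space_pair_measure)
      then show "(LBINT q. G p q * indicator S4 (p, q)) = (B p * indicator {u<..} p) * int_tail x"
        by (simp add: int_tail_Ici)
    qed
    then show ?thesis by (simp add: int_tail_def)
  qed
  ultimately show ?thesis by (simp add: add.commute)
qed

lemma conv_B_bound: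
  assumes f: "bounded_borel f" "\<And>v. 0 \<le> v \<Longrightarrow> \<bar>f v\<bar> \<le> W" and "0 \<le> u"
  shows "\<bar>conv f B u\<bar> \<le> W * \<mu>"
proof -
  have W: "0 \<le> W" using f(2)[of 0] by simp
  have "norm (LBINT v. B v * f (u - v) * indicator {0..u} v) \<le> (LBINT z. W * (B z * indicator {0..} z))"
  proof (rule Bochner_Integration.integral_norm_bound_integral)
    show "integrable lborel (\<lambda>v. B v * f (u - v) * indicator {0..u} v)"
      by (rule conv_integrable[OF B_bounded_borel f(1)])
    fix v
    have "B v * \<bar>f (u - v)\<bar> \<le> W * B v" if "v \<le> u"
      using mult_right_mono[OF f(2)[of "u - v"] B_bounds(1)[of v]] that by (simp add: mult.commute)
    then show "norm (B v * f (u - v) * indicator {0..u} v) \<le> W * (B v * indicator {0..} v)"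
      using B_bounds[of v] W by (auto simp: indicator_def abs_mult)
  qed (use B_integrable in auto)
  then show ?thesis unfolding conv_commute[of f B] unfolding conv_def by (simp add: B_integral)
qed

text \<open>Convolution with \<open>B\<close>, scaled by \<open>l / c\<close>, contracts bounded
  functions on the half-line by \<open>\<rho> = l * \<mu> / c < 1\<close>, so every iteration of the
  equation improves the bound on \<open>w\<close> by this factor.\<close>

lemma renewal_unique:
  assumes "0 < c" "0 \<le> l" "l * \<mu> < c" and w: "bounded_borel w"
    and eq: "\<And>u. 0 \<le> u \<Longrightarrow> c * w u = l * conv w B u" and u: "0 \<le> u"
  shows "w u = 0"
proof -
  from w obtain W where W: "0 \<le> W" "\<And>x. \<bar>w x\<bar> \<le> W" by (rule bounded_borelE) blast
  define \<rho> where "\<rho> = l * \<mu> / c"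
  have \<mu>: "0 \<le> \<mu>" using int_tail_nonneg[of 0] int_tail_0 by simp
  have \<rho>: "0 \<le> \<rho>" "\<rho> < 1" using assms \<mu> unfolding \<rho>_def by (auto simp: field_simps)
  have bound: "\<bar>w u\<bar> \<le> \<rho> ^ n * W" if "0 \<le> u" for n u
    using that
  proof (induction n arbitrary: u)
    case 0
    then show ?case using W by simp
  next
    case (Suc n)
    have "c * \<bar>w u\<bar> = l * \<bar>conv w B u\<bar>" using eq[OF Suc.prems] assms(1,2) by (metis abs_mult abs_of_nonneg less_imp_le)
    also have "\<dots> \<le> l * (\<rho> ^ n * W * \<mu>)"
      using assms(2) by (intro mult_left_mono conv_B_bound w Suc.IH Suc.prems)
    finally have "\<bar>w u\<bar> \<le> l * (\<rho> ^ n * W * \<mu>) / c" using assms(1) by (simp add: field_simps)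
    then show ?case by (simp add: \<rho>_def field_simps)
  qed
  have "(\<lambda>n. \<rho> ^ n * W) \<longlonglongrightarrow> 0 * W" using \<rho> by (intro tendsto_mult tendsto_const LIMSEQ_power_zero) auto
  then have "\<bar>w u\<bar> \<le> 0 * W"
    by (rule LIMSEQ_le_const) (use bound[OF u] in auto)
  then show ?thesis by simp
qed

lemma tail_function_shift:
  assumes "0 \<le> x" shows "tail_function (\<lambda>z. B (x + z)) (int_tail x)"
proof
  have eq: "(\<lambda>z. B (x + z) * indicator {0..} z) = (\<lambda>z. B (x + 1 * z) * indicator {x..} (x + 1 * z))"
    by (auto simp: indicator_def)
  have "integrable lborel (\<lambda>z. B z * indicator {x..} z)"
    by (rule Bochner_Integration.integrable_bound[OF B_integrable])
       (use assms B_bounds in \<open>auto intro!: AE_I2 simp: indicator_def\<close>)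
  then show "integrable lborel (\<lambda>z. B (x + z) * indicator {0..} z)"
    unfolding eq by (intro lborel_integrable_real_affine) auto
  show "(LBINT z. B (x + z) * indicator {0..} z) = int_tail x"
    unfolding int_tail_Ici eq by (subst lborel_integral_real_affine[where c=1 and t=x]) auto
qed (use B_bounds in auto)

text \<open>Formally, the resolvent of the renewal equation is a multiple of the measure with
  distribution function \<open>1 - \<psi>\<close> on the half-line. Thus \<open>\<phi>\<close> is
  \<open>l / (c - l * \<mu>)\<close> times the integral of \<open>int_tail (u + x - y)\<close>
  against this measure in \<open>y\<close>, and integration by parts gives the right-hand side. The
  proof needs no resolvent: it verifies that the difference \<open>w\<close> of the two sides solves
  the homogeneous equation.\<close>

lemma renewal_shift:
  assumes "0 < c" "0 \<le> l" "l * \<mu> < c" "0 \<le> x"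
    and \<psi>: "bounded_borel \<psi>" "\<And>u. 0 \<le> u \<Longrightarrow> c * \<psi> u = l * int_tail u + l * conv \<psi> B u"
    and \<phi>: "bounded_borel \<phi>" "\<And>u. 0 \<le> u \<Longrightarrow> c * \<phi> u = l * int_tail (u + x) + l * conv \<phi> B u"
    and u: "0 \<le> u"
  shows "(c - l * \<mu>) * \<phi> u = l * (int_tail (u + x) + conv \<psi> (\<lambda>z. B (x + z)) u - \<psi> u * int_tail x)"
proof -
  let ?Bx = "\<lambda>z. B (x + z)"
  interpret X: tail_function ?Bx "int_tail x" by (rule tail_function_shift[OF assms(4)])
  note Bx = X.B_bounded_borel
  \<comment> \<open>The cut-off at 0 keeps these functions bounded; at negative arguments
    \<open>int_tail\<close> is not controlled.\<close>
  define J where "J v = (if 0 \<le> v then int_tail (v + x) else 0)" for v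
  define I where "I v = (if 0 \<le> v then int_tail v else 0)" for v
  define C where "C v = (if 0 \<le> v then conv \<psi> ?Bx v else 0)" for v
  have bI: "bounded_borel I" unfolding bounded_borel_def I_def[abs_def]
    using int_tail_nonneg[of 0] int_tail_0 int_tail_nonneg int_tail_le int_tail_le[of 0]
    by (intro conjI exI[of _ \<mu>]) (auto simp: abs_le_iff intro: order_trans[OF _ int_tail_nonneg])
  have bJ: "bounded_borel J" unfolding bounded_borel_def J_def[abs_def]
    using int_tail_nonneg[of 0] int_tail_0 int_tail_nonneg int_tail_le[of "_ + x"] int_tail_le[of 0] assms(4)
    by (intro conjI exI[of _ \<mu>]) (auto simp: abs_le_iff intro: order_trans[OF _ int_tail_nonneg])
  have bC: "bounded_borel C"
  proof -
    from \<psi>(1) obtain W where W: "0 \<le> W" "\<And>x. \<bar>\<psi> x\<bar> \<le> W" by (rule bounded_borelE) blast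
    have "\<bar>C v\<bar> \<le> W * int_tail x" for v
      using X.conv_B_bound[OF \<psi>(1), of W v] W int_tail_nonneg[of x] by (auto simp: C_def)
    moreover have "C \<in> borel_measurable borel"
      unfolding C_def[abs_def] using measurable_conv[OF \<psi>(1) Bx] by measurable
    ultimately show ?thesis unfolding bounded_borel_def by blast
  qed
  define w where "w v = (c - l * \<mu>) * \<phi> v + ((- l) * J v + ((- l) * C v + (l * int_tail x) * \<psi> v))" for v
  have bw: "bounded_borel w"
    unfolding w_def by (intro bounded_borel_add bounded_borel_cmult bI bJ bC \<psi>(1) \<phi>(1))
  have "w u = 0"
  proof (rule renewal_unique[OF assms(1-3) bw _ u])
    fix u :: real assume u: "0 \<le> u"
    have convw: "conv w B u = (c - l * \<mu>) * conv \<phi> B u + ((- l) * conv J B u + ((- l) * conv C B u + (l * int_tail x) * conv \<psi> B u))"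
      unfolding w_def
      by (simp only: conv_add_left conv_cmult_left bounded_borel_add bounded_borel_cmult bI bJ bC \<psi>(1) \<phi>(1) B_bounded_borel)
    \<comment> \<open>Convolve the equation for \<open>\<psi>\<close> with the shifted tail;
      associativity and commutativity then move \<open>B\<close> to the outside.\<close>
    have f3: "c * C u = l * conv I ?Bx u + l * conv C B u"
    proof -
      have "c * C u = conv (\<lambda>v. c * \<psi> v) ?Bx u" using u by (simp add: C_def conv_cmult_left)
      also have "\<dots> = conv (\<lambda>v. l * I v + l * conv \<psi> B v) ?Bx u"
        by (intro conv_cong) (simp add: \<psi>(2) I_def)
      also have "\<dots> = conv (\<lambda>v. l * I v + l * (if 0 \<le> v then conv \<psi> B v else 0)) ?Bx u"
        by (intro conv_cong) simp
      also have "\<dots> = l * conv I ?Bx u + l * conv (\<lambda>v. if 0 \<le> v then conv \<psi> B v else 0) ?Bx u"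
      proof -
        from \<psi>(1) obtain W where W: "0 \<le> W" "\<And>x. \<bar>\<psi> x\<bar> \<le> W" by (rule bounded_borelE) blast
        have "\<bar>if 0 \<le> v then conv \<psi> B v else 0\<bar> \<le> W * \<mu>" for v
          using conv_B_bound[OF \<psi>(1), of W v] W int_tail_nonneg[of 0] int_tail_0 by auto
        moreover have "(\<lambda>v. if 0 \<le> v then conv \<psi> B v else 0) \<in> borel_measurable borel"
          using measurable_conv[OF \<psi>(1) B_bounded_borel] by measurable
        ultimately have "bounded_borel (\<lambda>v. if 0 \<le> v then conv \<psi> B v else 0)"
          unfolding bounded_borel_def by blast
        then show ?thesis
          by (simp add: conv_add_left conv_cmult_left bounded_borel_cmult bI Bx)
      qed
      also have "conv (\<lambda>v. if 0 \<le> v then conv \<psi> B v else 0) ?Bx u = conv (conv \<psi> B) ?Bx u"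
        by (intro conv_cong) simp
      also have "\<dots> = conv \<psi> (conv B ?Bx) u" by (rule conv_assoc[OF \<psi>(1) B_bounded_borel Bx])
      also have "conv B ?Bx = conv ?Bx B" by (rule ext, rule conv_commute)
      also have "conv \<psi> (conv ?Bx B) u = conv (conv \<psi> ?Bx) B u" by (rule conv_assoc[OF \<psi>(1) Bx B_bounded_borel, symmetric])
      also have "\<dots> = conv C B u" by (intro conv_cong) (simp add: C_def)
      finally show ?thesis .
    qed
    have f5: "conv J B u + int_tail u * int_tail x = conv I ?Bx u + \<mu> * int_tail (u + x)"
    proof -
      have "conv J B u = conv (\<lambda>v. int_tail (v + x)) B u" by (intro conv_cong) (simp add: J_def)
      moreover have "conv I ?Bx u = conv int_tail ?Bx u" by (intro conv_cong) (simp add: I_def)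
      ultimately show ?thesis using int_tail_convolution_swap[OF u assms(4)] by simp
    qed
    \<comment> \<open>All convolutions with \<open>B\<close> except that of the forcing terms
      reassemble to \<open>l * conv w B u\<close>; the rest is \<open>l * l\<close> times the
      difference of the two sides of \<open>f5\<close>.\<close>
    have "c * w u = (c - l * \<mu>) * (c * \<phi> u) - l * c * int_tail (u + x) - l * (c * C u) + l * int_tail x * (c * \<psi> u)"
      using u by (simp add: w_def J_def algebra_simps)
    also have "\<dots> = l * conv w B u + l * l * (conv J B u + int_tail u * int_tail x - conv I ?Bx u - \<mu> * int_tail (u + x))"
      unfolding f3 \<phi>(2)[OF u] \<psi>(2)[OF u] convw by (simp add: algebra_simps)
    finally show "c * w u = l * conv w B u" using f5 by simp
  qed
  then show ?thesis using u by (simp add: w_def J_def C_def algebra_simps)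
qed

end


section \<open>The renewal equation for the deficit at ruin\<close>

context tail_function
begin

lemma conv_tendsto_0:
  assumes f: "bounded_borel f" "(f \<longlongrightarrow> 0) at_top"
  shows "(conv f B \<longlongrightarrow> 0) at_top"
proof (rule tendsto_at_topI_sequentially)
  fix b :: "nat \<Rightarrow> real" assume b: "filterlim b at_top sequentially"
  from f(1) obtain W where W: "0 \<le> W" "\<And>x. \<bar>f x\<bar> \<le> W" by (rule bounded_borelE) blast
  note [measurable] = bounded_borel_measurable[OF f(1)]
  have "(\<lambda>n. \<integral>v. B v * f (b n - v) * indicator {0..b n} v \<partial>lborel) \<longlonglongrightarrow> (\<integral>v. 0 \<partial>(lborel :: real measure))"
  proof (rule integral_dominated_convergence[where w="\<lambda>v. W * (B v * indicator {0..} v)"])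
    show "AE v in lborel. (\<lambda>n. B v * f (b n - v) * indicator {0..b n} v) \<longlonglongrightarrow> 0"
    proof (rule AE_I2)
      fix v
      have "filterlim (\<lambda>n. - v + b n) at_top sequentially"
        using b by (rule filterlim_tendsto_add_at_top[OF tendsto_const])
      then have "(\<lambda>n. f (b n - v)) \<longlonglongrightarrow> 0"
        using filterlim_compose[OF f(2)] by (simp add: algebra_simps)
      then have "(\<lambda>n. \<bar>B v\<bar> * \<bar>f (b n - v)\<bar>) \<longlonglongrightarrow> \<bar>B v\<bar> * \<bar>0\<bar>" by (intro tendsto_intros)
      then have "(\<lambda>n. \<bar>B v\<bar> * \<bar>f (b n - v)\<bar>) \<longlonglongrightarrow> 0" by simp
      then show "(\<lambda>n. B v * f (b n - v) * indicator {0..b n} v) \<longlonglongrightarrow> 0"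
        by (rule Lim_null_comparison[rotated]) (auto simp: indicator_def abs_mult intro!: always_eventually)
    qed
    show "AE v in lborel. norm (B v * f (b n - v) * indicator {0..b n} v) \<le> W * (B v * indicator {0..} v)" for n
    proof (rule AE_I2)
      fix v
      show "norm (B v * f (b n - v) * indicator {0..b n} v) \<le> W * (B v * indicator {0..} v)"
        using mult_right_mono[OF W(2)[of "b n - v"] B_bounds(1)[of v]] B_bounds[of v] W(1)
        by (auto simp: indicator_def abs_mult mult.commute)
    qed
  qed (use B_integrable in auto)
  then show "(\<lambda>n. conv f B (b n)) \<longlonglongrightarrow> 0"
    unfolding conv_commute[of f] by (simp add: conv_def)
qed

text \<open>Splitting at \<open>z = x\<close> trades the convolution with the shifted tail, which
  extends over \<open>{0..u}\<close>, for an integral over the fixed interval \<open>{0..x}\<close>,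
  on which the arguments of \<open>f\<close> stay between \<open>u\<close> and
  \<open>u + x\<close>.\<close>

lemma conv_split:
  assumes f: "bounded_borel f" and "0 \<le> u" "0 \<le> x"
  shows "conv f B (u + x) = conv f (\<lambda>z. B (x + z)) u + (LBINT z. f (u + x - z) * B z * indicator {0..x} z)"
proof -
  note [measurable] = bounded_borel_measurable[OF f]
  from f obtain W where W: "0 \<le> W" "\<And>x. \<bar>f x\<bar> \<le> W" by (rule bounded_borelE) blast
  have int: "integrable lborel (\<lambda>z. f (u + x - z) * B z * indicator A z)"
    if "A \<in> sets borel" "A \<subseteq> {0..u + x}" for A
  proof (rule integrable_bounded_indicator[where B="W * 1" and s=0 and t="u + x"])
    fix z
    have "\<bar>f (u + x - z)\<bar> * \<bar>B z\<bar> \<le> W * 1" using W B_bounds[of z] by (intro mult_mono) auto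
    then show "\<bar>f (u + x - z) * B z * indicator A z\<bar> \<le> W * 1" using W by (simp add: abs_mult indicator_def)
  qed (use that in \<open>auto simp: indicator_def\<close>)
  have "conv f B (u + x) = conv B f (u + x)" by (rule conv_commute)
  also have "\<dots> = (LBINT z. f (u + x - z) * B z * indicator {0..x} z + f (u + x - z) * B z * indicator {x<..u + x} z)"
    unfolding conv_def using assms by (intro Bochner_Integration.integral_cong) (auto simp: indicator_def)
  also have "\<dots> = (LBINT z. f (u + x - z) * B z * indicator {0..x} z) + (LBINT z. f (u + x - z) * B z * indicator {x<..u + x} z)"
    using assms by (intro Bochner_Integration.integral_add int) auto
  also have "(LBINT z. f (u + x - z) * B z * indicator {x<..u + x} z) = (LBINT z. f (u + x - z) * B z * indicator {x..u + x} z)"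
    by (rule integral_cong_AE) (use AE_lborel_singleton[of x] in \<open>auto simp: indicator_def elim!: eventually_mono\<close>)
  also have "\<dots> = (LBINT z. f (u - z) * B (x + z) * indicator {0..u} z)"
    by (subst lborel_integral_real_affine[where c=1 and t=x])
       (auto intro!: Bochner_Integration.integral_cong simp: indicator_def)
  also have "\<dots> = conv (\<lambda>z. B (x + z)) f u" by (simp add: conv_def mult.commute)
  also have "\<dots> = conv f (\<lambda>z. B (x + z)) u" by (rule conv_commute)
  finally show ?thesis by simp
qed

end

context poisson_claims_model
begin

definition tail :: "real \<Rightarrow> real" where "tail z = measure D {z<..}"

lemma tail_eq: "tail z = 1 - F z"
proof -
  have "tail z = 1 - measure D {..z}"
    unfolding tail_def by (subst law.prob_compl[symmetric]) (auto intro!: arg_cong[where f="measure D"])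
  then show ?thesis using fun_cong[OF X_cdf[of 1], of z] by (simp add: cdf_def D_def)
qed

lemma measurable_tail [measurable]: "tail \<in> borel_measurable borel"
proof -
  have "mono (\<lambda>z. - tail z)" unfolding tail_def
    by (intro monoI) (auto intro!: law.finite_measure_mono)
  then have "(\<lambda>z. - (- tail z)) \<in> borel_measurable borel" by (intro borel_measurable_uminus borel_measurable_mono)
  then show ?thesis by simp
qed

lemma claim_positive: "AE y in D. 0 < y"
  unfolding D_def using X_pos[of 1] by (subst AE_distr_iff) (auto simp: X_measurable)

lemma tail_integral:
  "(\<integral>\<^sup>+z. ennreal (tail z * indicator {0..} z) \<partial>lborel) = ennreal (claim_mean)"
proof -
  interpret P: pair_sigma_finite lborel D ..
  have "(\<integral>\<^sup>+z. ennreal (tail z * indicator {0..} z) \<partial>lborel) = (\<integral>\<^sup>+z. \<integral>\<^sup>+y. (if 0 \<le> z \<and> z < y then 1 else 0) \<partial>D \<partial>lborel)"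
  proof (intro nn_integral_cong)
    fix z :: real
    have "(\<integral>\<^sup>+y. (if 0 \<le> z \<and> z < y then 1 else 0) \<partial>D) = (\<integral>\<^sup>+y. indicator {0..} z * indicator {z<..} y \<partial>D)"
      by (intro nn_integral_cong) (auto simp: indicator_def)
    also have "\<dots> = indicator {0..} z * emeasure D {z<..}" by (subst nn_integral_cmult) auto
    finally show "ennreal (tail z * indicator {0..} z) = (\<integral>\<^sup>+y. (if 0 \<le> z \<and> z < y then 1 else 0) \<partial>D)"
      by (auto simp: tail_def law.emeasure_eq_measure indicator_def)
  qed
  also have "\<dots> = (\<integral>\<^sup>+y. \<integral>\<^sup>+z. (if 0 \<le> z \<and> z < y then 1 else 0) \<partial>lborel \<partial>D)"
    by (rule P.Fubini'[symmetric]) measurable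
  also have "\<dots> = (\<integral>\<^sup>+y. ennreal y \<partial>D)"
  proof (rule nn_integral_cong_AE, use claim_positive in eventually_elim)
    fix y :: real assume "0 < y"
    have "(\<integral>\<^sup>+z. (if 0 \<le> z \<and> z < y then 1 else 0) \<partial>lborel) = (\<integral>\<^sup>+z. indicator {0..<y} z \<partial>lborel)"
      by (intro nn_integral_cong) (auto simp: indicator_def)
    then show "(\<integral>\<^sup>+z. (if 0 \<le> z \<and> z < y then 1 else 0) \<partial>lborel) = ennreal y" using \<open>0 < y\<close> by simp
  qed
  also have "\<dots> = ennreal (integral\<^sup>L D (\<lambda>y. y))"
    using X_integrable claim_positive
    by (intro nn_integral_eq_integral) (auto simp: D_def integrable_distr_eq X_measurable elim: eventually_mono)
  also have "integral\<^sup>L D (\<lambda>y. y) = claim_mean"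
    unfolding D_def claim_mean_def by (subst integral_distr) (auto simp: X_measurable)
  finally show ?thesis .
qed

sublocale tail: tail_function tail "claim_mean"
proof
  show "0 \<le> tail z" "tail z \<le> 1" for z by (auto simp: tail_def)
  have pos: "0 \<le> claim_mean"
    unfolding claim_mean_def using X_pos[of 1] by (intro integral_nonneg_AE) (auto elim: eventually_mono)
  have m: "(\<lambda>z. tail z * indicator {0..} z) \<in> borel_measurable lborel" by measurable
  have nn: "AE z in lborel. 0 \<le> tail z * indicator {0..} z" by (auto simp: tail_def)
  show "integrable lborel (\<lambda>z. tail z * indicator {0..} z)"
    by (rule integrableI_nonneg[OF m nn]) (simp add: tail_integral)
  show "(LBINT z. tail z * indicator {0..} z) = claim_mean"
    using tail_integral pos by (subst integral_eq_nn_integral[OF m nn]) simp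
qed measurable

abbreviation "excess \<equiv> tail.int_tail"

text \<open>By Fubini, a point \<open>v\<close> contributes exactly for claims of size at most
  \<open>b - v\<close>, which brings in the distribution function \<open>1 - tail\<close>.
  Subtracting this from the integral of \<open>\<phi>\<close> leaves a convolution with
  \<open>tail\<close>, and the law \<open>D\<close> disappears from the equation.\<close>

lemma claim_shift_integral:
  fixes \<phi> :: "real \<Rightarrow> real"
  assumes \<phi>: "bounded_borel \<phi>" and \<phi>0: "\<And>v. v < 0 \<Longrightarrow> \<phi> v = 0" and b: "0 \<le> b"
  shows "(LBINT w. (\<integral>y. \<phi> (w - y) \<partial>D) * indicator {0<..b} w)
    = (LBINT v. \<phi> v * (1 - tail (b - v)) * indicator {0..b} v)"
proof -
  interpret P: pair_sigma_finite lborel D ..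
  note [measurable] = bounded_borel_measurable[OF \<phi>]
  from \<phi> obtain W where W: "0 \<le> W" "\<And>x. \<bar>\<phi> x\<bar> \<le> W" by (rule bounded_borelE) blast
  have int: "integrable (lborel \<Otimes>\<^sub>M D) (case_prod H)"
    if [measurable]: "case_prod H \<in> borel_measurable (lborel \<Otimes>\<^sub>M D)"
      and H: "\<And>w y. \<bar>H w y\<bar> \<le> W" "\<And>w y. w \<notin> {0..b} \<Longrightarrow> H w y = 0" for H :: "real \<Rightarrow> real \<Rightarrow> real"
  proof (rule Bochner_Integration.integrable_bound)
    show "integrable (lborel \<Otimes>\<^sub>M D) (\<lambda>z. W * indicator ({0..b} \<times> UNIV) z :: real)"
      by (intro integrable_mult_right)
         (use law.space_eq_univ in \<open>auto simp: integrable_indicator_iff law.emeasure_pair_measure_Times emeasure_lborel_Icc_eq ennreal_mult_less_top law.emeasure_eq_measure\<close>)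
    have "\<bar>H w y\<bar> \<le> W * indicator ({0..b} \<times> UNIV) (w, y)" for w y
      using H[of w y] by (cases "w \<in> {0..b}") auto
    then show "AE z in lborel \<Otimes>\<^sub>M D. norm (case_prod H z) \<le> norm (W * indicator ({0..b} \<times> UNIV) z)"
      using W by (intro AE_I2) (auto simp: split_beta' abs_mult)
  qed measurable
  have "(LBINT w. (\<integral>y. \<phi> (w - y) \<partial>D) * indicator {0<..b} w)
    = (\<integral>w. \<integral>y. \<phi> (w - y) * (if 0 < w \<and> w \<le> b \<and> 0 < y then 1 else 0) \<partial>D \<partial>lborel)"
  proof (intro Bochner_Integration.integral_cong refl)
    fix w
    have "(\<integral>y. \<phi> (w - y) \<partial>D) * indicator {0<..b} w = (\<integral>y. \<phi> (w - y) * indicator {0<..b} w \<partial>D)" by simp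
    also have "\<dots> = (\<integral>y. \<phi> (w - y) * (if 0 < w \<and> w \<le> b \<and> 0 < y then 1 else 0) \<partial>D)"
      by (rule integral_cong_AE) (use claim_positive in \<open>auto simp: indicator_def elim!: eventually_mono\<close>)
    finally show "(\<integral>y. \<phi> (w - y) \<partial>D) * indicator {0<..b} w = (\<integral>y. \<phi> (w - y) * (if 0 < w \<and> w \<le> b \<and> 0 < y then 1 else 0) \<partial>D)" .
  qed
  also have "\<dots> = (\<integral>y. \<integral>w. \<phi> (w - y) * (if 0 < w \<and> w \<le> b \<and> 0 < y then 1 else 0) \<partial>lborel \<partial>D)"
    by (rule P.Fubini_integral[symmetric], rule int) (use W in auto)
  also have "\<dots> = (\<integral>y. \<integral>v. \<phi> v * (if 0 < v + y \<and> v + y \<le> b \<and> 0 < y then 1 else 0) \<partial>lborel \<partial>D)"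
  proof (rule Bochner_Integration.integral_cong[OF refl])
    fix y
    show "(LBINT w. \<phi> (w - y) * (if 0 < w \<and> w \<le> b \<and> 0 < y then 1 else 0))
      = (LBINT v. \<phi> v * (if 0 < v + y \<and> v + y \<le> b \<and> 0 < y then 1 else 0))"
      by (subst lborel_integral_real_affine[where c=1 and t=y]) (auto simp: add.commute intro!: Bochner_Integration.integral_cong)
  qed
  also have "\<dots> = (\<integral>v. \<integral>y. \<phi> v * (if 0 < v + y \<and> v + y \<le> b \<and> 0 < y then 1 else 0) \<partial>D \<partial>lborel)"
  proof (rule P.Fubini_integral, rule int)
    show "\<phi> v * (if 0 < v + y \<and> v + y \<le> b \<and> 0 < y then 1 else 0) = 0" if "v \<notin> {0..b}" for v y
      using that \<phi>0[of v] by (cases "v < 0") auto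
  qed (use W in auto)
  also have "\<dots> = (LBINT v. \<phi> v * (1 - tail (b - v)) * indicator {0..b} v)"
  proof (intro Bochner_Integration.integral_cong refl)
    fix v
    have "(\<integral>y. \<phi> v * (if 0 < v + y \<and> v + y \<le> b \<and> 0 < y then 1 else 0) \<partial>D) = (\<integral>y. \<phi> v * indicator {0..} v * indicator {0<..b - v} y \<partial>D)"
      using \<phi>0[of v] by (intro Bochner_Integration.integral_cong) (auto simp: indicator_def)
    also have "\<dots> = \<phi> v * indicator {0..} v * measure D {0<..b - v}"
      by simp
    also have "measure D {0<..b - v} = (1 - tail (b - v)) * indicator {..b} v"
    proof (cases "v \<le> b")
      case True
      have "measure D {0<..b - v} = measure D {..b - v}"
        by (rule law.finite_measure_eq_AE) (use claim_positive in \<open>auto elim!: eventually_mono\<close>)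
      also have "\<dots> = 1 - tail (b - v)"
        unfolding tail_def by (subst law.prob_compl[symmetric]) (auto intro!: arg_cong[where f="measure D"])
      finally show ?thesis using True by simp
    qed simp
    finally show "(\<integral>y. \<phi> v * (if 0 < v + y \<and> v + y \<le> b \<and> 0 < y then 1 else 0) \<partial>D) = \<phi> v * (1 - tail (b - v)) * indicator {0..b} v"
      by (auto simp: indicator_def)
  qed
  finally show ?thesis .
qed

text \<open>Extended by 0 to the whole line, as the integrated equation and the convolution calculus
  require.\<close>

definition below0 :: "real \<Rightarrow> real \<Rightarrow> real \<Rightarrow> real" where
  "below0 c a u = (if 0 \<le> u then below_prob c a u else 0)"

lemma below0_bounds: "0 \<le> below0 c a u" "below0 c a u \<le> 1"
  unfolding below0_def by (auto simp: below_prob_bounds)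

lemma bounded_borel_below0: "0 < c \<Longrightarrow> 0 \<le> a \<Longrightarrow> bounded_borel (below0 c a)"
  unfolding bounded_borel_def using measurable_below_prob[of c a] below0_bounds
  by (intro conjI exI[of _ 1]) (auto simp: below0_def[abs_def] abs_le_iff intro: order_trans[of _ 0])

lemma below0_integrated:
  assumes c: "0 < c" and a: "0 \<le> a" and b: "0 < b"
  shows "c * (below0 c a b - below0 c a 0) = rate * (conv (below0 c a) tail b - excess a + excess (b + a))"
proof -
  let ?\<phi> = "below0 c a"
  note bb = bounded_borel_below0[OF c a]
  note [measurable] = bounded_borel_measurable[OF bb]
  have \<phi>0: "?\<phi> v = 0" if "v < 0" for v using that by (simp add: below0_def)
  have int\<phi>: "integrable D (\<lambda>y. ?\<phi> (w - y))" for w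
    by (rule law.integrable_const_bound[where B=1]) (auto simp: below0_bounds)
  have "c * (?\<phi> b - ?\<phi> 0) = rate * (LBINT w. (?\<phi> w - (\<integral>y. law.extend_neg a ?\<phi> (w - y) \<partial>D)) * indicator {0<..b} w)"
  proof (rule law.integrated_equation[where h="\<lambda>m. inverse (real (Suc m))" and p="\<lambda>m. sk_prob c a (inverse (real (Suc m)))"])
    show "(\<lambda>m. inverse (real (Suc m))) \<longlonglongrightarrow> 0" by (rule LIMSEQ_inverse_real_of_nat)
    show "(\<lambda>m. sk_prob c a (inverse (real (Suc m))) u) \<longlonglongrightarrow> ?\<phi> u" if "0 \<le> u" for u
      using sk_prob_tendsto[OF c that a] that by (simp add: below0_def)
    show "(?\<phi> \<longlongrightarrow> ?\<phi> u) (at_right u)" if "0 \<le> u" for u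
    proof -
      have "eventually (\<lambda>v. below_prob c a v = ?\<phi> v) (at_right u)"
        unfolding eventually_at_right_field using that by (intro exI[of _ "u + 1"]) (auto simp: below0_def)
      from filterlim_cong[THEN iffD1, OF refl refl this below_prob_right_continuous[OF c that a]]
      show ?thesis using that by (simp add: below0_def[of c a u])
    qed
    fix m :: nat and w :: real assume w: "0 \<le> w"
    show "\<bar>sk_prob c a (inverse (real (Suc m))) (w - c * inverse (real (Suc m))) -
         (exp (- (rate * inverse (real (Suc m)))) * sk_prob c a (inverse (real (Suc m))) w +
          rate * inverse (real (Suc m)) * exp (- (rate * inverse (real (Suc m)))) *
          (\<integral>y. law.extend_neg a (sk_prob c a (inverse (real (Suc m)))) (w - y) \<partial>D))\<bar>
        \<le> (rate * inverse (real (Suc m)))\<^sup>2"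
      unfolding sk_prob_def[abs_def]
      by (rule law.skeleton_increment) (use rate_pos a w in auto)
  qed (use c b rate_pos a in \<open>auto simp: sk_prob_bounds below0_bounds \<phi>0 divide_le_eq_1 inverse_eq_divide\<close>)
  also have "(LBINT w. (?\<phi> w - (\<integral>y. law.extend_neg a ?\<phi> (w - y) \<partial>D)) * indicator {0<..b} w)
    = (LBINT w. ?\<phi> w * indicator {0<..b} w - (\<integral>y. ?\<phi> (w - y) \<partial>D) * indicator {0<..b} w - tail (w + a) * indicator {0<..b} w)"
  proof (intro Bochner_Integration.integral_cong refl)
    fix w
    \<comment> \<open>From \<open>w\<close>, a claim above \<open>w + a\<close> causes a deficit
      above \<open>a\<close>; a smaller ruinous claim contributes 0, just as the extension of
      \<open>?\<phi>\<close> by 0 does.\<close>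
    have "(\<integral>y. law.extend_neg a ?\<phi> (w - y) \<partial>D) = (\<integral>y. ?\<phi> (w - y) + indicator {w + a<..} y \<partial>D)"
      using a by (intro Bochner_Integration.integral_cong) (auto simp: law.extend_neg_def \<phi>0 indicator_def)
    also have "\<dots> = (\<integral>y. ?\<phi> (w - y) \<partial>D) + tail (w + a)"
      using int\<phi> by (subst Bochner_Integration.integral_add) (auto simp: tail_def integrable_indicator_iff law.emeasure_eq_measure)
    finally show "(?\<phi> w - (\<integral>y. law.extend_neg a ?\<phi> (w - y) \<partial>D)) * indicator {0<..b} w
       = ?\<phi> w * indicator {0<..b} w - (\<integral>y. ?\<phi> (w - y) \<partial>D) * indicator {0<..b} w - tail (w + a) * indicator {0<..b} w"
      by (simp add: left_diff_distrib distrib_right)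
  qed
  also have "\<dots> = (LBINT w. ?\<phi> w * indicator {0<..b} w) - (LBINT w. (\<integral>y. ?\<phi> (w - y) \<partial>D) * indicator {0<..b} w)
     - (LBINT w. tail (w + a) * indicator {0<..b} w)"
  proof -
    have 1: "integrable lborel (\<lambda>w. ?\<phi> w * indicator {0<..b} w)"
      by (rule integrable_bounded_indicator[where B=1 and s=0 and t=b]) (auto simp: below0_bounds indicator_def)
    have "0 \<le> (\<integral>y. ?\<phi> (w - y) \<partial>D)" "(\<integral>y. ?\<phi> (w - y) \<partial>D) \<le> 1" for w
      using int\<phi> by (auto intro!: integral_nonneg_AE law.integral_le_const simp: below0_bounds)
    then have 2: "integrable lborel (\<lambda>w. (\<integral>y. ?\<phi> (w - y) \<partial>D) * indicator {0<..b} w)"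
      by (intro integrable_bounded_indicator[where B=1 and s=0 and t=b]) (auto simp: indicator_def)
    have 3: "integrable lborel (\<lambda>w. tail (w + a) * indicator {0<..b} w)"
      by (rule integrable_bounded_indicator[where B=1 and s=0 and t=b]) (auto simp: tail.B_bounds indicator_def)
    show ?thesis using 1 2 3 by simp
  qed
  also have "(LBINT w. (\<integral>y. ?\<phi> (w - y) \<partial>D) * indicator {0<..b} w) = (LBINT v. ?\<phi> v * (1 - tail (b - v)) * indicator {0..b} v)"
    by (rule claim_shift_integral) (use bb b \<phi>0 in auto)
  also have "(LBINT w. ?\<phi> w * indicator {0<..b} w) = (LBINT w. ?\<phi> w * indicator {0..b} w)"
    by (rule integral_cong_AE) (use AE_lborel_singleton[of 0] in \<open>auto simp: indicator_def elim!: eventually_mono\<close>)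
  also have "(LBINT w. ?\<phi> w * indicator {0..b} w) - (LBINT v. ?\<phi> v * (1 - tail (b - v)) * indicator {0..b} v) = conv ?\<phi> tail b"
  proof -
    have 1: "integrable lborel (\<lambda>w. ?\<phi> w * indicator {0..b} w)"
      by (rule integrable_bounded_indicator[where B=1 and s=0 and t=b]) (auto simp: below0_bounds indicator_def)
    have 2: "integrable lborel (\<lambda>v. ?\<phi> v * (1 - tail (b - v)) * indicator {0..b} v)"
      by (rule integrable_bounded_indicator[where B=1 and s=0 and t=b])
         (auto simp: below0_bounds abs_mult tail.B_bounds indicator_def intro!: mult_le_one)
    show ?thesis
      unfolding conv_def using 1 2
      by (subst Bochner_Integration.integral_diff[symmetric])
         (auto intro!: Bochner_Integration.integral_cong simp: algebra_simps)
  qed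
  also have "(LBINT w. tail (w + a) * indicator {0<..b} w) = excess a - excess (b + a)"
  proof -
    have "(LBINT w. tail (w + a) * indicator {0<..b} w) = (LBINT z. tail z * indicator {a<..b + a} z)"
      by (subst (2) lborel_integral_real_affine[where c=1 and t=a])
         (auto intro!: Bochner_Integration.integral_cong simp: indicator_def add.commute)
    then show ?thesis using tail.int_tail_split[OF a, of "b + a"] b by simp
  qed
  finally show ?thesis by (simp add: algebra_simps)
qed

lemma below0_renewal:
  assumes c: "0 < c" and a: "0 \<le> a" and u: "0 \<le> u" and ruin: "(below0 c 0 \<longlongrightarrow> 0) at_top"
  shows "c * below0 c a u = rate * excess (u + a) + rate * conv (below0 c a) tail u"
proof -
  have lim: "(below0 c a \<longlongrightarrow> 0) at_top"
  proof (rule tendsto_sandwich[OF _ _ tendsto_const ruin])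
    show "eventually (\<lambda>u. below0 c a u \<le> below0 c 0 u) at_top"
      by (rule always_eventually) (use c a below_prob_mono[of c _ 0 a] in \<open>auto simp: below0_def\<close>)
  qed (auto simp: below0_bounds)
  have "((\<lambda>b. c * (below0 c a b - below0 c a 0)) \<longlongrightarrow> c * (0 - below0 c a 0)) at_top"
    by (intro tendsto_intros lim)
  moreover have "((\<lambda>b. c * (below0 c a b - below0 c a 0)) \<longlongrightarrow> rate * (0 - excess a + 0)) at_top"
  proof (rule Lim_transform_eventually)
    have "filterlim (\<lambda>b::real. a + b) at_top at_top"
      by (rule filterlim_tendsto_add_at_top[OF tendsto_const filterlim_ident])
    from filterlim_compose[OF tail.int_tail_tendsto_0 this]
    have "((\<lambda>b. excess (b + a)) \<longlongrightarrow> 0) at_top" by (simp add: add.commute)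
    then show "((\<lambda>b. rate * (conv (below0 c a) tail b - excess a + excess (b + a))) \<longlongrightarrow> rate * (0 - excess a + 0)) at_top"
      by (intro tendsto_intros tail.conv_tendsto_0 bounded_borel_below0 lim c a)
    show "eventually (\<lambda>b. rate * (conv (below0 c a) tail b - excess a + excess (b + a)) = c * (below0 c a b - below0 c a 0)) at_top"
      using eventually_gt_at_top[of 0] by eventually_elim (simp add: below0_integrated[OF c a])
  qed
  ultimately have "c * (0 - below0 c a 0) = rate * (0 - excess a + 0)"
    by (intro tendsto_unique[of at_top]) auto
  then have 0: "c * below0 c a 0 = rate * excess a" by simp
  show ?thesis
  proof (cases "u = 0")
    case True
    have "conv (below0 c a) tail 0 = (\<integral>v. 0 \<partial>(lborel :: real measure))"
      unfolding conv_def using bounded_borel_measurable[OF bounded_borel_below0[OF c a]]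
      by (intro integral_cong_AE) (use AE_lborel_singleton[of "0::real"] in \<open>auto simp: indicator_def elim!: eventually_mono\<close>)
    then show ?thesis using 0 True by simp
  next
    case False
    then show ?thesis using below0_integrated[OF c a, of u] u 0 by (simp add: algebra_simps)
  qed
qed

end


section \<open>The limiting deficit law\<close>

locale exponential_ruin = poisson_claims_model M N X F rate
  for M :: "'a measure" and N :: "real \<Rightarrow> 'a \<Rightarrow> nat"
    and X :: "nat \<Rightarrow> 'a \<Rightarrow> real" and F :: "real \<Rightarrow> real" and rate :: real +
  fixes c R K :: real
  assumes c_pos: "0 < c" and net_profit: "rate * claim_mean < c" and R_pos: "0 < R" and K_pos: "0 < K"
    and ruin_asymp: "ruin_prob M c N X \<sim>[at_top] (\<lambda>u. K * exp (- R * u))"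
begin

abbreviation "ruin \<equiv> below0 c 0"

abbreviation "safety \<equiv> c - rate * claim_mean"

lemma safety_pos: "0 < safety" using net_profit by simp

lemma ruin_prob_eq:
  assumes "0 \<le> u" shows "ruin_prob M c N X u = ruin u"
proof -
  have "{\<omega>\<in>space M. ruin_time c N X u \<omega> < \<infinity>} = {\<omega>\<in>space M. ruins_below c N X 0 u \<omega>}"
    using ruin_time_finite_iff[OF _ c_pos assms] by blast
  then show ?thesis using assms by (simp only: ruin_prob_def below0_def below_prob_def if_True)
qed

lemma ruin_scaled_tendsto: "((\<lambda>u. ruin u * exp (R * u)) \<longlongrightarrow> K) at_top"
proof -
  have "((\<lambda>u. ruin_prob M c N X u / (K * exp (- R * u))) \<longlongrightarrow> 1) at_top"
    using K_pos by (intro asymp_equivD_strong[OF ruin_asymp]) auto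
  from tendsto_mult_left[OF this, of K]
  have "((\<lambda>u. K * (ruin_prob M c N X u / (K * exp (- R * u)))) \<longlongrightarrow> K) at_top" by simp
  then show ?thesis
  proof (rule Lim_transform_eventually)
    show "eventually (\<lambda>u. K * (ruin_prob M c N X u / (K * exp (- R * u))) = ruin u * exp (R * u)) at_top"
      using eventually_ge_at_top[of 0]
      by eventually_elim (use K_pos in \<open>simp add: ruin_prob_eq exp_minus field_simps\<close>)
  qed
qed

lemma ruin_pos: "eventually (\<lambda>u. 0 < ruin u) at_top"
  using order_tendstoD(1)[OF ruin_scaled_tendsto K_pos] by eventually_elim (simp add: zero_less_mult_iff)

lemma exp_decay_tendsto: "((\<lambda>u. exp (- (R * u))) \<longlongrightarrow> 0) at_top"
proof -
  have "filterlim (\<lambda>u. R * u) at_top at_top"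
    using R_pos by (intro filterlim_tendsto_pos_mult_at_top[OF tendsto_const _ filterlim_ident])
  then have "filterlim (\<lambda>u. - (R * u)) at_bot at_top" by (simp add: filterlim_uminus_at_top)
  then show ?thesis by (rule filterlim_compose[OF exp_at_bot])
qed

lemma ruin_tendsto_0: "(ruin \<longlongrightarrow> 0) at_top"
  using tendsto_mult[OF ruin_scaled_tendsto exp_decay_tendsto] by (simp add: mult.assoc exp_minus)

lemma ruin_ratio_tendsto: "((\<lambda>u. ruin (u + s) / ruin u) \<longlongrightarrow> exp (- R * s)) at_top"
proof -
  have "filterlim (\<lambda>u. s + u) at_top at_top"
    by (rule filterlim_tendsto_add_at_top[OF tendsto_const filterlim_ident])
  from filterlim_compose[OF ruin_scaled_tendsto this]
  have "((\<lambda>u. ruin (u + s) * exp (R * (u + s))) \<longlongrightarrow> K) at_top" by (simp add: add.commute)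
  then have "((\<lambda>u. exp (- R * s) * (ruin (u + s) * exp (R * (u + s))) / (ruin u * exp (R * u))) \<longlongrightarrow> exp (- R * s) * K / K) at_top"
    using K_pos by (intro tendsto_intros ruin_scaled_tendsto) auto
  also have "exp (- R * s) * K / K = exp (- R * s)" using K_pos by simp
  also have "(\<lambda>u. exp (- R * s) * (ruin (u + s) * exp (R * (u + s))) / (ruin u * exp (R * u))) = (\<lambda>u. ruin (u + s) / ruin u)"
    by (auto simp: fun_eq_iff exp_minus exp_add distrib_left field_simps)
  finally show ?thesis .
qed

lemma ruin_antimono:
  assumes "0 \<le> u" "u \<le> v" shows "ruin v \<le> ruin u"
proof -
  have "ruins_below c N X 0 u \<omega>" if w: "\<omega> \<in> space M" and r: "ruins_below c N X 0 v \<omega>" for \<omega>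
  proof (rule ccontr)
    assume *: "\<not> ruins_below c N X 0 u \<omega>"
    from r obtain t where t: "0 < t" "surplus c N X v t \<omega> < 0" by (auto simp: ruins_below_def)
    have "0 \<le> surplus c N X u t \<omega>" by (rule no_ruin_nonneg[OF w c_pos assms(1) * t(1)])
    then show False using t(2) assms(2) surplus_shift[of c N X v t \<omega> u] by simp
  qed
  then have "below_prob c 0 v \<le> below_prob c 0 u"
    unfolding below_prob_def
    by (intro finite_measure_mono ruins_below_event c_pos assms order_refl) blast
  then show ?thesis using assms by (simp add: below0_def)
qed

lemmas ruin_bounded = bounded_borel_below0[OF c_pos order_refl]

lemma deficit_shift:
  assumes a: "0 \<le> a" and u: "0 \<le> u"
  shows "safety * below0 c a u = rate * (excess (u + a) + conv ruin (\<lambda>z. tail (a + z)) u - ruin u * excess a)"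
proof (rule tail.renewal_shift[OF c_pos _ net_profit a ruin_bounded _ bounded_borel_below0[OF c_pos a] _ u])
  show "c * ruin v = rate * excess v + rate * conv ruin tail v" if "0 \<le> v" for v
    using below0_renewal[OF c_pos order_refl that ruin_tendsto_0] by simp
  show "c * below0 c a v = rate * excess (v + a) + rate * conv (below0 c a) tail v" if "0 \<le> v" for v
    by (rule below0_renewal[OF c_pos a that ruin_tendsto_0])
qed (use rate_pos in simp)

text \<open>The renewal equation for \<open>ruin\<close> at \<open>u + a\<close> eliminates
  \<open>excess (u + a)\<close> and the convolution over \<open>{0..u}\<close> from
  \<open>deficit_shift\<close>. All remaining ruin probabilities have arguments between
  \<open>u\<close> and \<open>u + a\<close> and are thus comparable with
  \<open>ruin u\<close>.\<close>

lemma deficit_identity: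
  assumes a: "0 \<le> a" and u: "0 \<le> u"
  shows "safety * below0 c a u
    = c * ruin (u + a) - rate * (LBINT z. ruin (u + a - z) * tail z * indicator {0..a} z) - rate * ruin u * excess a"
proof -
  have "c * ruin (u + a) = rate * excess (u + a) + rate * conv ruin tail (u + a)"
    using below0_renewal[OF c_pos order_refl add_nonneg_nonneg[OF u a] ruin_tendsto_0] by (simp only: add_0_right)
  then show ?thesis
    unfolding deficit_shift[OF a u] tail.conv_split[OF ruin_bounded u a]
    by (simp only: right_diff_distrib distrib_left mult.assoc)
qed

text \<open>Uniform in the capital and zero as soon as \<open>excess a\<close> is: when claims
  cannot exceed \<open>a\<close>, neither can the deficit. The factor 2 accounts for
  \<open>excess (u + a)\<close> and for the convolution, each at most
  \<open>excess a\<close>.\<close>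

lemma deficit_bound:
  assumes a: "0 \<le> a" and u: "0 \<le> u"
  shows "below0 c a u \<le> 2 * rate * excess a / safety"
proof -
  interpret A: tail_function "\<lambda>z. tail (a + z)" "excess a" by (rule tail.tail_function_shift[OF a])
  have "conv ruin (\<lambda>z. tail (a + z)) u \<le> 1 * excess a"
  proof -
    have "\<bar>ruin v\<bar> \<le> 1" for v using below0_bounds[of c 0 v] by simp
    from A.conv_B_bound[OF ruin_bounded this u] show ?thesis by simp
  qed
  moreover have "excess (u + a) \<le> excess a" using a u by (intro tail.int_tail_antimono) auto
  moreover have "0 \<le> ruin u * excess a" using below0_bounds tail.int_tail_nonneg by simp
  ultimately have "excess (u + a) + conv ruin (\<lambda>z. tail (a + z)) u - ruin u * excess a \<le> 2 * excess a" by simp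
  then have "safety * below0 c a u \<le> rate * (2 * excess a)"
    unfolding deficit_shift[OF a u] using rate_pos by (intro mult_left_mono) auto
  then show ?thesis using safety_pos by (simp add: field_simps)
qed

section \<open>The limiting tail of the deficit given ruin\<close>

definition decay_conv :: "real \<Rightarrow> real" where
  "decay_conv x = (LBINT z. exp (- R * (x - z)) * tail z * indicator {0..x} z)"

definition limit_tail :: "real \<Rightarrow> real" where
  "limit_tail x = (c * exp (- R * x) - rate * decay_conv x - rate * excess x) / safety"

lemma deficit_tendsto:
  assumes a: "0 \<le> a"
  shows "((\<lambda>u. below0 c a u / ruin u) \<longlongrightarrow> limit_tail a) at_top"
proof (rule tendsto_at_topI_sequentially)
  fix v :: "nat \<Rightarrow> real" assume v: "filterlim v at_top sequentially"
  note [measurable] = bounded_borel_measurable[OF ruin_bounded]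
  have ratio: "(\<lambda>n. ruin (v n + s) / ruin (v n)) \<longlonglongrightarrow> exp (- R * s)" for s
    by (rule filterlim_compose[OF ruin_ratio_tendsto v])
  have ev: "eventually (\<lambda>n. 0 \<le> v n \<and> 0 < ruin (v n)) sequentially"
    using filterlim_iff[THEN iffD1, OF v, rule_format, OF eventually_conj[OF eventually_ge_at_top[of 0] ruin_pos]] .
  \<comment> \<open>The cut-off at 0 makes the majorant valid for every \<open>n\<close>, not just
    eventually. For \<open>z \<le> a\<close> the quotient is at most 1 because \<open>ruin\<close>
    is antitone; a zero denominator gives the value 0.\<close>
  let ?J = "\<lambda>n. \<integral>z. (ruin (max 0 (v n) + (a - z)) / ruin (max 0 (v n))) * tail z * indicator {0..a} z \<partial>lborel"
  have "?J \<longlonglongrightarrow> decay_conv a"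
    unfolding decay_conv_def
  proof (rule integral_dominated_convergence[where w="\<lambda>z. indicator {0..a} z"])
    show "integrable lborel (\<lambda>z. indicator {0..a} z :: real)" by (simp add: integrable_indicator_iff emeasure_lborel_Icc_eq)
    show "AE z in lborel. (\<lambda>n. (ruin (max 0 (v n) + (a - z)) / ruin (max 0 (v n))) * tail z * indicator {0..a} z)
       \<longlonglongrightarrow> exp (- R * (a - z)) * tail z * indicator {0..a} z"
    proof (rule AE_I2)
      fix z
      have "(\<lambda>n. ruin (max 0 (v n) + (a - z)) / ruin (max 0 (v n))) \<longlonglongrightarrow> exp (- R * (a - z))"
        by (rule Lim_transform_eventually[OF ratio]) (use ev in eventually_elim, simp add: max_def)
      then show "(\<lambda>n. (ruin (max 0 (v n) + (a - z)) / ruin (max 0 (v n))) * tail z * indicator {0..a} z)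
       \<longlonglongrightarrow> exp (- R * (a - z)) * tail z * indicator {0..a} z" by (intro tendsto_intros)
    qed
    show "AE z in lborel. norm ((ruin (max 0 (v n) + (a - z)) / ruin (max 0 (v n))) * tail z * indicator {0..a} z) \<le> indicator {0..a} z" for n
    proof (rule AE_I2)
      fix z
      have "(ruin (max 0 (v n) + (a - z)) / ruin (max 0 (v n))) * tail z \<le> 1" if "z \<le> a"
        using ruin_antimono[of "max 0 (v n)" "max 0 (v n) + (a - z)"] that below0_bounds[of c 0 "max 0 (v n)"] tail.B_bounds[of z]
          below0_bounds[of c 0 "max 0 (v n) + (a - z)"]
        by (intro mult_le_one) (auto simp: divide_le_eq_1)
      then show "norm ((ruin (max 0 (v n) + (a - z)) / ruin (max 0 (v n))) * tail z * indicator {0..a} z) \<le> indicator {0..a} z"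
        using below0_bounds tail.B_bounds[of z] by (auto simp: indicator_def abs_mult)
    qed
  qed measurable
  then have "(\<lambda>n. (c * (ruin (v n + a) / ruin (v n)) - rate * ?J n - rate * excess a) / safety) \<longlonglongrightarrow> limit_tail a"
    unfolding limit_tail_def using safety_pos by (intro tendsto_intros ratio) auto
  then show "(\<lambda>n. below0 c a (v n) / ruin (v n)) \<longlonglongrightarrow> limit_tail a"
  proof (rule Lim_transform_eventually)
    show "eventually (\<lambda>n. (c * (ruin (v n + a) / ruin (v n)) - rate * ?J n - rate * excess a) / safety = below0 c a (v n) / ruin (v n)) sequentially"
      using ev
    proof eventually_elim
      case (elim n)
      have "?J n = (LBINT z. (1 / ruin (v n)) * (ruin (v n + a - z) * tail z * indicator {0..a} z))"
        using elim by (intro Bochner_Integration.integral_cong) (auto simp: max_def algebra_simps)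
      then have J: "?J n = (LBINT z. ruin (v n + a - z) * tail z * indicator {0..a} z) / ruin (v n)"
        by (simp only: integral_mult_right_zero) simp
      have "below0 c a (v n) = (c * ruin (v n + a) - rate * (LBINT z. ruin (v n + a - z) * tail z * indicator {0..a} z) - rate * ruin (v n) * excess a) / safety"
        using elim safety_pos by (subst deficit_identity[OF a, symmetric]) auto
      then show ?case unfolding J using elim by (simp add: diff_divide_distrib mult_ac)
    qed
  qed
qed

text \<open>The sign cannot be read off the formula; it is inherited from the ratios of
  probabilities whose limit this is, and so is the monotonicity in the next lemma.\<close>

lemma limit_tail_nonneg:
  assumes "0 \<le> a" shows "0 \<le> limit_tail a"
proof (rule tendsto_lowerbound[OF deficit_tendsto[OF assms]])
  show "eventually (\<lambda>u. 0 \<le> below0 c a u / ruin u) at_top"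
    by (intro always_eventually allI divide_nonneg_nonneg below0_bounds)
qed simp

lemma limit_tail_antimono:
  assumes "0 \<le> a" "a \<le> b" shows "limit_tail b \<le> limit_tail a"
proof (rule tendsto_le[OF _ deficit_tendsto deficit_tendsto])
  show "eventually (\<lambda>u. below0 c b u / ruin u \<le> below0 c a u / ruin u) at_top"
    using eventually_ge_at_top[of 0]
  proof eventually_elim
    case (elim u)
    have "below0 c b u \<le> below0 c a u"
      using below_prob_mono[OF c_pos elim assms] elim by (simp add: below0_def)
    then show ?case by (rule divide_right_mono) (rule below0_bounds)
  qed
qed (use assms in auto)

lemma limit_tail_0: "limit_tail 0 = 1"
proof -
  have "decay_conv 0 = (\<integral>z. 0 \<partial>(lborel :: real measure))"
    unfolding decay_conv_def
    by (intro integral_cong_AE) (use AE_lborel_singleton[of "0::real"] in \<open>auto simp: indicator_def elim!: eventually_mono\<close>)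
  then show ?thesis using safety_pos by (simp add: limit_tail_def tail.int_tail_0)
qed

lemma decay_conv_split:
  assumes "0 \<le> x" "x \<le> y"
  shows "decay_conv y = exp (- R * (y - x)) * decay_conv x + (LBINT z. exp (- R * (y - z)) * tail z * indicator {x<..y} z)"
proof -
  have int: "integrable lborel (\<lambda>z. exp (- R * (y - z)) * tail z * indicator A z)"
    if "A \<in> sets borel" "A \<subseteq> {0..y}" for A
  proof (rule integrable_bounded_indicator[where B=1 and s=0 and t=y])
    fix z
    have "exp (- R * (y - z)) * tail z \<le> 1" if "z \<le> y"
      using R_pos tail.B_bounds[of z] that by (intro mult_le_one) (auto simp: zero_le_mult_iff)
    then show "\<bar>exp (- R * (y - z)) * tail z * indicator A z\<bar> \<le> 1"
      using \<open>A \<subseteq> {0..y}\<close> tail.B_bounds[of z] by (auto simp: indicator_def)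
  qed (use that in \<open>auto simp: indicator_def\<close>)
  have "decay_conv y = (LBINT z. exp (- R * (y - z)) * tail z * indicator {0..x} z + exp (- R * (y - z)) * tail z * indicator {x<..y} z)"
    unfolding decay_conv_def using assms by (intro Bochner_Integration.integral_cong) (auto simp: indicator_def)
  also have "\<dots> = (LBINT z. exp (- R * (y - z)) * tail z * indicator {0..x} z) + (LBINT z. exp (- R * (y - z)) * tail z * indicator {x<..y} z)"
    using assms by (intro Bochner_Integration.integral_add int) auto
  also have "(LBINT z. exp (- R * (y - z)) * tail z * indicator {0..x} z) = (LBINT z. exp (- R * (y - x)) * (exp (- R * (x - z)) * tail z * indicator {0..x} z))"
    by (intro Bochner_Integration.integral_cong) (auto simp: exp_add[symmetric] algebra_simps)
  also have "\<dots> = exp (- R * (y - x)) * decay_conv x" by (simp add: decay_conv_def)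
  finally show ?thesis .
qed

lemma decay_segment:
  assumes "0 \<le> x" "x \<le> y"
  shows "exp (- R * (y - x)) * (excess x - excess y) \<le> (LBINT z. exp (- R * (y - z)) * tail z * indicator {x<..y} z)"
    and "(LBINT z. exp (- R * (y - z)) * tail z * indicator {x<..y} z) \<le> excess x - excess y"
proof -
  have int1: "integrable lborel (\<lambda>z. tail z * indicator {x<..y} z)"
    by (rule integrable_bounded_indicator[where B=1 and s=x and t=y]) (auto simp: indicator_def tail.B_bounds)
  have le: "exp (- R * (y - z)) * tail z * indicator {x<..y} z \<le> tail z * indicator {x<..y} z" for z
    using R_pos tail.B_bounds[of z] by (auto simp: indicator_def intro!: mult_left_le_one_le)
  have ge: "exp (- R * (y - x)) * (tail z * indicator {x<..y} z) \<le> exp (- R * (y - z)) * tail z * indicator {x<..y} z" for z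
    using R_pos tail.B_bounds[of z] by (auto simp: indicator_def intro!: mult_right_mono)
  have int2: "integrable lborel (\<lambda>z. exp (- R * (y - z)) * tail z * indicator {x<..y} z)"
    by (rule Bochner_Integration.integrable_bound[OF int1]) (use le tail.B_bounds in \<open>auto intro!: AE_I2\<close>)
  have eq: "(LBINT z. tail z * indicator {x<..y} z) = excess x - excess y"
    using tail.int_tail_split[OF assms] by simp
  have "exp (- R * (y - x)) * (LBINT z. tail z * indicator {x<..y} z) = (LBINT z. exp (- R * (y - x)) * (tail z * indicator {x<..y} z))" by simp
  also have "\<dots> \<le> (LBINT z. exp (- R * (y - z)) * tail z * indicator {x<..y} z)"
    by (intro integral_mono integrable_mult_right int1 int2 ge)
  finally show "exp (- R * (y - x)) * (excess x - excess y) \<le> (LBINT z. exp (- R * (y - z)) * tail z * indicator {x<..y} z)"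
    unfolding eq .
  show "(LBINT z. exp (- R * (y - z)) * tail z * indicator {x<..y} z) \<le> excess x - excess y"
    unfolding eq[symmetric] by (intro integral_mono int1 int2 le)
qed

lemma decay_conv_nonneg: "0 \<le> decay_conv x"
  unfolding decay_conv_def using tail.B_bounds by (intro integral_nonneg_AE) auto

text \<open>Formally this function \<open>g\<close> solves
  \<open>g' = - R * g - rate * tail\<close>, while \<open>excess\<close> has derivative
  \<open>- tail\<close>. Hence \<open>safety * limit_tail\<close> has derivative
  \<open>- R * g\<close>: the limit law has density \<open>R * g / safety\<close> at distance
  \<open>x\<close> below 0, and \<open>limit_tail\<close> decreases strictly where
  \<open>g > 0\<close>. The lemmas that follow express this by integrals over
  \<open>{x<..y}\<close>, without derivatives.\<close>

definition lundberg_gap :: "real \<Rightarrow> real" where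
  "lundberg_gap x = c * exp (- R * x) - rate * decay_conv x"

lemma limit_tail_gap: "safety * limit_tail x = lundberg_gap x - rate * excess x"
  using safety_pos by (simp add: limit_tail_def lundberg_gap_def)

lemma lundberg_gap_split:
  assumes "0 \<le> x" "x \<le> y"
  shows "lundberg_gap y = exp (- R * (y - x)) * lundberg_gap x - rate * (LBINT z. exp (- R * (y - z)) * tail z * indicator {x<..y} z)"
proof -
  have "exp (- R * y) = exp (- R * (y - x)) * exp (- R * x)" by (simp add: exp_add[symmetric] algebra_simps)
  then show ?thesis unfolding lundberg_gap_def decay_conv_split[OF assms] by (simp only:) (simp add: algebra_simps)
qed

lemma lundberg_gap_bounds:
  assumes "0 \<le> x" shows "rate * excess x \<le> lundberg_gap x" "lundberg_gap x \<le> c"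
proof -
  have "0 \<le> safety * limit_tail x" using safety_pos limit_tail_nonneg[OF assms] by simp
  then show "rate * excess x \<le> lundberg_gap x" unfolding limit_tail_gap by simp
  have "c * exp (- R * x) \<le> c * 1" using R_pos c_pos assms by (intro mult_left_mono) auto
  then show "lundberg_gap x \<le> c" using mult_nonneg_nonneg[OF less_imp_le[OF rate_pos] decay_conv_nonneg[of x]] by (simp add: lundberg_gap_def)
qed

text \<open>Makes the limit law free of atoms. In the constant, \<open>c * R\<close> comes from
  \<open>1 - exp (- t) \<le> t\<close> and a gap of at most \<open>c\<close>, and
  \<open>rate\<close> from the segment between \<open>x\<close> and \<open>y\<close>, where
  \<open>tail \<le> 1\<close>.\<close>

lemma limit_tail_lipschitz:
  assumes "0 \<le> x" "x \<le> y"
  shows "limit_tail x - limit_tail y \<le> (c * R + rate) / safety * (y - x)"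
proof -
  let ?s = "\<integral>z. exp (- R * (y - z)) * tail z * indicator {x<..y} z \<partial>lborel"
  have "safety * (limit_tail x - limit_tail y) = lundberg_gap x * (1 - exp (- R * (y - x))) + rate * ?s - rate * (excess x - excess y)"
    unfolding right_diff_distrib limit_tail_gap lundberg_gap_split[OF assms] by (simp add: algebra_simps)
  also have "\<dots> \<le> c * (R * (y - x)) + rate * (y - x) - 0"
  proof (intro diff_mono add_mono)
    have "0 \<le> lundberg_gap x"
      using lundberg_gap_bounds(1)[OF assms(1)] rate_pos tail.int_tail_nonneg[of x] by (auto intro: order_trans[rotated])
    then show "lundberg_gap x * (1 - exp (- R * (y - x))) \<le> c * (R * (y - x))"
      using lundberg_gap_bounds(2)[OF assms(1)] exp_ge_add_one_self[of "- R * (y - x)"] assms R_pos c_pos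
      by (intro mult_mono) auto
    show "rate * ?s \<le> rate * (y - x)"
      using decay_segment(2)[OF assms] tail.int_tail_lipschitz[OF assms] rate_pos by (intro mult_left_mono) auto
    show "0 \<le> rate * (excess x - excess y)"
      using rate_pos tail.int_tail_antimono[OF assms] by simp
  qed
  finally show ?thesis using safety_pos by (simp add: field_simps)
qed

lemma limit_tail_le_exp: "0 \<le> x \<Longrightarrow> limit_tail x \<le> c / safety * exp (- R * x)"
  using safety_pos mult_nonneg_nonneg[OF less_imp_le[OF rate_pos] decay_conv_nonneg[of x]]
    mult_nonneg_nonneg[OF less_imp_le[OF rate_pos] tail.int_tail_nonneg[of x]]
  by (simp add: limit_tail_def divide_le_cancel)

text \<open>Where \<open>limit_tail\<close> is constant, its derivative, a negative multiple of the
  gap, has to vanish; the gap dominates \<open>rate * excess\<close>. In integrated form, the gap at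
  \<open>w\<close> is bounded by a proper fraction of itself. This gives zeros of
  \<open>excess\<close> to the right of \<open>x\<close>, and Lipschitz continuity carries them over
  to \<open>x\<close>.\<close>

lemma limit_tail_flat:
  assumes "0 \<le> x" "x < y" "limit_tail x = limit_tail y"
  shows "excess x = 0"
proof -
  have 0: "excess w = 0" if w: "x < w" "w \<le> y" for w
  proof -
    have "limit_tail w = limit_tail x"
      using limit_tail_antimono[of x w] limit_tail_antimono[of w y] assms w by simp
    then have eq: "lundberg_gap x - rate * (excess x - excess w) = lundberg_gap w"
      using limit_tail_gap[of x] limit_tail_gap[of w] by (simp add: algebra_simps)
    have "lundberg_gap w \<le> exp (- R * (w - x)) * lundberg_gap x - rate * (exp (- R * (w - x)) * (excess x - excess w))"
      unfolding lundberg_gap_split[OF assms(1) less_imp_le[OF w(1)]]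
      using decay_segment(1)[OF assms(1) less_imp_le[OF w(1)]] rate_pos by (intro diff_left_mono mult_left_mono) auto
    also have "\<dots> = exp (- R * (w - x)) * (lundberg_gap x - rate * (excess x - excess w))"
      by (simp only: right_diff_distrib mult_ac)
    finally have "lundberg_gap w \<le> exp (- R * (w - x)) * lundberg_gap w" unfolding eq .
    then have "lundberg_gap w * (1 - exp (- R * (w - x))) \<le> 0" by (simp add: algebra_simps)
    moreover have "0 < 1 - exp (- R * (w - x))" using R_pos w by simp
    ultimately have "lundberg_gap w \<le> 0" by (meson mult_pos_pos not_le)
    then have "rate * excess w \<le> 0" using lundberg_gap_bounds(1)[of w] assms w by linarith
    then show ?thesis using rate_pos tail.int_tail_nonneg[of w] by (simp add: mult_le_0_iff)
  qed
  have "excess x \<le> 0 + e" if "0 < e" for e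
  proof -
    let ?w = "min y (x + e)"
    have "excess x \<le> excess ?w + (?w - x)" using assms that by (intro tail.int_tail_lipschitz) auto
    then show ?thesis using 0[of ?w] assms that by simp
  qed
  then have "excess x \<le> 0" by (rule field_le_epsilon)
  then show ?thesis using tail.int_tail_nonneg[of x] by simp
qed

text \<open>\<open>min 0 y\<close> sends every \<open>y \<ge> 0\<close> to
  \<open>limit_tail 0 = 1\<close>.\<close>

definition limit_cdf :: "real \<Rightarrow> real" where
  "limit_cdf y = limit_tail (- min 0 y)"

lemma limit_cdf_mono: "x \<le> y \<Longrightarrow> limit_cdf x \<le> limit_cdf y"
  unfolding limit_cdf_def by (intro limit_tail_antimono) auto

lemma isCont_limit_cdf: "isCont limit_cdf y"
proof -
  have "((c * R + rate) / safety)-lipschitz_on UNIV limit_cdf"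
  proof (rule lipschitz_onI)
    have lip: "dist (limit_cdf x) (limit_cdf y) \<le> (c * R + rate) / safety * dist x y" if "x \<le> y" for x y
    proof -
      have "dist (limit_cdf x) (limit_cdf y) = limit_cdf y - limit_cdf x"
        using limit_cdf_mono[OF that] by (simp add: dist_real_def)
      also have "\<dots> \<le> (c * R + rate) / safety * (- min 0 x - - min 0 y)"
        unfolding limit_cdf_def using that by (intro limit_tail_lipschitz) auto
      also have "\<dots> \<le> (c * R + rate) / safety * dist x y"
        using that safety_pos c_pos R_pos rate_pos by (intro mult_left_mono) (auto simp: dist_real_def)
      finally show ?thesis .
    qed
    show "dist (limit_cdf x) (limit_cdf y) \<le> (c * R + rate) / safety * dist x y" for x y
      using lip[of x y] lip[of y x] by (cases "x \<le> y") (auto simp: dist_commute)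
    show "0 \<le> (c * R + rate) / safety" using safety_pos c_pos R_pos rate_pos by simp
  qed
  then show ?thesis
    using lipschitz_on_continuous_on continuous_on_eq_continuous_at by blast
qed

text \<open>The defining condition prescribes the distribution function only up to 0, but its value
  there is already 1, so the rest is forced. Existence, uniqueness and weak convergence can then be
  treated through one explicit cdf.\<close>

lemma limit_deficit_law_iff:
  "limit_deficit_law c rate claim_mean F R \<nu> \<longleftrightarrow> real_distribution \<nu> \<and> cdf \<nu> = limit_cdf"
proof -
  have formula: "1 / safety * (c * exp (- R * x) - rate * (LBINT z:{0..x}. exp (- R * (x - z)) * (1 - F z)) - rate * (LBINT z:{x..}. 1 - F z))
    = limit_tail x" for x
    unfolding limit_tail_def decay_conv_def tail.int_tail_Ici set_lebesgue_integral_def tail_eq[symmetric]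
    by (simp add: mult_ac)
  show ?thesis
  proof
    assume *: "limit_deficit_law c rate claim_mean F R \<nu>"
    have sets: "sets \<nu> = sets borel" using * by (simp add: limit_deficit_law_def)
    have "prob_space \<nu>" using * by (simp add: limit_deficit_law_def)
    then have rd: "real_distribution \<nu>"
      by (simp add: real_distribution_def real_distribution_axioms_def sets)
    then interpret V: real_distribution \<nu> .
    have m: "measure \<nu> {..- x} = limit_tail x" if "0 \<le> x" for x
      using * that unfolding limit_deficit_law_def formula by auto
    have "cdf \<nu> y = limit_cdf y" for y
    proof (cases "y \<le> 0")
      case True
      then show ?thesis using m[of "- y"] by (simp add: cdf_def limit_cdf_def)
    next
      case False
      have "1 = cdf \<nu> 0" using m[of 0] by (simp add: cdf_def limit_tail_0)
      also have "\<dots> \<le> cdf \<nu> y" using False by (intro V.cdf_nondecreasing) auto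
      finally have "cdf \<nu> y = 1" using V.cdf_bounded_prob[of y] by simp
      then show ?thesis using False by (simp add: limit_cdf_def limit_tail_0)
    qed
    then show "real_distribution \<nu> \<and> cdf \<nu> = limit_cdf" using rd by blast
  next
    assume *: "real_distribution \<nu> \<and> cdf \<nu> = limit_cdf"
    then interpret V: real_distribution \<nu> by simp
    have "measure \<nu> {..- x} = limit_tail x" if "0 \<le> x" for x
      using * that by (simp add: cdf_def fun_eq_iff limit_cdf_def)
    then show "limit_deficit_law c rate claim_mean F R \<nu>"
      unfolding limit_deficit_law_def formula by (simp add: V.prob_space_axioms)
  qed
qed

lemma limit_deficit_law_exists1: "\<exists>!\<nu>. limit_deficit_law c rate claim_mean F R \<nu>"
proof (rule ex1I)
  have rc: "continuous (at_right y) limit_cdf" for y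
    using isCont_limit_cdf by (rule continuous_at_imp_continuous_at_within)
  have bot: "(limit_cdf \<longlongrightarrow> 0) at_bot"
  proof (rule tendsto_sandwich[OF _ _ tendsto_const])
    show "eventually (\<lambda>y. 0 \<le> limit_cdf y) at_bot"
      by (auto simp: limit_cdf_def intro!: always_eventually limit_tail_nonneg)
    show "eventually (\<lambda>y. limit_cdf y \<le> c / safety * exp (- (R * - y))) at_bot"
      using eventually_le_at_bot[of 0]
    proof eventually_elim
      case (elim y)
      then show ?case using limit_tail_le_exp[of "- y"] by (simp add: limit_cdf_def)
    qed
    have "((\<lambda>y. c / safety * exp (- (R * - y))) \<longlongrightarrow> c / safety * 0) at_bot"
      by (intro tendsto_mult tendsto_const filterlim_compose[OF exp_decay_tendsto filterlim_uminus_at_top_at_bot])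
    then show "((\<lambda>y. c / safety * exp (- (R * - y))) \<longlongrightarrow> 0) at_bot" by simp
  qed
  have top: "(limit_cdf \<longlongrightarrow> 1) at_top"
    by (rule tendsto_eventually) (use eventually_ge_at_top[of 0] in eventually_elim, simp add: limit_cdf_def limit_tail_0)
  show "limit_deficit_law c rate claim_mean F R (interval_measure limit_cdf)"
    unfolding limit_deficit_law_iff
    by (intro conjI real_distribution_interval_measure cdf_interval_measure limit_cdf_mono rc bot top)
  show "\<nu> = interval_measure limit_cdf" if "limit_deficit_law c rate claim_mean F R \<nu>" for \<nu>
    using that unfolding limit_deficit_law_iff
    by (intro cdf_unique) (auto intro!: real_distribution_interval_measure simp: cdf_interval_measure limit_cdf_mono rc bot top)
qed

end


section \<open>Convergence of the deficit law\<close>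

context exponential_ruin
begin

text \<open>It suffices to consider preimages of \<open>{..<y}\<close>. For \<open>y \<le> 0\<close>
  this is a first-passage event with threshold \<open>a = - y\<close>; for \<open>y > 0\<close> it
  is the whole ruin event, since the surplus at ruin is negative.\<close>

lemma deficit_measurable:
  assumes u: "0 \<le> u"
  shows "(\<lambda>\<omega>. surplus c N X u (real_of_ereal (ruin_time c N X u \<omega>)) \<omega>)
    \<in> borel_measurable (restrict_space M {\<omega>\<in>space M. ruin_time c N X u \<omega> < \<infinity>})"
    and "{\<omega>\<in>space M. ruin_time c N X u \<omega> < \<infinity>} \<in> events"
proof -
  let ?E = "{\<omega>\<in>space M. ruin_time c N X u \<omega> < \<infinity>}"
  let ?f = "\<lambda>\<omega>. surplus c N X u (real_of_ereal (ruin_time c N X u \<omega>)) \<omega>"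
  have "?E = {\<omega>\<in>space M. ruins_below c N X 0 u \<omega>}"
    using ruin_time_finite_iff[OF _ c_pos u] by blast
  then show E: "?E \<in> events" using ruins_below_event[OF c_pos u order_refl] by (simp only:)
  show "?f \<in> borel_measurable (restrict_space M ?E)"
  proof (rule borel_measurableI_less)
    fix y
    have "{\<omega>\<in>space (restrict_space M ?E). ?f \<omega> < y} = (if y \<le> 0 then {\<omega>\<in>space M. ruins_below c N X (- y) u \<omega>} else ?E)"
    proof (cases "y \<le> 0")
      case True
      then have neg: "0 \<le> - y" by simp
      have "{\<omega>\<in>space (restrict_space M ?E). ?f \<omega> < y} = {\<omega>\<in>space M. ruin_time c N X u \<omega> < \<infinity> \<and> ?f \<omega> < - (- y)}"
        by (auto simp: space_restrict_space)
      also have "\<dots> = {\<omega>\<in>space M. ruins_below c N X (- y) u \<omega>}"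
        using deficit_iff[OF _ c_pos u neg, of _ X] by (intro Collect_cong conj_cong refl)
      finally show ?thesis using True by simp
    next
      case False
      have "?f \<omega> < y" if "\<omega> \<in> ?E" for \<omega>
        using deficit_iff[OF _ c_pos u order_refl, of \<omega> X] ruin_time_finite_iff[OF _ c_pos u, of \<omega> X] that False by simp
      then have "{\<omega>\<in>space (restrict_space M ?E). ?f \<omega> < y} = ?E" by (auto simp: space_restrict_space)
      then show ?thesis using False by simp
    qed
    moreover have "{\<omega>\<in>space M. ruins_below c N X (- y) u \<omega>} \<in> events" if "y \<le> 0"
      using that by (intro ruins_below_event c_pos u) simp
    ultimately have ev: "{\<omega>\<in>space (restrict_space M ?E). ?f \<omega> < y} \<in> events"
      using E by (cases "y \<le> 0") (simp_all only: if_True if_False simp_thms)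
    have sub: "{\<omega>\<in>space (restrict_space M ?E). ?f \<omega> < y} \<subseteq> ?E"
      by (auto simp: space_restrict_space)
    show "{\<omega>\<in>space (restrict_space M ?E). ?f \<omega> < y} \<in> sets (restrict_space M ?E)"
      by (rule sets_restrict_space_iff[THEN iffD2, OF sets.Int[OF E sets.top] conjI[OF sub ev]])
  qed
qed

lemma sets_ruin_law [simp, measurable_cong]: "sets (ruin_law M c N X u) = sets borel"
  by (simp add: ruin_law_def)

lemma space_ruin_law [simp]: "space (ruin_law M c N X u) = UNIV"
  by (simp add: ruin_law_def)

lemma finite_ruin_law:
  assumes "0 \<le> u" shows "finite_measure (ruin_law M c N X u)"
  unfolding ruin_law_def
  by (intro finite_measure.finite_measure_distr finite_measure_restrict_space deficit_measurable[OF assms])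
     (auto intro: finite_measure_axioms)

lemma ruin_law_below:
  assumes u: "0 \<le> u" and a: "0 \<le> a"
  shows "measure (ruin_law M c N X u) {..<- a} = below0 c a u"
proof -
  let ?E = "{\<omega>\<in>space M. ruin_time c N X u \<omega> < \<infinity>}"
  let ?f = "\<lambda>\<omega>. surplus c N X u (real_of_ereal (ruin_time c N X u \<omega>)) \<omega>"
  have "measure (ruin_law M c N X u) {..<- a} = measure (restrict_space M ?E) (?f -` {..<- a} \<inter> space (restrict_space M ?E))"
    unfolding ruin_law_def by (rule measure_distr[OF deficit_measurable(1)[OF u]]) simp
  also have "?f -` {..<- a} \<inter> space (restrict_space M ?E) = {\<omega>\<in>space M. ruin_time c N X u \<omega> < \<infinity> \<and> ?f \<omega> < - a}"
    by (auto simp: space_restrict_space)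
  also have "measure (restrict_space M ?E) \<dots> = prob {\<omega>\<in>space M. ruin_time c N X u \<omega> < \<infinity> \<and> ?f \<omega> < - a}"
    using deficit_measurable(2)[OF u] by (intro measure_restrict_space) auto
  also have "{\<omega>\<in>space M. ruin_time c N X u \<omega> < \<infinity> \<and> ?f \<omega> < - a} = {\<omega>\<in>space M. ruins_below c N X a u \<omega>}"
    using deficit_iff[OF _ c_pos u a, of _ X] by (intro Collect_cong conj_cong refl)
  finally show ?thesis using u by (simp only: below0_def below_prob_def if_True)
qed

lemma ruin_law_total:
  assumes u: "0 \<le> u" shows "measure (ruin_law M c N X u) UNIV = ruin u"
proof -
  let ?E = "{\<omega>\<in>space M. ruin_time c N X u \<omega> < \<infinity>}"
  let ?f = "\<lambda>\<omega>. surplus c N X u (real_of_ereal (ruin_time c N X u \<omega>)) \<omega>"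
  have "measure (ruin_law M c N X u) UNIV = measure (restrict_space M ?E) (?f -` UNIV \<inter> space (restrict_space M ?E))"
    unfolding ruin_law_def by (rule measure_distr[OF deficit_measurable(1)[OF u]]) simp
  also have "?f -` UNIV \<inter> space (restrict_space M ?E) = ?E" by (auto simp: space_restrict_space)
  also have "measure (restrict_space M ?E) ?E = prob ?E"
    using deficit_measurable(2)[OF u] by (intro measure_restrict_space) auto
  also have "\<dots> = ruin u" using ruin_prob_eq[OF u] by (simp only: ruin_prob_def)
  finally show ?thesis .
qed

lemma ruin_law_Iic_bounds:
  assumes u: "0 \<le> u"
  shows "0 \<le> a \<Longrightarrow> below0 c a u \<le> measure (ruin_law M c N X u) {..- a}"
    and "0 \<le> a \<Longrightarrow> - a > y \<Longrightarrow> measure (ruin_law M c N X u) {..y} \<le> below0 c a u"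
proof -
  interpret L: finite_measure "ruin_law M c N X u" by (rule finite_ruin_law[OF u])
  show "below0 c a u \<le> measure (ruin_law M c N X u) {..- a}" if "0 \<le> a"
    unfolding ruin_law_below[OF u that, symmetric] by (intro L.finite_measure_mono) auto
  show "measure (ruin_law M c N X u) {..y} \<le> below0 c a u" if "0 \<le> a" "- a > y"
    unfolding ruin_law_below[OF u that(1), symmetric] using that by (intro L.finite_measure_mono) auto
qed

text \<open>First-passage events describe open half-lines, the cdf closed ones. The lower bound is
  immediate; for the upper bound \<open>{..y}\<close> is enclosed in \<open>{..<z}\<close> with
  \<open>z\<close> slightly above \<open>y\<close>, and continuity of \<open>limit_cdf\<close>
  closes the gap.\<close>

lemma ruin_law_cdf_tendsto:
  "((\<lambda>u. measure (ruin_law M c N X u) {..y} / ruin u) \<longlongrightarrow> limit_cdf y) at_top"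
proof (cases "0 \<le> y")
  case True
  have "eventually (\<lambda>u. measure (ruin_law M c N X u) {..y} / ruin u = limit_cdf y) at_top"
    using eventually_ge_at_top[of 0] ruin_pos
  proof eventually_elim
    case (elim u)
    interpret L: finite_measure "ruin_law M c N X u" by (rule finite_ruin_law[OF elim(1)])
    have "measure (ruin_law M c N X u) {..<0} \<le> measure (ruin_law M c N X u) {..y}"
      using True by (intro L.finite_measure_mono) auto
    moreover have "measure (ruin_law M c N X u) {..y} \<le> measure (ruin_law M c N X u) UNIV"
      by (intro L.finite_measure_mono) auto
    ultimately have "measure (ruin_law M c N X u) {..y} = ruin u"
      using ruin_law_below[OF elim(1) order_refl] ruin_law_total[OF elim(1)] by simp
    then show ?case using elim True by (simp add: limit_cdf_def limit_tail_0)
  qed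
  then show ?thesis by (rule tendsto_eventually)
next
  case False
  then have y: "0 \<le> - y" "limit_cdf y = limit_tail (- y)" by (auto simp: limit_cdf_def)
  show ?thesis
  proof (rule order_tendstoI)
    fix a assume "a < limit_cdf y"
    then have "eventually (\<lambda>u. a < below0 c (- y) u / ruin u) at_top"
      using order_tendstoD(1)[OF deficit_tendsto[OF y(1)]] y(2) by simp
    then show "eventually (\<lambda>u. a < measure (ruin_law M c N X u) {..y} / ruin u) at_top"
      using eventually_ge_at_top[of 0] ruin_pos
    proof eventually_elim
      case (elim u)
      have "below0 c (- y) u \<le> measure (ruin_law M c N X u) {..y}"
        using ruin_law_Iic_bounds(1)[OF elim(2) y(1)] by simp
      then have "below0 c (- y) u / ruin u \<le> measure (ruin_law M c N X u) {..y} / ruin u"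
        using elim by (intro divide_right_mono) auto
      then show ?case using elim by simp
    qed
  next
    fix a assume a: "limit_cdf y < a"
    have "(limit_cdf \<longlongrightarrow> limit_cdf y) (at_right y)"
      using isCont_limit_cdf[of y] by (simp add: isCont_def filterlim_at_split)
    from order_tendstoD(2)[OF this a] obtain b where b: "y < b" "\<And>z. y < z \<Longrightarrow> z < b \<Longrightarrow> limit_cdf z < a"
      unfolding eventually_at_right_field by auto
    obtain z where z: "y < z" "z < min b 0" using dense[of y "min b 0"] b False by auto
    then have "limit_tail (- z) < a" using b(2)[of z] by (simp add: limit_cdf_def)
    then have "eventually (\<lambda>u. below0 c (- z) u / ruin u < a) at_top"
      using order_tendstoD(2)[OF deficit_tendsto[of "- z"]] z by simp
    then show "eventually (\<lambda>u. measure (ruin_law M c N X u) {..y} / ruin u < a) at_top"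
      using eventually_ge_at_top[of 0] ruin_pos
    proof eventually_elim
      case (elim u)
      have "measure (ruin_law M c N X u) {..y} \<le> below0 c (- z) u"
        using z by (intro ruin_law_Iic_bounds(2)[OF elim(2)]) auto
      then have "measure (ruin_law M c N X u) {..y} / ruin u \<le> below0 c (- z) u / ruin u"
        using elim by (intro divide_right_mono) auto
      then show ?case using elim by simp
    qed
  qed
qed

section \<open>Weak convergence of the deficit law given ruin\<close>

definition conditional_law :: "real \<Rightarrow> real measure" where
  "conditional_law u = density (ruin_law M c N X u) (\<lambda>_. ennreal (1 / ruin u))"

lemma conditional_law:
  assumes u: "0 \<le> u" "0 < ruin u"
  shows "real_distribution (conditional_law u)"
    and "cdf (conditional_law u) y = measure (ruin_law M c N X u) {..y} / ruin u"
    and "f \<in> borel_measurable borel \<Longrightarrow> integral\<^sup>L (conditional_law u) f = integral\<^sup>L (ruin_law M c N X u) f / (ruin u :: real)"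
proof -
  interpret L: finite_measure "ruin_law M c N X u" by (rule finite_ruin_law[OF u(1)])
  have em: "emeasure (conditional_law u) A = ennreal (measure (ruin_law M c N X u) A / ruin u)" if "A \<in> sets borel" for A
  proof -
    have "emeasure (conditional_law u) A = ennreal (1 / ruin u) * emeasure (ruin_law M c N X u) A"
      unfolding conditional_law_def using that by (subst emeasure_density) (auto simp: nn_integral_cmult_indicator)
    then show ?thesis using u by (simp add: L.emeasure_eq_measure ennreal_mult[symmetric])
  qed
  have "prob_space (conditional_law u)"
  proof
    have "emeasure (conditional_law u) UNIV = 1"
      using u by (subst em) (auto simp: ruin_law_total)
    then show "emeasure (conditional_law u) (space (conditional_law u)) = 1" by (simp add: conditional_law_def)
  qed
  then show "real_distribution (conditional_law u)"
    by (simp add: real_distribution_def real_distribution_axioms_def conditional_law_def)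
  show "cdf (conditional_law u) y = measure (ruin_law M c N X u) {..y} / ruin u"
    unfolding cdf_def using u em[of "{..y}"] by (simp add: measure_def[of "conditional_law u"])
  show "integral\<^sup>L (conditional_law u) f = integral\<^sup>L (ruin_law M c N X u) f / ruin u" if "f \<in> borel_measurable borel"
  proof -
    have "f \<in> borel_measurable (ruin_law M c N X u)"
      using that measurable_cong_sets[OF sets_ruin_law refl] by blast
    then show ?thesis unfolding conditional_law_def using u by (subst integral_density) simp_all
  qed
qed

context
  fixes \<nu> :: "real measure"
  assumes \<nu>: "limit_deficit_law c rate claim_mean F R \<nu>"
begin

interpretation \<nu>: real_distribution \<nu> using \<nu> limit_deficit_law_iff by blast

lemma limit_law_cdf: "cdf \<nu> = limit_cdf" using \<nu> limit_deficit_law_iff by blast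

lemma limit_law_singleton: "measure \<nu> {y} = 0"
  using \<nu>.isCont_cdf[of y] isCont_limit_cdf limit_law_cdf by simp

lemma limit_law_countable:
  assumes "countable A" shows "emeasure \<nu> A = 0"
  using emeasure_countable_singleton[OF _ assms, of \<nu>] limit_law_singleton
  by (simp add: \<nu>.emeasure_eq_measure)

lemma ruin_integral_tendsto:
  fixes \<psi> :: "real \<Rightarrow> real"
  assumes [measurable]: "\<psi> \<in> borel_measurable borel" and bd: "\<And>y. \<bar>\<psi> y\<bar> \<le> B"
    and disc: "countable {y\<in>{..<0}. \<not> isCont \<psi> y}"
  shows "((\<lambda>u. ruin_integral M c N X \<psi> u / ruin u) \<longlongrightarrow> (LINT y:{..<0}|\<nu>. \<psi> y)) at_top"
proof (rule tendsto_at_topI_sequentially)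
  fix v :: "nat \<Rightarrow> real" assume v: "filterlim v at_top sequentially"
  obtain u0 where u0: "0 \<le> u0" "\<And>u. u0 \<le> u \<Longrightarrow> 0 < ruin u"
  proof -
    obtain u0 where "\<And>u. u0 \<le> u \<Longrightarrow> 0 < ruin u" using ruin_pos unfolding eventually_at_top_linorder by auto
    then show ?thesis by (intro that[of "max 0 u0"]) auto
  qed
  \<comment> \<open>Raised to \<open>u0\<close>, so that every member of the sequence has a positive
    ruin probability and all conditional laws are probability measures.\<close>
  define w where "w n = max u0 (v n)" for n
  have w: "0 \<le> w n" "0 < ruin (w n)" for n using u0 unfolding w_def by auto
  have ev: "eventually (\<lambda>n. w n = v n) sequentially"
    using v[unfolded filterlim_at_top, rule_format, of u0] by eventually_elim (simp add: w_def)
  have wt: "filterlim w at_top sequentially"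
    by (rule filterlim_cong[THEN iffD2, OF refl refl ev v])
  let ?f = "\<lambda>y. indicator {..<0} y *\<^sub>R \<psi> y"
  have "weak_conv_m (\<lambda>n. conditional_law (w n)) \<nu>"
    unfolding weak_conv_m_def weak_conv_def limit_law_cdf conditional_law(2)[OF w]
    by (auto intro: filterlim_compose[OF ruin_law_cdf_tendsto wt])
  moreover have "emeasure \<nu> {y. \<not> isCont ?f y} = 0"
  proof (rule limit_law_countable, rule countable_subset)
    \<comment> \<open>Restricting \<open>\<psi>\<close> to the negative half-line can create one new
      discontinuity, at 0.\<close>
    show "countable (insert 0 {y\<in>{..<0}. \<not> isCont \<psi> y})" using disc by simp
    have "isCont ?f y" if y: "y \<noteq> 0" "y < 0 \<Longrightarrow> isCont \<psi> y" for y
    proof (cases "y < 0")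
      case True
      have "eventually (\<lambda>z. ?f z = \<psi> z) (nhds y)"
        using eventually_nhds_in_open[of "{..<0}" y] True by (auto elim: eventually_mono)
      then show ?thesis using isCont_cong[of ?f \<psi> y] y(2)[OF True] by simp
    next
      case False
      then have "0 < y" using y by simp
      have "eventually (\<lambda>z. ?f z = 0) (nhds y)"
        using eventually_nhds_in_open[of "{0<..}" y] \<open>0 < y\<close> by (auto elim: eventually_mono)
      then show ?thesis using isCont_cong[of ?f "\<lambda>_. 0" y] by simp
    qed
    then show "{y. \<not> isCont ?f y} \<subseteq> insert 0 {y\<in>{..<0}. \<not> isCont \<psi> y}" by auto
  qed
  moreover have "norm (?f y) \<le> B" for y using bd[of y] by (auto simp: indicator_def)
  moreover have fm: "?f \<in> borel_measurable borel" by measurable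
  ultimately have "(\<lambda>n. integral\<^sup>L (conditional_law (w n)) ?f) \<longlonglongrightarrow> integral\<^sup>L \<nu> ?f"
    by (intro weak_conv_imp_bdd_ae_continuous_conv conditional_law(1) w \<nu>.real_distribution_axioms)
  then have "(\<lambda>n. ruin_integral M c N X \<psi> (w n) / ruin (w n)) \<longlonglongrightarrow> (LINT y:{..<0}|\<nu>. \<psi> y)"
    unfolding conditional_law(3)[OF w fm] by (simp add: ruin_integral_def set_lebesgue_integral_def)
  then show "(\<lambda>n. ruin_integral M c N X \<psi> (v n) / ruin (v n)) \<longlonglongrightarrow> (LINT y:{..<0}|\<nu>. \<psi> y)"
    by (rule Lim_transform_eventually) (use ev in eventually_elim, simp)
qed

section \<open>The case of a vanishing limit constant\<close>

lemma ruin_law_null: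
  assumes u: "0 \<le> u" and x: "0 \<le> x" "excess x = 0"
  shows "measure (ruin_law M c N X u) {..- x} = 0"
proof -
  interpret L: finite_measure "ruin_law M c N X u" by (rule finite_ruin_law[OF u])
  have "measure (ruin_law M c N X u) {..- x} \<le> 0 + e" if e: "0 < e" for e
  proof (cases "x = 0")
    case True
    have "measure (ruin_law M c N X u) {..- x} \<le> measure (ruin_law M c N X u) UNIV" by (intro L.finite_measure_mono) auto
    also have "\<dots> \<le> 0" using deficit_bound[OF order_refl u] x True by (simp add: ruin_law_total[OF u])
    finally show ?thesis using e by simp
  next
    case False
    define k where "k = 2 * rate / safety"
    have k: "0 < k" using rate_pos safety_pos by (simp add: k_def)
    \<comment> \<open>\<open>excess\<close> is 1-Lipschitz and zero at \<open>x\<close>, so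
      \<open>excess z \<le> e / k\<close>. A threshold \<open>z < x\<close> is taken because
      \<open>below0\<close> counts only deficits strictly above its threshold, while
      \<open>{..- x}\<close> is closed.\<close>
    define z where "z = max 0 (x - e / k)"
    have z: "0 \<le> z" "z < x" "x - z \<le> e / k" using x False e k by (auto simp: z_def)
    have "measure (ruin_law M c N X u) {..- x} \<le> below0 c z u" using z by (intro ruin_law_Iic_bounds(2)[OF u]) auto
    also have "\<dots> \<le> k * excess z" using deficit_bound[OF z(1) u] by (simp add: k_def)
    also have "\<dots> \<le> k * (e / k)" using tail.int_tail_lipschitz[of z x] z x k by (intro mult_left_mono) auto
    finally show ?thesis using k by simp
  qed
  then have "measure (ruin_law M c N X u) {..- x} \<le> 0" by (rule field_le_epsilon)
  then show ?thesis by (simp add: measure_le_0_iff)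
qed

text \<open>Vanishing almost everywhere for \<nu> does not by itself say anything about the deficit
  law at a finite \<open>u\<close>. The shape of \<open>\<psi>\<close> helps: a point of positivity
  comes with an interval of positivity, which \<nu> must not charge; there \<open>limit_tail\<close>
  is flat, so \<open>excess\<close> has already vanished.\<close>

lemma ruin_integral_zero:
  fixes \<psi> :: "real \<Rightarrow> real"
  assumes [measurable]: "\<psi> \<in> borel_measurable borel" and bd: "\<And>y. 0 \<le> \<psi> y" "\<And>y. \<psi> y \<le> 1"
    and shape: "continuous_on {..<0} \<psi> \<or> mono_on {..<0} \<psi> \<or> antimono_on {..<0} \<psi>"
    and zero: "(LINT y:{..<0}|\<nu>. \<psi> y) = 0" and u: "0 \<le> u"
  shows "ruin_integral M c N X \<psi> u = 0"
proof -
  let ?f = "\<lambda>y. indicator {..<0} y *\<^sub>R \<psi> y"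
  have fb: "0 \<le> ?f y" "?f y \<le> 1" for y using bd[of y] by (auto simp: indicator_def)
  have "integrable \<nu> ?f" by (rule \<nu>.integrable_const_bound[where B=1]) (use fb in auto)
  then have ae: "AE y in \<nu>. ?f y = 0"
    using zero fb by (subst (asm) set_lebesgue_integral_def) (simp add: integral_nonneg_eq_0_iff_AE)
  have pos: "excess (- y) = 0" if y: "y < 0" "0 < \<psi> y" for y
  proof -
    \<comment> \<open>Continuity gives an interval around \<open>y\<close>, monotonicity one between
      \<open>y\<close> and 0 or just to the left of \<open>y\<close>. Since
      \<open>y \<le> y2\<close>, a zero of \<open>excess\<close> at \<open>- y2\<close> passes to
      \<open>- y\<close>.\<close>
    obtain y1 y2 where I: "y1 < y2" "y2 \<le> 0" "y \<le> y2" "\<And>z. y1 < z \<Longrightarrow> z < y2 \<Longrightarrow> 0 < \<psi> z"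
      using shape
    proof (elim disjE)
      assume "continuous_on {..<0} \<psi>"
      then have "isCont \<psi> y" using y by (simp add: continuous_on_eq_continuous_at)
      then have "(\<psi> \<longlongrightarrow> \<psi> y) (at y)" by (simp add: isCont_def)
      from order_tendstoD(1)[OF this y(2)] obtain d where d: "0 < d" "\<And>z. z \<noteq> y \<Longrightarrow> dist z y < d \<Longrightarrow> 0 < \<psi> z"
        unfolding eventually_at by auto
      show thesis
      proof (rule that[of "y - d" "min 0 (y + d)"])
        fix z assume "y - d < z" "z < min 0 (y + d)"
        then show "0 < \<psi> z" using d(2)[of z] y(2) by (cases "z = y") (auto simp: dist_real_def)
      qed (use d y in auto)
    next
      assume m: "mono_on {..<0} \<psi>"
      show thesis
      proof (rule that[of y 0])
        fix z assume "y < z" "z < 0"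
        then have "\<psi> y \<le> \<psi> z" using y by (intro mono_onD[OF m]) auto
        then show "0 < \<psi> z" using y by simp
      qed (use y in auto)
    next
      assume m: "antimono_on {..<0} \<psi>"
      show thesis
      proof (rule that[of "y - 1" y])
        fix z assume "y - 1 < z" "z < y"
        then have "\<psi> y \<le> \<psi> z" using y monotone_onD[OF m, of z y] by auto
        then show "0 < \<psi> z" using y by simp
      qed (use y in auto)
    qed
    have "emeasure \<nu> {z\<in>space \<nu>. ?f z \<noteq> 0} = 0"
      using ae by (intro emeasure_eq_0_AE) auto
    moreover have "{y1<..<y2} \<subseteq> {z\<in>space \<nu>. ?f z \<noteq> 0}" using I by (force simp: indicator_def)
    ultimately have "emeasure \<nu> {y1<..<y2} \<le> 0"
      using emeasure_mono[of "{y1<..<y2}" "{z\<in>space \<nu>. ?f z \<noteq> 0}" \<nu>] by simp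
    then have "measure \<nu> {y1<..<y2} = 0" by (simp add: measure_def)
    \<comment> \<open>Differences of the cdf measure half-open intervals; the added endpoint is no
      atom.\<close>
    moreover have "measure \<nu> {y1<..y2} \<le> measure \<nu> {y1<..<y2} + measure \<nu> {y2}"
    proof -
      have "{y1<..y2} = {y1<..<y2} \<union> {y2}" using I(1) by auto
      then show ?thesis using measure_Un_le[of "{y1<..<y2}" \<nu> "{y2}"] by simp
    qed
    ultimately have "measure \<nu> {y1<..y2} = 0" using limit_law_singleton[of y2] by (simp add: measure_le_0_iff)
    then have "limit_cdf y2 = limit_cdf y1" using \<nu>.cdf_diff_eq[OF I(1)] by (simp add: limit_law_cdf)
    then have "limit_tail (- y2) = limit_tail (- y1)" using I by (simp add: limit_cdf_def)
    then have "excess (- y2) = 0" using I by (intro limit_tail_flat[of "- y2" "- y1"]) auto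
    then show ?thesis
      using tail.int_tail_antimono[of "- y2" "- y"] tail.int_tail_nonneg[of "- y"] I by simp
  qed
  have "AE y in ruin_law M c N X u. ?f y = 0"
  proof (cases "\<exists>y<0. 0 < \<psi> y")
    case False
    then have "?f y = 0" for y using bd(1)[of y] by (auto simp: indicator_def not_less intro: antisym)
    then show ?thesis by simp
  next
    case True
    then obtain y0 where y0: "y0 < 0" "0 < \<psi> y0" by auto
    interpret L: finite_measure "ruin_law M c N X u" by (rule finite_ruin_law[OF u])
    let ?Z = "{x. 0 \<le> x \<and> excess x = 0}"
    have ne: "?Z \<noteq> {}" using pos[OF y0] y0 by (auto intro!: exI[of _ "- y0"])
    have bdd: "bdd_below ?Z" by (rule bdd_belowI[of _ 0]) simp
    \<comment> \<open>The least zero of \<open>excess\<close>, attained because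
      \<open>excess\<close> is continuous: the largest possible claim. \<open>\<psi>\<close> can be
      positive only at or below \<open>- x0\<close>, where the deficit law has no mass.\<close>
    define x0 where "x0 = Inf ?Z"
    have x0: "0 \<le> x0" unfolding x0_def using ne by (intro cInf_greatest) auto
    have "excess x0 \<le> 0 + e" if "0 < e" for e
    proof -
      have "Inf ?Z < x0 + e" using that by (simp add: x0_def)
      then obtain z where z: "z \<in> ?Z" "z < x0 + e" using cInf_less_iff[OF ne bdd] by auto
      have "x0 \<le> z" unfolding x0_def by (rule cInf_lower[OF z(1) bdd])
      then show ?thesis using tail.int_tail_lipschitz[OF x0, of z] z by simp
    qed
    then have "excess x0 \<le> 0" by (rule field_le_epsilon)
    then have "excess x0 = 0" using tail.int_tail_nonneg[of x0] by simp
    then have "measure (ruin_law M c N X u) {..- x0} = 0" by (rule ruin_law_null[OF u x0])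
    then have "emeasure (ruin_law M c N X u) {..- x0} = 0" by (simp add: L.emeasure_eq_measure)
    then have "{..- x0} \<in> null_sets (ruin_law M c N X u)" by (simp add: null_sets_def)
    moreover have "{y\<in>space (ruin_law M c N X u). ?f y \<noteq> 0} \<subseteq> {..- x0}"
    proof
      fix y assume "y \<in> {y\<in>space (ruin_law M c N X u). ?f y \<noteq> 0}"
      then have "y < 0" "0 < \<psi> y" using bd(1)[of y] by (auto simp: indicator_def less_le split: if_splits)
      then have "- y \<in> ?Z" using pos by simp
      then have "x0 \<le> - y" unfolding x0_def by (intro cInf_lower bdd)
      then show "y \<in> {..- x0}" by simp
    qed
    ultimately show ?thesis by (rule AE_I')
  qed
  then show ?thesis
    unfolding ruin_integral_def set_lebesgue_integral_def by (rule integral_eq_zero_AE)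
qed

lemma ruin_integral_asymp_equiv:
  fixes \<psi> :: "real \<Rightarrow> real"
  assumes meas: "\<psi> \<in> borel_measurable borel" and bd: "\<And>y. 0 \<le> \<psi> y" "\<And>y. \<psi> y \<le> 1"
    and shape: "continuous_on {..<0} \<psi> \<or> mono_on {..<0} \<psi> \<or> antimono_on {..<0} \<psi>"
  shows "ruin_integral M c N X \<psi> \<sim>[at_top] (\<lambda>u. (LINT y:{..<0}|\<nu>. \<psi> y) * ruin_prob M c N X u)"
proof (cases "(LINT y:{..<0}|\<nu>. \<psi> y) = 0")
  case True
  have "eventually (\<lambda>u. ruin_integral M c N X \<psi> u = 0) at_top"
    using eventually_ge_at_top[of 0] by eventually_elim (rule ruin_integral_zero[OF meas bd shape True])
  then show ?thesis using True by simp
next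
  case False
  have disc: "countable {y\<in>{..<0}. \<not> isCont \<psi> y}"
    using shape
  proof (elim disjE)
    assume "continuous_on {..<0} \<psi>"
    then have "{y\<in>{..<0}. \<not> isCont \<psi> y} = {}" by (auto simp: continuous_on_eq_continuous_at)
    then show ?thesis by (metis countable_empty)
  next
    assume "mono_on {..<0} \<psi>"
    then show ?thesis by (intro mono_on_ctble_discont_open) auto
  next
    assume "antimono_on {..<0} \<psi>"
    then have "mono_on {..<0} (\<lambda>y. - \<psi> y)" by (auto simp: monotone_on_def)
    then have "countable {y\<in>{..<0}. \<not> isCont (\<lambda>y. - \<psi> y) y}" by (intro mono_on_ctble_discont_open) auto
    moreover have "isCont (\<lambda>y. - \<psi> y) y \<longleftrightarrow> isCont \<psi> y" for y
      using continuous_minus[of "at y" \<psi>] continuous_minus[of "at y" "\<lambda>y. - \<psi> y"] by auto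
    ultimately show ?thesis by simp
  qed
  have "((\<lambda>u. ruin_integral M c N X \<psi> u / ruin u) \<longlongrightarrow> (LINT y:{..<0}|\<nu>. \<psi> y)) at_top"
    using bd by (intro ruin_integral_tendsto[where B=1] meas disc) auto
  then have "((\<lambda>u. ruin_integral M c N X \<psi> u / ruin_prob M c N X u) \<longlongrightarrow> (LINT y:{..<0}|\<nu>. \<psi> y)) at_top"
    by (rule Lim_transform_eventually) (use eventually_ge_at_top[of 0] in eventually_elim, simp add: ruin_prob_eq)
  then show ?thesis using False by (rule asymp_equivI'_const)
qed

end

end

theorem theorem4p1:
  fixes M :: "'a measure" and N :: "real \<Rightarrow> 'a \<Rightarrow> nat" and X :: "nat \<Rightarrow> 'a \<Rightarrow> real"
    and \<Lambda> :: "'a \<Rightarrow> real"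
    and Q :: "'b measure" and N' :: "real \<Rightarrow> 'b \<Rightarrow> nat" and X' :: "nat \<Rightarrow> 'b \<Rightarrow> real"
    and F :: "real \<Rightarrow> real" and c \<mu> l c\<^sub>l R\<^sub>l :: real and \<psi> :: "real \<Rightarrow> real"
  assumes "0 < c"
    and "mixed_poisson_claims_model M N X F \<Lambda>"
    and "\<mu> = prob_space.expectation M (X 1)"
    and "modified_ruin_probability M c N X \<psi>"
    and "0 < l" and "l < c / \<mu>"
    and "poisson_claims_model Q N' X' F l" \<comment> \<open>the model conditioned on \<open>\<Lambda> = l\<close>\<close>
    and "0 < c\<^sub>l" and "0 < R\<^sub>l"
    and "ruin_prob Q c N' X' \<sim>[at_top] (\<lambda>u. c\<^sub>l * exp (- R\<^sub>l * u))"
    and "continuous_on {..<0} \<psi> \<or> mono_on {..<0} \<psi> \<or> antimono_on {..<0} \<psi>"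
  shows "(\<exists>!\<nu>. limit_deficit_law c l \<mu> F R\<^sub>l \<nu>) \<and>
    (\<forall>\<nu>. limit_deficit_law c l \<mu> F R\<^sub>l \<nu> \<longrightarrow>
       ruin_integral Q c N' X' \<psi>
         \<sim>[at_top] (\<lambda>u. (LINT y:{..<0}|\<nu>. \<psi> y) * ruin_prob Q c N' X' u))"
proof -
  interpret A: mixed_poisson_claims_model M N X F \<Lambda> by fact
  interpret B: poisson_claims_model Q N' X' F l by fact
  \<comment> \<open>Stated for an arbitrary probability space because it is applied both to
    \<open>M\<close> and to \<open>Q\<close>: the mean depends only on the claim law, and this is
    determined by the common \<open>F\<close>.\<close>
  have mean: "claim_sizes.claim_mean P Y = integral\<^sup>L (claim_sizes.D P Y) (\<lambda>y. y)"
    if "claim_sizes P Y F" for P :: "'c measure" and Y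
  proof -
    interpret claim_sizes P Y F by fact
    show ?thesis unfolding D_def claim_mean_def by (subst integral_distr) (auto simp: X_measurable)
  qed
  have "cdf A.D = cdf B.D" using A.X_cdf[of 1] B.X_cdf[of 1] by (simp add: A.D_def B.D_def)
  then have "A.D = B.D" by (intro cdf_unique A.law.real_distribution_axioms B.law.real_distribution_axioms)
  then have "A.claim_mean = B.claim_mean"
    using mean[OF A.claim_sizes_axioms] mean[OF B.claim_sizes_axioms] by simp
  then have \<mu>: "\<mu> = B.claim_mean" using assms(3) by (simp add: A.claim_mean_def)
  have "0 \<le> \<mu>" using B.tail.int_tail_nonneg[of 0] B.tail.int_tail_0 \<mu> by simp
  \<comment> \<open>Division by 0 yields 0, so \<open>\<mu> = 0\<close> would turn
    \<open>l < c / \<mu>\<close> into \<open>l < 0\<close>.\<close>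
  moreover have "\<mu> \<noteq> 0" using assms(5,6) by auto
  ultimately have "l * \<mu> < c" using assms(6) by (simp add: pos_less_divide_eq)
  then interpret B: exponential_ruin Q N' X' F l c R\<^sub>l c\<^sub>l
    using assms \<mu> by unfold_locales auto
  have \<psi>: "\<psi> \<in> borel_measurable borel" "\<And>y. 0 \<le> \<psi> y" "\<And>y. \<psi> y \<le> 1"
    using assms(4) by (auto simp: modified_ruin_probability_def)
  show ?thesis
    unfolding \<mu> using B.limit_deficit_law_exists1 B.ruin_integral_asymp_equiv[OF _ \<psi> assms(11)] by blast
qed

end
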